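(* Let $\Lambda$ be any finite simple graph. Then there exists a finite simple graph $\Gamma = \Gamma(\Lambda)$ such that (1) $A_\Lambda \cong \mathrm{PSO}(A_\Gamma)$, and (2) $\mathrm{PSO}(A_\Gamma)$ has finite index in $\mathrm{Out}(A_\Gamma)$. In particular, every right-angled Artin group is (isomorphic to) a finite-index subgroup of the outer automorphism group of some right-angled Artin group.
   Context: All graphs are finite, undirected, without loops or multiple edges. For a graph $\Gamma$ with vertex set $V(\Gamma)$ and edge set $E(\Gamma)$, the right-angled Artin group is $A_\Gamma = \langle V(\Gamma) \mid [v,w]=1 \text{ for } \{v,w\}\in E(\Gamma)\rangle$ (for the graph with no vertices, $A_\emptyset$ is the trivial group). An automorphism $\phi$ of $A_\Gamma$ is pure symmetric if for every vertex $v\in V(\Gamma)$, $\phi(v)$ is a conjugate of $v$ (the conjugating element may depend on $v$); these form a subgroup $\mathrm{PSA}(A_\Gamma)\le \mathrm{Aut}(A_\Gamma)$. The group of pure symmetric outer automorphisms $\mathrm{PSO}(A_\Gamma)$ is the image of $\mathrm{PSA}(A_\Gamma)$ in $\mathrm{Out}(A_\Gamma)=\mathrm{Aut}(A_\Gamma)/\mathrm{Inn}(A_\Gamma)$. *)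

theory Defs
  imports "HOL-Algebra.Algebra"
begin

definition simple_graph :: "'v set \<Rightarrow> 'v set set \<Rightarrow> bool" where
  "simple_graph V E \<longleftrightarrow> finite V \<and>
     (\<forall>e\<in>E. \<exists>v w. v \<in> V \<and> w \<in> V \<and> v \<noteq> w \<and> e = {v, w})"

text \<open>Words: letters (v, True) stand for v, letters (v, False) for v inverse.\<close>
type_synonym 'v word = "('v \<times> bool) list"

definition words :: "'v set \<Rightarrow> 'v word set" where
  "words V = {w. \<forall>x \<in> set w. fst x \<in> V}"

inductive raag_eq :: "'v set set \<Rightarrow> 'v word \<Rightarrow> 'v word \<Rightarrow> bool" for E where
  refl: "raag_eq E w w"
| sym: "raag_eq E u w \<Longrightarrow> raag_eq E w u"
| trans: "raag_eq E u w \<Longrightarrow> raag_eq E w z \<Longrightarrow> raag_eq E u z"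
| cancel: "raag_eq E (xs @ [(v, b), (v, \<not> b)] @ ys) (xs @ ys)"
| comm: "{v, w} \<in> E \<Longrightarrow> raag_eq E (xs @ [(v, b), (w, c)] @ ys) (xs @ [(w, c), (v, b)] @ ys)"

definition raag_class :: "'v set set \<Rightarrow> 'v word \<Rightarrow> 'v word set" where
  "raag_class E w = {u. raag_eq E w u}"

definition RAAG :: "'v set \<Rightarrow> 'v set set \<Rightarrow> 'v word set monoid" where
  "RAAG V E = \<lparr>carrier = raag_class E ` words V,
     monoid.mult = (\<lambda>A B. {z. \<exists>x\<in>A. \<exists>y\<in>B. raag_eq E (x @ y) z}),
     one = raag_class E []\<rparr>"

definition raag_gen :: "'v set set \<Rightarrow> 'v \<Rightarrow> 'v word set" where
  "raag_gen E v = raag_class E [(v, True)]"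

definition Inn :: "('a, 'b) monoid_scheme \<Rightarrow> ('a \<Rightarrow> 'a) set" where
  "Inn G = {(\<lambda>x \<in> carrier G. g \<otimes>\<^bsub>G\<^esub> x \<otimes>\<^bsub>G\<^esub> inv\<^bsub>G\<^esub> g) | g. g \<in> carrier G}"

definition Out :: "('a, 'b) monoid_scheme \<Rightarrow> ('a \<Rightarrow> 'a) set monoid" where
  "Out G = AutoGroup G Mod Inn G"

definition PSA :: "'v set \<Rightarrow> 'v set set \<Rightarrow> ('v word set \<Rightarrow> 'v word set) set" where
  "PSA V E = {\<phi> \<in> auto (RAAG V E). \<forall>v\<in>V. \<exists>g\<in>carrier (RAAG V E).
      \<phi> (raag_gen E v) = g \<otimes>\<^bsub>RAAG V E\<^esub> raag_gen E v \<otimes>\<^bsub>RAAG V E\<^esub> inv\<^bsub>RAAG V E\<^esub> g}"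

definition PSO :: "'v set \<Rightarrow> 'v set set \<Rightarrow> ('v word set \<Rightarrow> 'v word set) set set" where
  "PSO V E = (\<lambda>\<phi>. Inn (RAAG V E) #>\<^bsub>AutoGroup (RAAG V E)\<^esub> \<phi>) ` PSA V E"

end

theory Submission
  imports Defs "HOL-Library.Countable"
begin

text \<open>
  The graph \<open>\<Gamma>\<close> consists of a copy \<open>L\<close> of \<open>\<Lambda>\<close> and of vertex sets \<open>B\<close>, \<open>C\<close>, \<open>D\<close> such that every vertex of \<open>B\<close>
  is joined to all of \<open>L\<close>, the only edges leaving \<open>C\<close> end in \<open>B\<close>, and \<open>L\<close> is exactly the set of common
  neighbours of \<open>B\<close>. Conjugating all generators in \<open>C\<close> by an element \<open>k\<close> of the subgroup generated by \<open>L\<close>,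
  and fixing the other generators, is then a pure symmetric automorphism. These automorphisms form a
  copy of the group of \<open>\<Lambda>\<close>, which meets the inner automorphisms trivially. The claim is that they
  represent all of the pure symmetric outer automorphisms.

  For every vertex \<open>u\<close> the group is the semidirect product of the subgroup generated by the other
  vertices with a free group on conjugates of \<open>u\<close>, hence it acts on the Cayley tree of that free
  group. An element fixing an edge has exponent zero at all generators outside the star of \<open>u\<close>. So a
  conjugate of a generator \<open>v\<close> outside the star fixes at most one vertex, and everything commuting with
  it fixes that vertex too. If a vertex set \<open>S\<close> stays connected, in a strong sense, after removal of any
  star, all images of \<open>S\<close> under a pure symmetric automorphism fix a common vertex in every tree, and one
  element conjugates all of \<open>S\<close>. This applies to \<open>S = B \<union> D\<close> and to \<open>S = B \<union> C\<close>; after an inner correction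
  the automorphism is the identity on \<open>B \<union> D\<close> and on \<open>L\<close>, and on \<open>B \<union> C\<close> it is conjugation by an
  element that centralizes \<open>B\<close>, that is, by an element of the subgroup generated by \<open>L\<close>.

  For the finite index, let an automorphism \<open>\<phi>\<close> send \<open>v\<close> to an element acting hyperbolically on the tree of
  \<open>u\<close>. The images of the neighbours of \<open>v\<close> act on its axis by translations, so modulo multiples of
  \<open>\<phi> v\<close> their exponents are supported in the star of \<open>u\<close>. Applying this to \<open>\<phi>\<close> and to its inverse, and using
  that \<open>lk v - st v'\<close> always has two elements for \<open>v \<noteq> v'\<close>, one finds that \<open>\<phi> v\<close> is conjugate to \<open>u\<close> or
  its inverse.
\<close>

section \<open>Right-angled Artin groups\<close>

definition winv :: "'v word \<Rightarrow> 'v word" where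
  "winv w = rev (map (\<lambda>(v, b). (v, \<not> b)) w)"

lemma winv_simps [simp]:
  "winv [] = []" "winv ((v, b) # w) = winv w @ [(v, \<not> b)]" "winv (winv w) = w"
  by (auto simp: winv_def rev_map comp_def case_prod_unfold)

lemma winv_words: "w \<in> words V \<Longrightarrow> winv w \<in> words V"
  by (auto simp: words_def winv_def)

lemma raag_eq_context: "raag_eq E u w \<Longrightarrow> raag_eq E (x @ u @ y) (x @ w @ y)"
proof (induction rule: raag_eq.induct)
  case (cancel xs v b ys)
  show ?case using raag_eq.cancel[of E "x @ xs" v b "ys @ y"] by simp
next
  case (comm v w xs b c ys)
  then show ?case using raag_eq.comm[of v w E "x @ xs" b c "ys @ y"] by simp
qed (auto intro: raag_eq.refl raag_eq.sym raag_eq.trans)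

lemma raag_eq_append: "raag_eq E u u' \<Longrightarrow> raag_eq E w w' \<Longrightarrow> raag_eq E (u @ w) (u' @ w')"
  using raag_eq_context[of E u u' "[]" w] raag_eq_context[of E w w' u' "[]"]
  by (auto intro: raag_eq.trans)

lemma raag_eq_winv_right: "raag_eq E (w @ winv w) []"
proof (induction w)
  case (Cons l w)
  obtain v b where l: "l = (v, b)" by fastforce
  have "raag_eq E ([l] @ (w @ winv w) @ [(v, \<not> b)]) ([l] @ [] @ [(v, \<not> b)])"
    by (rule raag_eq_context[OF Cons.IH])
  moreover have "raag_eq E ([] @ [(v, b), (v, \<not> b)] @ []) ([] @ [])"
    by (rule raag_eq.cancel)
  ultimately show ?case by (auto simp: l intro: raag_eq.trans)
qed (auto intro: raag_eq.refl)

lemma raag_class_eq_iff: "raag_class E u = raag_class E w \<longleftrightarrow> raag_eq E u w"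
  unfolding raag_class_def by (auto intro: raag_eq.refl raag_eq.sym raag_eq.trans)

lemma raag_class_mult:
  "raag_class E u \<otimes>\<^bsub>RAAG V E\<^esub> raag_class E w = raag_class E (u @ w)"
  unfolding RAAG_def raag_class_def
  by (auto intro: raag_eq.refl raag_eq.sym raag_eq.trans raag_eq_append)

lemma RAAG_carrier: "carrier (RAAG V E) = raag_class E ` words V"
  and RAAG_one: "\<one>\<^bsub>RAAG V E\<^esub> = raag_class E []"
  by (simp_all add: RAAG_def)

lemma group_RAAG: "group (RAAG V E)"
proof (rule groupI)
  fix x assume "x \<in> carrier (RAAG V E)"
  then obtain w where w: "w \<in> words V" "x = raag_class E w" by (auto simp: RAAG_carrier)
  then have "raag_class E (winv w) \<otimes>\<^bsub>RAAG V E\<^esub> x = \<one>\<^bsub>RAAG V E\<^esub>"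
    using raag_eq_winv_right[of E "winv w"] by (simp add: raag_class_mult RAAG_one raag_class_eq_iff)
  then show "\<exists>y\<in>carrier (RAAG V E). y \<otimes>\<^bsub>RAAG V E\<^esub> x = \<one>\<^bsub>RAAG V E\<^esub>"
    using w winv_words by (auto simp: RAAG_carrier)
next
  fix x y assume "x \<in> carrier (RAAG V E)" "y \<in> carrier (RAAG V E)"
  then obtain u w where "u \<in> words V" "x = raag_class E u" "w \<in> words V" "y = raag_class E w"
    by (auto simp: RAAG_carrier)
  moreover from this have "u @ w \<in> words V" by (auto simp: words_def)
  ultimately show "x \<otimes>\<^bsub>RAAG V E\<^esub> y \<in> carrier (RAAG V E)"
    by (simp add: RAAG_carrier raag_class_mult)
qed (auto simp: RAAG_carrier RAAG_one raag_class_mult words_def)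

lemma (in group) inv_mult_cancel [simp]:
  assumes "x \<in> carrier G" "y \<in> carrier G"
  shows "inv x \<otimes> (x \<otimes> y) = y" "x \<otimes> (inv x \<otimes> y) = y"
  using assms by (simp_all flip: m_assoc)

lemma (in group) commute_inv:
  assumes "x \<otimes> y = y \<otimes> x" "x \<in> carrier G" "y \<in> carrier G"
  shows "x \<otimes> inv y = inv y \<otimes> x"
proof -
  have "inv y \<otimes> (y \<otimes> x) \<otimes> inv y = inv y \<otimes> (x \<otimes> y) \<otimes> inv y" by (simp add: assms(1))
  then show ?thesis using assms(2,3) by (simp add: m_assoc)
qed

text \<open>The laws are asked only on \<open>A\<close>, since actions used below violate them
  elsewhere: pushing a letter after its inverse restores reduced words only.\<close>

definition raag_action :: "'v set set \<Rightarrow> ('v \<times> bool \<Rightarrow> 'x \<Rightarrow> 'x) \<Rightarrow> 'x set \<Rightarrow> bool" where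
  "raag_action E act A \<longleftrightarrow>
     (\<forall>l. \<forall>x\<in>A. act l x \<in> A) \<and>
     (\<forall>v b. \<forall>x\<in>A. act (v, b) (act (v, \<not> b) x) = x) \<and>
     (\<forall>v w b c. \<forall>x\<in>A. {v, w} \<in> E \<longrightarrow> act (v, b) (act (w, c) x) = act (w, c) (act (v, b) x))"

lemma foldr_raag_action_closed: "raag_action E act A \<Longrightarrow> x \<in> A \<Longrightarrow> foldr act w x \<in> A"
  by (induction w) (auto simp: raag_action_def)

lemma raag_eq_foldr_action:
  assumes "raag_eq E u w" and act: "raag_action E act A" and "x \<in> A"
  shows "foldr act u x = foldr act w x"
  using assms(1)
proof (induction rule: raag_eq.induct)
  case (cancel xs v b ys)
  then show ?case
    using foldr_raag_action_closed[OF act \<open>x \<in> A\<close>, of ys] act by (simp add: raag_action_def)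
next
  case (comm v w xs b c ys)
  then have "act (v, b) (act (w, c) (foldr act ys x)) = act (w, c) (act (v, b) (foldr act ys x))"
    using foldr_raag_action_closed[OF act \<open>x \<in> A\<close>, of ys] act unfolding raag_action_def by blast
  then show ?case by simp
qed auto

locale raag =
  fixes V :: "'v set" and E :: "'v set set" and G (structure)
  assumes simple: "simple_graph V E" and G_eq: "G = RAAG V E"
begin

sublocale group G
  unfolding G_eq by (rule group_RAAG)

abbreviation gen :: "'v \<Rightarrow> 'v word set" where "gen v \<equiv> raag_gen E v"

definition lk :: "'v \<Rightarrow> 'v set" where "lk v = {w. {v, w} \<in> E}"

abbreviation st :: "'v \<Rightarrow> 'v set" where "st v \<equiv> insert v (lk v)"

lemma finite_V: "finite V"
  using simple by (simp add: simple_graph_def)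

lemma edgeD: "{v, w} \<in> E \<Longrightarrow> v \<in> V \<and> w \<in> V \<and> v \<noteq> w"
  using simple unfolding simple_graph_def by (metis doubleton_eq_iff)

lemma lk_sym: "w \<in> lk v \<longleftrightarrow> v \<in> lk w"
  by (simp add: lk_def insert_commute)

lemma st_sym: "w \<in> st v \<longleftrightarrow> v \<in> st w"
  using lk_sym by blast

lemma lkD: "w \<in> lk v \<Longrightarrow> v \<in> V \<and> w \<in> V \<and> v \<noteq> w"
  using edgeD by (simp add: lk_def)

lemma gen_closed [simp]: "v \<in> V \<Longrightarrow> gen v \<in> carrier G"
  by (auto simp: raag_gen_def G_eq RAAG_carrier words_def)

lemma inv_gen: "v \<in> V \<Longrightarrow> inv (gen v) = raag_class E [(v, False)]"
proof (rule inv_equality)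
  show "raag_class E [(v, False)] \<otimes> gen v = \<one>"
    using raag_eq_winv_right[of E "[(v, False)]"]
    by (simp add: raag_gen_def G_eq raag_class_mult RAAG_one raag_class_eq_iff)
qed (auto simp: raag_gen_def G_eq RAAG_carrier words_def)

lemma gen_commute: "w \<in> lk v \<Longrightarrow> gen v \<otimes> gen w = gen w \<otimes> gen v"
  using raag_eq.comm[of v w E "[]" True True "[]"]
  by (simp add: lk_def raag_gen_def G_eq raag_class_mult raag_class_eq_iff)

lemma raag_induct [consumes 1, case_names one gen inv_gen]:
  assumes "g \<in> carrier G" and "P \<one>"
    and "\<And>v g. v \<in> V \<Longrightarrow> g \<in> carrier G \<Longrightarrow> P g \<Longrightarrow> P (gen v \<otimes> g)"
    and "\<And>v g. v \<in> V \<Longrightarrow> g \<in> carrier G \<Longrightarrow> P g \<Longrightarrow> P (inv (gen v) \<otimes> g)"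
  shows "P g"
proof -
  have "P (raag_class E w)" if "w \<in> words V" for w
    using that
  proof (induction w)
    case Nil
    then show ?case using \<open>P \<one>\<close> by (simp add: G_eq RAAG_one)
  next
    case (Cons l w)
    obtain v b where l: "l = (v, b)" by fastforce
    from Cons have *: "v \<in> V" "w \<in> words V" "P (raag_class E w)" by (auto simp: words_def l)
    have "raag_class E (l # w) = raag_class E [l] \<otimes> raag_class E w"
      by (simp add: G_eq raag_class_mult)
    also have "raag_class E [l] = (if b then gen v else inv (gen v))"
      using * by (simp add: inv_gen l) (simp add: raag_gen_def)
    finally show ?case using assms(3,4) * by (auto simp: G_eq RAAG_carrier)
  qed
  then show ?thesis using assms(1) by (auto simp: G_eq RAAG_carrier)
qed

text \<open>Any representing word will do once \<open>raag_action\<close> holds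
  (\<open>gact_class\<close>), so the choice made by \<open>SOME\<close> is harmless.\<close>

definition gact :: "('v \<times> bool \<Rightarrow> 'x \<Rightarrow> 'x) \<Rightarrow> 'v word set \<Rightarrow> 'x \<Rightarrow> 'x" where
  "gact act g = foldr act (SOME w. g = raag_class E w)"

lemma gact_class:
  assumes "raag_action E act A" "x \<in> A"
  shows "gact act (raag_class E w) x = foldr act w x"
proof -
  have "raag_class E w = raag_class E (SOME w'. raag_class E w = raag_class E w')"
    by (rule someI) simp
  then show ?thesis
    using raag_eq_foldr_action[OF _ assms] unfolding gact_def raag_class_eq_iff by metis
qed

lemma gact_closed:
  assumes "raag_action E act A" "x \<in> A" "g \<in> carrier G"
  shows "gact act g x \<in> A"
  using assms foldr_raag_action_closed by (auto simp: gact_class G_eq RAAG_carrier)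

lemma gact_one: "raag_action E act A \<Longrightarrow> x \<in> A \<Longrightarrow> gact act \<one> x = x"
  by (simp add: gact_class G_eq RAAG_one)

lemma gact_mult:
  assumes "raag_action E act A" "x \<in> A" "g \<in> carrier G" "h \<in> carrier G"
  shows "gact act (g \<otimes> h) x = gact act g (gact act h x)"
proof -
  obtain u w where "g = raag_class E u" "h = raag_class E w"
    using assms by (auto simp: G_eq RAAG_carrier)
  then show ?thesis
    using assms foldr_raag_action_closed[OF assms(1,2), of w]
    by (simp add: G_eq raag_class_mult gact_class)
qed

lemma gact_gen: "raag_action E act A \<Longrightarrow> x \<in> A \<Longrightarrow> gact act (gen v) x = act (v, True) x"
  by (simp add: gact_class raag_gen_def)

lemma gact_inv_gen:
  "raag_action E act A \<Longrightarrow> x \<in> A \<Longrightarrow> v \<in> V \<Longrightarrow> gact act (inv (gen v)) x = act (v, False) x"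
  by (simp add: gact_class inv_gen)

section \<open>The universal property\<close>

lemma hom_eqI:
  assumes "group K" "f \<in> hom G K" "f' \<in> hom G K" "\<And>v. v \<in> V \<Longrightarrow> f (gen v) = f' (gen v)"
    and "g \<in> carrier G"
  shows "f g = f' g"
proof -
  interpret f: group_hom G K f using assms is_group by (simp add: group_hom_def group_hom_axioms_def)
  interpret f': group_hom G K f' using assms is_group by (simp add: group_hom_def group_hom_axioms_def)
  show ?thesis using assms(5) by (induction rule: raag_induct) (simp_all add: assms(4))
qed

text \<open>The universal property is realized by an action: letters multiply \<open>K\<close> from
  the left, and \<open>g\<close> is sent to the image of the identity. Letters outside
  \<open>V\<close> act trivially because \<open>raag_action\<close> quantifies over all
  letters.\<close>

definition lift :: "('b, 'c) monoid_scheme \<Rightarrow> ('v \<Rightarrow> 'b) \<Rightarrow> 'v word set \<Rightarrow> 'b" where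
  "lift K f g = gact (\<lambda>(v, b) a. if v \<notin> V then a else (if b then f v else inv\<^bsub>K\<^esub> (f v)) \<otimes>\<^bsub>K\<^esub> a) g \<one>\<^bsub>K\<^esub>"

lemma lift_hom_gen:
  assumes K: "group K" and f: "\<And>v. v \<in> V \<Longrightarrow> f v \<in> carrier K"
    and comm: "\<And>v w. w \<in> lk v \<Longrightarrow> f v \<otimes>\<^bsub>K\<^esub> f w = f w \<otimes>\<^bsub>K\<^esub> f v"
  shows "lift K f \<in> hom G K" and "\<And>v. v \<in> V \<Longrightarrow> lift K f (gen v) = f v"
proof -
  interpret K: group K by fact
  let ?act = "\<lambda>(v, b) a. if v \<notin> V then a else (if b then f v else inv\<^bsub>K\<^esub> (f v)) \<otimes>\<^bsub>K\<^esub> a"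
  have comm': "x \<otimes>\<^bsub>K\<^esub> y = y \<otimes>\<^bsub>K\<^esub> x"
    if "{v, w} \<in> E" "x \<in> {f v, inv\<^bsub>K\<^esub> (f v)}" "y \<in> {f w, inv\<^bsub>K\<^esub> (f w)}" for x y v w
  proof -
    have 1: "f v \<in> carrier K" "f w \<in> carrier K" "f v \<otimes>\<^bsub>K\<^esub> f w = f w \<otimes>\<^bsub>K\<^esub> f v"
      using that edgeD f comm by (auto simp: lk_def)
    show ?thesis
      using that(2,3) 1 K.commute_inv[OF 1(3,1,2)] K.commute_inv[OF 1(3)[symmetric] 1(2,1)]
        K.commute_inv[of "inv\<^bsub>K\<^esub> (f v)" "f w"]
      by auto
  qed
  have act: "raag_action E ?act (carrier K)"
    unfolding raag_action_def
  proof (intro conjI allI ballI impI)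
    fix v w b c x assume *: "{v, w} \<in> E" "x \<in> carrier K"
    let ?p = "if b then f v else inv\<^bsub>K\<^esub> (f v)" and ?q = "if c then f w else inv\<^bsub>K\<^esub> (f w)"
    have "?p \<otimes>\<^bsub>K\<^esub> ?q = ?q \<otimes>\<^bsub>K\<^esub> ?p" by (rule comm'[OF *(1)]) auto
    moreover have "?p \<in> carrier K" "?q \<in> carrier K" using edgeD[OF *(1)] f by auto
    ultimately have "?p \<otimes>\<^bsub>K\<^esub> (?q \<otimes>\<^bsub>K\<^esub> x) = ?q \<otimes>\<^bsub>K\<^esub> (?p \<otimes>\<^bsub>K\<^esub> x)"
      using *(2) by (simp flip: K.m_assoc)
    then show "?act (v, b) (?act (w, c) x) = ?act (w, c) (?act (v, b) x)"
      using edgeD[OF *(1)] by auto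
  qed (auto simp: f K.m_assoc[symmetric])
  have one: "\<one>\<^bsub>K\<^esub> \<in> carrier K" by simp
  \<comment> \<open>On all of \<open>K\<close> the element \<open>g\<close> acts as left
    multiplication by \<open>lift K f g\<close>; composing two such maps gives
    multiplicativity.\<close>
  have mult: "gact ?act g a = lift K f g \<otimes>\<^bsub>K\<^esub> a" if "g \<in> carrier G" "a \<in> carrier K" for g a
    using that(1)
  proof (induction rule: raag_induct)
    case one
    then show ?case using that by (simp add: lift_def gact_one[OF act])
  next
    case (gen v g)
    then show ?case using that gact_closed[OF act]
      by (simp add: lift_def gact_mult[OF act] gact_gen[OF act] K.m_assoc f)
  next
    case (inv_gen v g)
    then show ?case using that gact_closed[OF act]
      by (simp add: lift_def gact_mult[OF act] gact_inv_gen[OF act] K.m_assoc f)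
  qed
  show "lift K f \<in> hom G K"
  proof (rule homI)
    fix g assume g: "g \<in> carrier G"
    show closed: "lift K f g \<in> carrier K" unfolding lift_def by (rule gact_closed[OF act one g])
    fix h assume h: "h \<in> carrier G"
    have "lift K f h \<in> carrier K" unfolding lift_def by (rule gact_closed[OF act one h])
    then show "lift K f (g \<otimes> h) = lift K f g \<otimes>\<^bsub>K\<^esub> lift K f h"
      using mult[OF g, of "lift K f h"] by (simp add: lift_def gact_mult[OF act one g h])
  qed
  show "lift K f (gen v) = f v" if "v \<in> V" for v
    using that f by (simp add: lift_def gact_gen[OF act one])
qed

text \<open>The exponent sum of \<open>t\<close>, a coordinate of the abelianization, obtained from
  translations of the integers.\<close>

definition expo :: "'v \<Rightarrow> 'v word set \<Rightarrow> int" where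
  "expo t g = gact (\<lambda>(v, b) k. if v = t then (if b then k + 1 else k - 1) else k) g 0"

lemma expo_gact:
  assumes "g \<in> carrier G"
  shows "gact (\<lambda>(v, b) k. if v = t then (if b then k + 1 else k - 1) else k) g k = expo t g + k"
proof -
  have act: "raag_action E (\<lambda>(v, b) k. if v = t then (if b then k + 1 else k - 1) else k) (UNIV::int set)"
    using edgeD by (auto simp: raag_action_def)
  show ?thesis using assms
    by (induction rule: raag_induct)
       (auto simp: expo_def gact_one[OF act] gact_mult[OF act] gact_gen[OF act] gact_inv_gen[OF act])
qed

lemma expo_mult [simp]:
  assumes "g \<in> carrier G" "h \<in> carrier G"
  shows "expo t (g \<otimes> h) = expo t g + expo t h"
proof -
  have act: "raag_action E (\<lambda>(v, b) k. if v = t then (if b then k + 1 else k - 1) else k) (UNIV::int set)"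
    using edgeD by (auto simp: raag_action_def)
  show ?thesis
    using assms expo_gact[of g t "expo t h"] by (simp add: expo_def gact_mult[OF act])
qed

lemma expo_gen [simp]: "expo t (gen v) = (if v = t then 1 else 0)"
proof -
  have act: "raag_action E (\<lambda>(v, b) k. if v = t then (if b then k + 1 else k - 1) else k) (UNIV::int set)"
    using edgeD by (auto simp: raag_action_def)
  show ?thesis by (simp add: expo_def gact_gen[OF act])
qed

lemma expo_one [simp]: "expo t \<one> = 0"
  using expo_mult[of \<one> \<one> t] by simp

lemma expo_inv [simp]: "g \<in> carrier G \<Longrightarrow> expo t (inv g) = - expo t g"
  using expo_mult[of "inv g" g t] by simp

lemma expo_nat_pow [simp]: "g \<in> carrier G \<Longrightarrow> expo t (g [^] (n::nat)) = int n * expo t g"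
  by (induction n) (auto simp: algebra_simps)

lemma expo_int_pow [simp]: "g \<in> carrier G \<Longrightarrow> expo t (g [^] (n::int)) = n * expo t g"
  by (cases n rule: int_cases2) (simp_all add: int_pow_int int_pow_neg_int)

text \<open>Sending \<open>u\<close> and \<open>t\<close> to the integral Heisenberg group, acting on \<open>\<int>\<^sup>2\<close>, detects the exponent of \<open>t\<close>.\<close>
lemma commute_gen_imp_expo_zero:
  assumes u: "u \<in> V" and t: "t \<notin> st u" and g: "g \<in> carrier G" and comm: "g \<otimes> gen u = gen u \<otimes> g"
  shows "expo t g = 0"
proof -
  define act :: "'v \<times> bool \<Rightarrow> int \<times> int \<Rightarrow> int \<times> int" where
    "act = (\<lambda>(v, b) (p, q). if v = u then (if b then p + 1 else p - 1, q)
       else if v = t then (p, if b then q + p else q - p) else (p, q))"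
  have act_simp: "act (v, b) (p, q) = (if v = u then (if b then p + 1 else p - 1, q)
       else if v = t then (p, if b then q + p else q - p) else (p, q))" for v b p q
    by (simp add: act_def)
  \<comment> \<open>The maps for \<open>u\<close> and \<open>t\<close> do not commute; this is
    allowed because \<open>t \<notin> st u\<close> means that no edge joins them.\<close>
  have act: "raag_action E act UNIV"
    using t by (auto simp: raag_action_def act_def lk_def insert_commute)
  have "\<exists>c. \<forall>p q. gact act g (p, q) = (p + expo u g, q + expo t g * p + c)"
    using g
  proof (induction rule: raag_induct)
    case one
    show ?case by (simp add: gact_one[OF act])
  next
    case (gen v g)
    then obtain c where c: "\<And>p q. gact act g (p, q) = (p + expo u g, q + expo t g * p + c)" by blast
    have "gact act (gen v \<otimes> g) (p, q) = act (v, True) (gact act g (p, q))" for p q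
      using gen by (simp add: gact_mult[OF act] gact_gen[OF act])
    then show ?case using gen(1,2) t
      by (intro exI[of _ "c + (if v = t then expo u g else 0)"]) (auto simp: c act_simp algebra_simps)
  next
    case (inv_gen v g)
    then obtain c where c: "\<And>p q. gact act g (p, q) = (p + expo u g, q + expo t g * p + c)" by blast
    have "gact act (inv (gen v) \<otimes> g) (p, q) = act (v, False) (gact act g (p, q))" for p q
      using inv_gen by (simp add: gact_mult[OF act] gact_inv_gen[OF act])
    then show ?case using inv_gen(1,2) t
      by (intro exI[of _ "c - (if v = t then expo u g else 0)"]) (auto simp: c act_simp algebra_simps)
  qed
  then obtain c where c: "\<And>p q. gact act g (p, q) = (p + expo u g, q + expo t g * p + c)" by blast
  \<comment> \<open>Here \<open>g\<close> is applied once at p = 1 and once at p = 0, so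
    \<open>c\<close> cancels and the second coordinates differ by \<open>expo t g\<close>.\<close>
  have "gact act g (1, 0) = gact act (g \<otimes> gen u) (0, 0)"
    using g u by (simp add: gact_mult[OF act] gact_gen[OF act] act_simp)
  also have "\<dots> = act (u, True) (gact act g (0, 0))"
    using g u by (simp add: comm gact_mult[OF act] gact_gen[OF act])
  finally show ?thesis by (simp add: c act_simp)
qed

section \<open>Conjugation\<close>

definition cj :: "'v word set \<Rightarrow> 'v word set \<Rightarrow> 'v word set" where
  "cj g x = g \<otimes> x \<otimes> inv g"

lemma cj_closed [simp]: "g \<in> carrier G \<Longrightarrow> x \<in> carrier G \<Longrightarrow> cj g x \<in> carrier G"
  by (simp add: cj_def)

lemma cj_one [simp]: "x \<in> carrier G \<Longrightarrow> cj \<one> x = x" "g \<in> carrier G \<Longrightarrow> cj g \<one> = \<one>"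
  by (simp_all add: cj_def)

lemma cj_cj: "g \<in> carrier G \<Longrightarrow> h \<in> carrier G \<Longrightarrow> x \<in> carrier G \<Longrightarrow> cj g (cj h x) = cj (g \<otimes> h) x"
  by (simp add: cj_def inv_mult_group m_assoc)

lemma cj_inv_cj [simp]:
  "g \<in> carrier G \<Longrightarrow> x \<in> carrier G \<Longrightarrow> cj (inv g) (cj g x) = x"
  "g \<in> carrier G \<Longrightarrow> x \<in> carrier G \<Longrightarrow> cj g (cj (inv g) x) = x"
  by (simp_all add: cj_cj)

lemma cj_inject: "g \<in> carrier G \<Longrightarrow> x \<in> carrier G \<Longrightarrow> y \<in> carrier G \<Longrightarrow> cj g x = cj g y \<longleftrightarrow> x = y"
  by (metis cj_inv_cj(1))

lemma cj_mult:
  "g \<in> carrier G \<Longrightarrow> x \<in> carrier G \<Longrightarrow> y \<in> carrier G \<Longrightarrow> cj g (x \<otimes> y) = cj g x \<otimes> cj g y"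
  by (simp add: cj_def m_assoc)

lemma cj_inv: "g \<in> carrier G \<Longrightarrow> x \<in> carrier G \<Longrightarrow> cj g (inv x) = inv (cj g x)"
  by (simp add: cj_def inv_mult_group m_assoc)

lemma cj_hom: "g \<in> carrier G \<Longrightarrow> cj g \<in> hom G G"
  by (rule homI) (simp_all add: cj_mult)

lemma cj_eq_iff_commute: "g \<in> carrier G \<Longrightarrow> x \<in> carrier G \<Longrightarrow> cj g x = x \<longleftrightarrow> g \<otimes> x = x \<otimes> g"
  unfolding cj_def by (metis inv_closed inv_solve_right m_closed inv_solve_right')

lemma expo_cj [simp]: "g \<in> carrier G \<Longrightarrow> x \<in> carrier G \<Longrightarrow> expo t (cj g x) = expo t x"
  by (simp add: cj_def)

text \<open>The element \<open>inv y \<otimes> inv q \<otimes> p \<otimes> y\<close> centralizes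
  \<open>gen u\<close>, so its exponent at \<open>t\<close> vanishes; the contributions of
  \<open>y\<close> cancel.\<close>

lemma cj_gen_eq_imp_expo_eq:
  assumes "u \<in> V" "t \<notin> st u" "y \<in> carrier G" "p \<in> carrier G" "q \<in> carrier G"
    and eq: "cj p (cj y (gen u)) = cj q (cj y (gen u))"
  shows "expo t p = expo t q"
proof -
  let ?z = "inv y \<otimes> inv q \<otimes> p \<otimes> y"
  have "cj ?z (gen u) = cj (inv y) (cj (inv q) (cj p (cj y (gen u))))"
    using assms(1-5) by (simp add: cj_cj m_assoc)
  also have "\<dots> = gen u" using assms(1-5) by (simp add: eq)
  finally have "expo t ?z = 0"
    using commute_gen_imp_expo_zero[OF assms(1,2), of ?z] assms(1-5) by (simp add: cj_eq_iff_commute)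
  then show ?thesis using assms(3-5) by simp
qed

section \<open>Retractions and parabolic subgroups\<close>

definition retr :: "'v set \<Rightarrow> 'v word set \<Rightarrow> 'v word set" where
  "retr S = lift G (\<lambda>v. if v \<in> S then gen v else \<one>)"

lemma retr_hom: "retr S \<in> hom G G"
  and retr_gen [simp]: "v \<in> V \<Longrightarrow> retr S (gen v) = (if v \<in> S then gen v else \<one>)"
proof -
  have *: "(if w \<in> S then gen w else \<one>) \<in> carrier G" if "w \<in> V" for w
    using that by simp
  have **: "(if v \<in> S then gen v else \<one>) \<otimes> (if w \<in> S then gen w else \<one>) =
      (if w \<in> S then gen w else \<one>) \<otimes> (if v \<in> S then gen v else \<one>)" if "w \<in> lk v" for v w
    using lkD[OF that] gen_commute[OF that] by simp
  show "retr S \<in> hom G G" unfolding retr_def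
    using lift_hom_gen(1)[OF is_group, of "\<lambda>v. if v \<in> S then gen v else \<one>"] * ** by blast
  show "retr S (gen v) = (if v \<in> S then gen v else \<one>)" if "v \<in> V"
    unfolding retr_def
    using lift_hom_gen(2)[OF is_group, of "\<lambda>v. if v \<in> S then gen v else \<one>"] * ** that by blast
qed

lemma retr_closed [simp]: "g \<in> carrier G \<Longrightarrow> retr S g \<in> carrier G"
  by (rule hom_in_carrier[OF retr_hom])

lemma retr_mult [simp]:
  "g \<in> carrier G \<Longrightarrow> h \<in> carrier G \<Longrightarrow> retr S (g \<otimes> h) = retr S g \<otimes> retr S h"
  by (rule hom_mult[OF retr_hom])

lemma retr_one [simp]: "retr S \<one> = \<one>"
  by (rule hom_one[OF retr_hom is_group is_group])

lemma retr_inv [simp]: "g \<in> carrier G \<Longrightarrow> retr S (inv g) = inv (retr S g)"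
  by (metis inv_equality inv_closed l_inv retr_closed retr_mult retr_one)

lemma retr_cj: "g \<in> carrier G \<Longrightarrow> x \<in> carrier G \<Longrightarrow> retr S (cj g x) = cj (retr S g) (retr S x)"
  by (simp add: cj_def)

lemma retr_nat_pow: "g \<in> carrier G \<Longrightarrow> retr S (g [^] (n::nat)) = retr S g [^] n"
  by (induction n) auto

lemma retr_retr [simp]: "g \<in> carrier G \<Longrightarrow> retr S (retr T g) = retr (S \<inter> T) g"
  by (induction rule: raag_induct) auto

lemma expo_retr [simp]: "g \<in> carrier G \<Longrightarrow> t \<in> S \<Longrightarrow> expo t (retr S g) = expo t g"
  by (induction rule: raag_induct) auto

text \<open>The subgroup generated by the vertices of \<open>S\<close> in \<open>V\<close>,
  described as the fixed points of a retraction. Intersections then reduce to composing retractions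
  (\<open>retr_retr\<close>).\<close>

definition par :: "'v set \<Rightarrow> 'v word set set" where
  "par S = {g \<in> carrier G. retr S g = g}"

lemma parD: "g \<in> par S \<Longrightarrow> g \<in> carrier G" "g \<in> par S \<Longrightarrow> retr S g = g"
  by (simp_all add: par_def)

lemma par_closed:
  "\<one> \<in> par S" "g \<in> par S \<Longrightarrow> h \<in> par S \<Longrightarrow> g \<otimes> h \<in> par S" "g \<in> par S \<Longrightarrow> inv g \<in> par S"
  "v \<in> V \<Longrightarrow> v \<in> S \<Longrightarrow> gen v \<in> par S" "g \<in> par S \<Longrightarrow> h \<in> par S \<Longrightarrow> cj g h \<in> par S"
  by (simp_all add: par_def retr_cj)

lemma retr_in_par: "g \<in> carrier G \<Longrightarrow> retr S g \<in> par S"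
  by (simp add: par_def)

declare parD [simp]

lemma retr_par: "g \<in> par S \<Longrightarrow> retr T g \<in> par (S \<inter> T)"
  using retr_retr[of g T S] retr_in_par[of g "S \<inter> T"] by (simp add: Int_commute)

lemma par_Int: "g \<in> par S \<Longrightarrow> g \<in> par T \<Longrightarrow> g \<in> par (S \<inter> T)"
  using retr_par[of g S T] by simp

lemma par_mono: "g \<in> par S \<Longrightarrow> S \<subseteq> T \<Longrightarrow> g \<in> par T"
  using retr_par[of g S T] retr_retr[of g T S] by (simp add: Int_absorb1) (metis parD retr_in_par)

lemma par_V: "g \<in> carrier G \<Longrightarrow> g \<in> par V"
  by (induction rule: raag_induct) (auto intro: par_closed)

lemma par_INT:
  assumes "finite U" "g \<in> par S" "\<And>u. u \<in> U \<Longrightarrow> g \<in> par (F u)"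
  shows "g \<in> par (S \<inter> (\<Inter>u\<in>U. F u))"
  using assms
proof (induction U)
  case (insert u U)
  then have "g \<in> par ((S \<inter> (\<Inter>u\<in>U. F u)) \<inter> F u)" using par_Int by blast
  then show ?case by (simp add: Int_ac)
qed auto

text \<open>Every element of \<open>par S\<close> is its own retraction, and \<open>retr S\<close>
  deletes the letters outside \<open>S\<close> from a product of generators.\<close>

lemma par_induct [consumes 1, case_names one gen inv_gen]:
  assumes "g \<in> par S" and "P \<one>"
    and "\<And>v g. v \<in> V \<Longrightarrow> v \<in> S \<Longrightarrow> g \<in> par S \<Longrightarrow> P g \<Longrightarrow> P (gen v \<otimes> g)"
    and "\<And>v g. v \<in> V \<Longrightarrow> v \<in> S \<Longrightarrow> g \<in> par S \<Longrightarrow> P g \<Longrightarrow> P (inv (gen v) \<otimes> g)"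
  shows "P g"
proof -
  have "P (retr S g)" if "g \<in> carrier G" for g
    using that by (induction rule: raag_induct) (use assms(2-4) retr_in_par in auto)
  then show ?thesis using assms(1) parD by metis
qed

lemma par_empty: "g \<in> par {} \<Longrightarrow> g = \<one>"
  by (induction rule: par_induct) auto

lemma par_single:
  assumes "g \<in> par {v}" "v \<in> V"
  shows "g = gen v [^] expo v g"
  using assms(1)
proof (induction rule: par_induct)
  case (gen w g)
  have "gen v [^] (1 + expo v g) = gen v [^] (1::int) \<otimes> gen v [^] expo v g"
    using assms(2) by (intro int_pow_mult) simp
  with gen assms(2) show ?case by auto
next
  case (inv_gen w g)
  have "gen v [^] (- 1 + expo v g) = gen v [^] (- 1::int) \<otimes> gen v [^] expo v g"
    using assms(2) by (intro int_pow_mult) simp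
  with inv_gen assms(2) show ?case by (auto simp: int_pow_neg)
qed simp

end

section \<open>The tree of a vertex\<close>

text \<open>Left multiplication by a letter in a free group, on reduced words.\<close>

fun push :: "'a \<times> bool \<Rightarrow> ('a \<times> bool) list \<Rightarrow> ('a \<times> bool) list" where
  "push l [] = [l]"
| "push l (m # L) = (if fst m = fst l \<and> snd m \<noteq> snd l then L else l # m # L)"

definition reduced :: "('a \<times> bool) list \<Rightarrow> bool" where
  "reduced L \<longleftrightarrow> successively (\<lambda>l m. \<not> (fst l = fst m \<and> snd l \<noteq> snd m)) L"

lemma reduced_Nil [simp]: "reduced []"
  by (simp add: reduced_def)

lemma reduced_ConsD: "reduced (l # L) \<Longrightarrow> reduced L"
  by (cases L) (auto simp: reduced_def)

lemma reduced_push: "reduced L \<Longrightarrow> reduced (push l L)"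
  by (cases L) (auto simp: reduced_def successively_Cons)

lemma push_push_inverse: "reduced L \<Longrightarrow> push (x, b) (push (x, \<not> b) L) = L"
  by (cases L; cases "tl L") (auto simp: reduced_def)

lemma push_reduced: "reduced (l # L) \<Longrightarrow> push l L = l # L"
  by (cases L) (auto simp: reduced_def)

lemma map_push:
  "inj_on f A \<Longrightarrow> fst l \<in> A \<Longrightarrow> fst ` set L \<subseteq> A \<Longrightarrow>
    map (apfst f) (push l L) = push (apfst f l) (map (apfst f) L)"
  by (cases L) (auto simp: inj_on_def)

lemma reduced_map: "inj_on f A \<Longrightarrow> fst ` set L \<subseteq> A \<Longrightarrow> reduced L \<Longrightarrow> reduced (map (apfst f) L)"
  unfolding reduced_def successively_map
  by (erule successively_mono) (auto simp: inj_on_def)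

lemma set_push: "set (push l L) \<subseteq> insert l (set L)"
  by (cases L) auto

lemma reduced_append_iff:
  "reduced (K @ L) \<longleftrightarrow> reduced K \<and> reduced L \<and>
     (K = [] \<or> L = [] \<or> \<not> (fst (last K) = fst (hd L) \<and> snd (last K) \<noteq> snd (hd L)))"
  by (auto simp: reduced_def successively_append_iff)

lemma foldr_push_reduced: "reduced (K @ L) \<Longrightarrow> foldr push K L = K @ L"
proof (induction K)
  case (Cons k K)
  then have "reduced (K @ L)" using reduced_ConsD[of k "K @ L"] by simp
  then show ?case using Cons push_reduced by simp
qed simp

text \<open>The number \<open>c\<close> counts the letters cancelled at the junction. A further
  letter in front of \<open>K\<close> can cancel only if all of \<open>K\<close> has been used up;
  otherwise it meets the first letter of \<open>K\<close>, and \<open>k # K\<close> is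
  reduced.\<close>

lemma foldr_push_eq:
  assumes "reduced K" "reduced L"
  shows "\<exists>c. c \<le> length K \<and> c \<le> length L \<and> foldr push K L = take (length K - c) K @ drop c L"
  using assms(1)
proof (induction K)
  case (Cons k K)
  then obtain c where c: "c \<le> length K" "c \<le> length L"
    "foldr push K L = take (length K - c) K @ drop c L"
    using reduced_ConsD by blast
  show ?case
  proof (cases "c < length K")
    case True
    then obtain k' K' where K: "K = k' # K'" by (cases K) auto
    then have "\<not> (fst k' = fst k \<and> snd k' \<noteq> snd k)" using Cons.prems by (auto simp: reduced_def)
    then have "foldr push (k # K) L = k # foldr push K L"
      using True by (simp add: c(3)) (simp add: K Suc_diff_le)
    then show ?thesis using c True by (intro exI[of _ c]) (simp add: Suc_diff_le)
  next
    case False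
    then have c': "c = length K" using c by simp
    show ?thesis
    proof (cases "c < length L \<and> fst (L ! c) = fst k \<and> snd (L ! c) \<noteq> snd k")
      case True
      then have "drop c L = L ! c # drop (Suc c) L" by (simp add: Cons_nth_drop_Suc)
      then have "foldr push (k # K) L = drop (Suc c) L" using True c' by (simp add: c(3))
      then show ?thesis using c' True by (intro exI[of _ "Suc c"]) simp
    next
      case False
      have "push k (drop c L) = k # drop c L"
      proof (cases "c < length L")
        case True
        then have "drop c L = L ! c # drop (Suc c) L" by (simp add: Cons_nth_drop_Suc)
        then show ?thesis using False True by auto
      qed simp
      then have "foldr push (k # K) L = k # drop c L" using c' by (simp add: c(3))
      then show ?thesis using c c' by (intro exI[of _ c]) simp
    qed
  qed
qed auto

section \<open>The free factor and the action of the group on it\<close>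

context raag
begin

definition letters :: "'v \<Rightarrow> 'v word set set" where
  "letters u = (\<lambda>y. cj y (gen u)) ` par (- {u})"

text \<open>The group is the semidirect product of \<open>par (- {u})\<close> with the free group on \<open>letters u\<close>.
  The reduced words in these letters are the vertices of the tree on which the group acts.\<close>
definition tree :: "'v \<Rightarrow> ('v word set \<times> bool) list set" where
  "tree u = {L. reduced L \<and> fst ` set L \<subseteq> letters u}"

text \<open>The action on the cosets of \<open>par (- {u})\<close>, each represented by its element
  of the free factor: \<open>gen u\<close> multiplies from the left, while the other generators fix
  the base coset and therefore conjugate.\<close>

definition tlet :: "'v \<Rightarrow> 'v \<times> bool \<Rightarrow> ('v word set \<times> bool) list \<Rightarrow> ('v word set \<times> bool) list" where
  "tlet u = (\<lambda>(v, b) L. if v = u then push (gen u, b) L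
     else if v \<in> V then map (apfst (cj (if b then gen v else inv (gen v)))) L else L)"

abbreviation tact :: "'v \<Rightarrow> 'v word set \<Rightarrow> ('v word set \<times> bool) list \<Rightarrow> ('v word set \<times> bool) list" where
  "tact u \<equiv> gact (tlet u)"

definition ev :: "('v word set \<times> bool) list \<Rightarrow> 'v word set" where
  "ev L = foldr (\<lambda>(x, b) a. (if b then x else inv x) \<otimes> a) L \<one>"

lemma letters_carrier: "u \<in> V \<Longrightarrow> letters u \<subseteq> carrier G"
  by (auto simp: letters_def)

lemma gen_letters: "u \<in> V \<Longrightarrow> gen u \<in> letters u"
  unfolding letters_def using par_closed(1) by (intro image_eqI[of _ _ \<one>]) auto

lemma cj_letters: "u \<in> V \<Longrightarrow> g \<in> par (- {u}) \<Longrightarrow> x \<in> letters u \<Longrightarrow> cj g x \<in> letters u"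
  unfolding letters_def by (auto simp: cj_cj intro: par_closed)

lemma cj_inj_on: "g \<in> carrier G \<Longrightarrow> inj_on (cj g) (carrier G)"
  by (auto simp: inj_on_def cj_inject)

lemma tree_Nil [simp]: "[] \<in> tree u"
  by (simp add: tree_def)

lemma map_cj_tree:
  assumes "u \<in> V" "g \<in> par (- {u})" "L \<in> tree u"
  shows "map (apfst (cj g)) L \<in> tree u"
proof -
  have "fst ` set L \<subseteq> letters u" "reduced L" using assms by (auto simp: tree_def)
  moreover have "inj_on (cj g) (letters u)"
    using cj_inj_on letters_carrier assms inj_on_subset parD(1) by metis
  ultimately show ?thesis
    using cj_letters[OF assms(1,2)] reduced_map by (auto simp: tree_def)
qed

lemma push_tree: "x \<in> letters u \<Longrightarrow> L \<in> tree u \<Longrightarrow> push (x, b) L \<in> tree u"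
  using set_push[of "(x, b)" L] reduced_push by (fastforce simp: tree_def)

lemma map_cj_push:
  assumes "u \<in> V" "g \<in> carrier G" "x \<in> letters u" "L \<in> tree u"
  shows "map (apfst (cj g)) (push (x, b) L) = push (cj g x, b) (map (apfst (cj g)) L)"
proof -
  have "x \<in> carrier G" "fst ` set L \<subseteq> carrier G"
    using assms letters_carrier by (auto simp: tree_def)
  then show ?thesis using map_push[OF cj_inj_on[OF assms(2)], of "(x, b)" L] by simp
qed

lemma map_cj_cj:
  assumes "u \<in> V" "g \<in> carrier G" "h \<in> carrier G" "L \<in> tree u"
  shows "map (apfst (cj g)) (map (apfst (cj h)) L) = map (apfst (cj (g \<otimes> h))) L"
proof -
  have "fst ` set L \<subseteq> carrier G" using assms letters_carrier by (auto simp: tree_def)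
  then show ?thesis using assms(2,3) by (auto simp: cj_cj subset_iff image_iff Bex_def)
qed

lemma map_cj_one: "u \<in> V \<Longrightarrow> L \<in> tree u \<Longrightarrow> map (apfst (cj \<one>)) L = L"
  by (rule map_idI) (use letters_carrier in \<open>fastforce simp: tree_def\<close>)

text \<open>The relation that needs care joins \<open>u\<close> to a neighbour: conjugation by the
  neighbour fixes the letter \<open>gen u\<close>, so it commutes with pushing that letter.\<close>

lemma tree_action:
  assumes u: "u \<in> V"
  shows "raag_action E (tlet u) (tree u)"
  unfolding raag_action_def
proof (intro conjI allI ballI impI)
  fix l L assume "L \<in> tree u"
  then show "tlet u l L \<in> tree u"
    using u map_cj_tree push_tree gen_letters par_closed(3,4)
    by (auto simp: tlet_def split: prod.splits)
next
  fix v b L assume "L \<in> tree u"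
  then show "tlet u (v, b) (tlet u (v, \<not> b) L) = L"
    using u push_push_inverse[of L "gen u" b]
    by (auto simp: tlet_def map_cj_cj[OF u] map_cj_one[OF u] simp del: map_map) (auto simp: tree_def)
next
  fix v w b c L assume L: "L \<in> tree u" and e: "{v, w} \<in> E"
  have V: "v \<in> V" "w \<in> V" "v \<noteq> w" using edgeD[OF e] by auto
  let ?g = "\<lambda>b v. if b then gen v else inv (gen v)"
  have c: "?g b v \<otimes> ?g c w = ?g c w \<otimes> ?g b v"
    if "gen v \<otimes> gen w = gen w \<otimes> gen v" "v \<in> V" "w \<in> V" for b c v w
    using that commute_inv[of "gen v" "gen w"] commute_inv[of "gen w" "gen v"]
      commute_inv[of "inv (gen v)" "gen w"] by auto
  have c': "gen v \<otimes> gen w = gen w \<otimes> gen v" using e gen_commute[of w v] by (simp add: lk_def)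
  have fix_gen: "cj (?g b v) (gen w) = gen w" if "gen v \<otimes> gen w = gen w \<otimes> gen v" "v \<in> V" "w \<in> V" for b v w
    using c[OF that, of b True] that by (simp add: cj_eq_iff_commute)
  have m: "map (apfst (cj (?g b v))) (push (gen w, c) L) = push (gen w, c) (map (apfst (cj (?g b v))) L)"
    if "gen v \<otimes> gen w = gen w \<otimes> gen v" "v \<in> V" "w = u" for b v w c
    using map_cj_push[OF u _ gen_letters[OF u] L, of "?g b v"] fix_gen[of v w b] that u by auto
  have "?g b v \<otimes> ?g c w = ?g c w \<otimes> ?g b v" using c[OF c' V(1,2)] .
  then have "map (apfst (cj (?g b v))) (map (apfst (cj (?g c w))) L) =
      map (apfst (cj (?g c w))) (map (apfst (cj (?g b v))) L)"
    using map_cj_cj[OF u _ _ L, of "?g b v" "?g c w"] map_cj_cj[OF u _ _ L, of "?g c w" "?g b v"] V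
    by (simp del: map_map)
  then show "tlet u (v, b) (tlet u (w, c) L) = tlet u (w, c) (tlet u (v, b) L)"
    using m[OF c'] m[OF c'[symmetric]] V unfolding tlet_def by (auto simp del: map_map)
qed

lemma tact_closed: "u \<in> V \<Longrightarrow> L \<in> tree u \<Longrightarrow> g \<in> carrier G \<Longrightarrow> tact u g L \<in> tree u"
  using gact_closed[OF tree_action] .

lemma tact_mult:
  "u \<in> V \<Longrightarrow> L \<in> tree u \<Longrightarrow> g \<in> carrier G \<Longrightarrow> h \<in> carrier G \<Longrightarrow>
    tact u (g \<otimes> h) L = tact u g (tact u h L)"
  using gact_mult[OF tree_action] .

lemma tact_gen: "u \<in> V \<Longrightarrow> L \<in> tree u \<Longrightarrow> v \<in> V \<Longrightarrow>
    tact u (gen v) L = (if v = u then push (gen u, True) L else map (apfst (cj (gen v))) L)"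
  and tact_inv_gen: "u \<in> V \<Longrightarrow> L \<in> tree u \<Longrightarrow> v \<in> V \<Longrightarrow>
    tact u (inv (gen v)) L = (if v = u then push (gen u, False) L else map (apfst (cj (inv (gen v)))) L)"
  by (simp_all only: gact_gen[OF tree_action] gact_inv_gen[OF tree_action]) (simp_all add: tlet_def)

lemma tact_par:
  assumes "u \<in> V" "L \<in> tree u" "g \<in> par (- {u})"
  shows "tact u g L = map (apfst (cj g)) L"
  using assms(3)
proof (induction rule: par_induct)
  case one
  then show ?case using assms by (simp add: gact_one[OF tree_action] map_cj_one)
next
  case (gen v g)
  then show ?case using assms map_cj_tree[OF assms(1), of g L]
    by (simp add: tact_mult tact_gen map_cj_cj del: map_map)
next
  case (inv_gen v g)
  then show ?case using assms map_cj_tree[OF assms(1), of g L]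
    by (simp add: tact_mult tact_inv_gen map_cj_cj del: map_map)
qed

text \<open>If \<open>x = cj y (gen u)\<close>, then \<open>x\<close> acts by relabelling with
  \<open>inv y\<close>, pushing \<open>gen u\<close>, and relabelling with \<open>y\<close>.\<close>

lemma tact_letter:
  assumes u: "u \<in> V" and L: "L \<in> tree u" and x: "x \<in> letters u"
  shows "tact u (if b then x else inv x) L = push (x, b) L"
proof -
  obtain y where y: "y \<in> par (- {u})" "x = cj y (gen u)" using x by (auto simp: letters_def)
  let ?z = "if b then gen u else inv (gen u)"
  let ?M = "map (apfst (cj (inv y))) L"
  have M: "?M \<in> tree u" using u L y by (intro map_cj_tree) (auto intro: par_closed)
  have "(if b then x else inv x) = cj y ?z" using u y by (simp add: cj_inv)
  also have "\<dots> = y \<otimes> (?z \<otimes> inv y)" using u y by (simp add: cj_def m_assoc)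
  finally have "tact u (if b then x else inv x) L = tact u y (tact u ?z (tact u (inv y) L))"
    using u L y by (simp add: tact_mult tact_closed)
  also have "\<dots> = map (apfst (cj y)) (tact u ?z ?M)"
    using u L y M by (subst tact_par[of u _ y]) (auto simp: tact_par[of u _ "inv y"] par_closed tact_closed)
  also have "\<dots> = map (apfst (cj y)) (push (gen u, b) ?M)"
    using u M by (simp add: tact_gen tact_inv_gen)
  also have "\<dots> = push (x, b) (map (apfst (cj y)) ?M)"
    using u y map_cj_push[OF u _ gen_letters[OF u] M, of y] by simp
  also have "map (apfst (cj y)) ?M = L"
    using u y L by (simp add: map_cj_cj map_cj_one del: map_map)
  finally show ?thesis .
qed

lemma ev_simps [simp]: "ev [] = \<one>" "ev ((x, b) # L) = (if b then x else inv x) \<otimes> ev L"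
  by (simp_all add: ev_def)

lemma ev_closed: "u \<in> V \<Longrightarrow> fst ` set L \<subseteq> letters u \<Longrightarrow> ev L \<in> carrier G"
proof (induction L)
  case (Cons l L)
  then show ?case using letters_carrier[of u] by (cases l) auto
qed simp

lemma ev_push: "u \<in> V \<Longrightarrow> x \<in> letters u \<Longrightarrow> L \<in> tree u \<Longrightarrow> ev (push (x, b) L) = ev ((x, b) # L)"
  using letters_carrier[of u] ev_closed[of u "tl L"]
  by (cases L; cases "hd L") (auto simp: tree_def subset_iff)

lemma ev_map_cj:
  assumes "u \<in> V" "g \<in> carrier G" "fst ` set L \<subseteq> letters u"
  shows "ev (map (apfst (cj g)) L) = cj g (ev L)"
  using assms(3)
proof (induction L)
  case (Cons l L)
  then show ?case using letters_carrier[OF assms(1)] assms ev_closed[of u L]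
    by (cases l) (auto simp: cj_mult cj_inv)
qed (simp add: assms)

lemma tact_ev:
  assumes "u \<in> V" "L \<in> tree u" "fst ` set K \<subseteq> letters u"
  shows "tact u (ev K) L = foldr push K L"
  using assms(3)
proof (induction K)
  case Nil
  then show ?case using assms by (simp add: gact_one[OF tree_action])
next
  case (Cons k K)
  obtain x b where k: "k = (x, b)" by fastforce
  have *: "x \<in> letters u" "fst ` set K \<subseteq> letters u" using Cons k by auto
  have "ev K \<in> carrier G" "(if b then x else inv x) \<in> carrier G"
    using * ev_closed[of u K] assms letters_carrier[of u] by auto
  then have "tact u (ev (k # K)) L = tact u (if b then x else inv x) (tact u (ev K) L)"
    using assms by (simp add: k tact_mult)
  also have "\<dots> = push k (tact u (ev K) L)"
    using assms * \<open>ev K \<in> carrier G\<close> by (simp only: tact_letter tact_closed k)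
  finally show ?case using Cons * by simp
qed

lemma tact_fst_letters: "u \<in> V \<Longrightarrow> g \<in> carrier G \<Longrightarrow> fst ` set (tact u g []) \<subseteq> letters u"
  using tact_closed[of u "[]" g] by (auto simp: tree_def)

text \<open>The semidirect factorization: the image of the base vertex spells the free factor of
  \<open>g\<close>, and the retraction is the other factor.\<close>

lemma ev_tact:
  assumes u: "u \<in> V" and "g \<in> carrier G"
  shows "ev (tact u g []) \<otimes> retr (- {u}) g = g"
  using assms(2)
proof (induction rule: raag_induct)
  case one
  then show ?case using assms by (simp add: gact_one[OF tree_action])
next
  case (gen v g)
  let ?L = "tact u g []"
  have *: "?L \<in> tree u" "ev ?L \<in> carrier G" "retr (- {u}) g \<in> carrier G"
    using u gen tact_closed[of u "[]" g] ev_closed tact_fst_letters by auto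
  have t: "tact u (gen v \<otimes> g) [] = tact u (gen v) ?L" using u gen by (simp add: tact_mult)
  have "ev (tact u (gen v \<otimes> g) []) \<otimes> retr (- {u}) (gen v \<otimes> g) = gen v \<otimes> (ev ?L \<otimes> retr (- {u}) g)"
  proof (cases "v = u")
    case True
    then show ?thesis
      unfolding t using u gen * by (simp add: tact_gen ev_push gen_letters m_assoc)
  next
    case False
    then show ?thesis
      using u gen * tact_fst_letters by (simp add: t tact_gen ev_map_cj cj_def m_assoc)
  qed
  then show ?case using gen by simp
next
  case (inv_gen v g)
  let ?L = "tact u g []"
  have *: "?L \<in> tree u" "ev ?L \<in> carrier G" "retr (- {u}) g \<in> carrier G"
    using u inv_gen tact_closed[of u "[]" g] ev_closed tact_fst_letters by auto
  have t: "tact u (inv (gen v) \<otimes> g) [] = tact u (inv (gen v)) ?L" using u inv_gen by (simp add: tact_mult)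
  have "ev (tact u (inv (gen v) \<otimes> g) []) \<otimes> retr (- {u}) (inv (gen v) \<otimes> g) =
      inv (gen v) \<otimes> (ev ?L \<otimes> retr (- {u}) g)"
  proof (cases "v = u")
    case True
    then show ?thesis
      unfolding t using u inv_gen * by (simp add: tact_inv_gen ev_push gen_letters m_assoc)
  next
    case False
    then show ?thesis
      using u inv_gen * tact_fst_letters by (simp add: t tact_inv_gen ev_map_cj cj_def m_assoc)
  qed
  then show ?case using inv_gen by simp
qed

lemma tact_eq:
  assumes "u \<in> V" "L \<in> tree u" "g \<in> carrier G"
  shows "tact u g L = foldr push (tact u g []) (map (apfst (cj (retr (- {u}) g))) L)"
proof -
  have "tact u g L = tact u (ev (tact u g []) \<otimes> retr (- {u}) g) L" using assms by (simp add: ev_tact)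
  also have "\<dots> = tact u (ev (tact u g [])) (tact u (retr (- {u}) g) L)"
    using assms ev_closed tact_fst_letters by (simp add: tact_mult)
  also have "tact u (retr (- {u}) g) L = map (apfst (cj (retr (- {u}) g))) L"
    using assms by (simp add: tact_par retr_in_par)
  also have "tact u (ev (tact u g [])) \<dots> = foldr push (tact u g []) \<dots>"
    using assms by (intro tact_ev tact_fst_letters map_cj_tree retr_in_par)
  finally show ?thesis .
qed

text \<open>By \<open>ev_tact\<close>, an element that fixes the base vertex equals its
  retraction.\<close>

lemma par_iff_tact_Nil:
  assumes "u \<in> V" "g \<in> carrier G"
  shows "g \<in> par (- {u}) \<longleftrightarrow> tact u g [] = []"
proof
  assume "tact u g [] = []"
  then have "retr (- {u}) g = g" using ev_tact[OF assms] assms by simp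
  then show "g \<in> par (- {u})" using retr_in_par assms by metis
qed (use assms tact_par in simp)

lemma cj_letter_eq_imp_expo_eq:
  assumes "u \<in> V" "t \<notin> st u" "x \<in> letters u" "p \<in> carrier G" "q \<in> carrier G" "cj p x = cj q x"
  shows "expo t p = expo t q"
proof -
  obtain y where "y \<in> par (- {u})" "x = cj y (gen u)" using assms(3) by (auto simp: letters_def)
  then show ?thesis using cj_gen_eq_imp_expo_eq[OF assms(1,2) _ assms(4,5)] assms(6) parD(1) by blast
qed

text \<open>If \<open>a\<close> has nonzero exponent outside the star of \<open>u\<close>, it fixes at most one vertex of the tree of \<open>u\<close>.\<close>
lemma conj_in_par_imp:
  assumes u: "u \<in> V" and a: "a \<in> par (- {u})" and g: "g \<in> carrier G" "cj (inv g) a \<in> par (- {u})"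
    and t: "t \<notin> st u" "expo t a \<noteq> 0"
  shows "g \<in> par (- {u})"
proof (rule ccontr)
  assume "g \<notin> par (- {u})"
  then have ne: "tact u g [] \<noteq> []" using par_iff_tact_Nil u g by blast
  have "a \<otimes> g = g \<otimes> cj (inv g) a" using a g by (simp add: cj_def m_assoc)
  \<comment> \<open>The element \<open>cj (inv g) a\<close> fixes the base vertex, so
    \<open>a\<close> fixes its image under \<open>g\<close>. As \<open>a\<close> acts by
    relabelling, it centralizes every letter of that nonempty word.\<close>
  then have "tact u a (tact u g []) = tact u g (tact u (cj (inv g) a) [])"
    using u a g tact_mult[of u "[]" a g] tact_mult[of u "[]" g "cj (inv g) a"] by simp
  also have "tact u (cj (inv g) a) [] = []" using u g by (simp add: tact_par)
  finally have "map (apfst (cj a)) (tact u g []) = tact u g []"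
    using u a g by (simp add: tact_par tact_closed)
  then obtain l where "l \<in> set (tact u g [])" "apfst (cj a) l = l"
    using ne by (metis list.map_sel(1) list.set_sel(1))
  then have "fst l \<in> letters u" "cj a (fst l) = fst l"
    using tact_fst_letters[OF u g(1)] by (blast, metis fst_apfst)
  then have "expo t a = expo t \<one>"
    using cj_letter_eq_imp_expo_eq[OF u t(1), of "fst l" a \<one>] a letters_carrier[OF u]
    by (simp add: subset_iff)
  then show False using t by simp
qed

section \<open>Commuting elements\<close>

text \<open>\<open>axis n h f\<close> enumerates the edges along the axis of an element \<open>a\<close> translating by \<open>n\<close>:
  \<open>f\<close> is the reduced word for \<open>a\<close>, and \<open>h\<close> acts on letters the way \<open>a\<close> does.\<close>
definition axis :: "nat \<Rightarrow> 'v word set \<Rightarrow> ('v word set \<times> bool) list \<Rightarrow> nat \<Rightarrow> 'v word set \<times> bool" where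
  "axis n h f i = apfst (cj (h [^] (i div n))) (f ! (i mod n))"

text \<open>A conjugate of minimal length is cyclically reduced.\<close>
lemma exists_min_conjugate:
  assumes u: "u \<in> V" and a: "a \<in> carrier G" and nc: "\<And>y. y \<in> carrier G \<Longrightarrow> cj y a \<notin> par (- {u})"
  obtains y where "y \<in> carrier G" "tact u (cj y a) [] \<noteq> []"
    "reduced (tact u (cj y a) [] @ map (apfst (cj (retr (- {u}) (cj y a)))) (tact u (cj y a) []))"
proof -
  obtain y where y: "y \<in> carrier G"
    and min: "\<And>z. z \<in> carrier G \<Longrightarrow> length (tact u (cj y a) []) \<le> length (tact u (cj z a) [])"
    using ex_has_least_nat[of "\<lambda>y. y \<in> carrier G" \<one> "\<lambda>y. length (tact u (cj y a) [])"] by auto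
  define a' where "a' = cj y a"
  define f where "f = tact u a' []"
  define h where "h = retr (- {u}) a'"
  have a': "a' \<in> carrier G" "h \<in> par (- {u})" using a y by (simp_all add: a'_def h_def retr_in_par)
  have f: "f \<noteq> []" "f \<in> tree u"
    using nc[OF y] par_iff_tact_Nil[OF u a'(1)] tact_closed[OF u tree_Nil a'(1)] by (auto simp: f_def a'_def)
  have hf: "map (apfst (cj h)) f \<in> tree u" using u a' f by (intro map_cj_tree)
  have "reduced (f @ map (apfst (cj h)) f)"
  proof (rule ccontr)
    assume "\<not> ?thesis"
    then have junction: "fst (last f) = cj h (fst (hd f))" "snd (last f) \<noteq> snd (hd f)"
      using f hf by (auto simp: reduced_append_iff tree_def hd_map)
    obtain x b where xb: "hd f = (x, b)" by fastforce
    have x: "x \<in> letters u" using f xb hd_in_set[of f] by (force simp: tree_def)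
    then have xG: "x \<in> carrier G" using letters_carrier[OF u] by auto
    \<comment> \<open>With a single letter the two ends coincide and cannot have opposite
      signs.\<close>
    have "length f \<noteq> 1" using junction(2) by (cases f) auto
    then obtain m where m: "f = (x, b) # m @ [(cj h x, \<not> b)]"
      using f junction xb
      by (cases f; cases "tl f" rule: rev_cases) (auto simp: prod_eq_iff)
    \<comment> \<open>\<open>?z\<close> is the first letter as a group element and
      \<open>?z'\<close> its inverse; conjugating by \<open>?z'\<close> removes both ends of
      \<open>f\<close>, against minimality.\<close>
    let ?z = "if b then x else inv x" and ?z' = "if \<not> b then x else inv x"
    have z: "?z \<in> carrier G" "?z' \<in> carrier G" "inv ?z' = ?z" using xG by auto
    have "cj (?z' \<otimes> y) a = ?z' \<otimes> (a' \<otimes> ?z)"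
      using xG y a z by (simp add: a'_def cj_cj[symmetric]) (simp add: cj_def m_assoc)
    then have "tact u (cj (?z' \<otimes> y) a) [] = tact u ?z' (tact u a' (tact u ?z []))"
      using u z a' by (simp add: tact_mult tact_closed)
    also have "tact u ?z [] = [(x, b)]" using tact_letter[OF u tree_Nil x] by simp
    also have "tact u a' [(x, b)] = foldr push f [(cj h x, b)]"
      using tact_eq[OF u, of "[(x, b)]" a'] x a' by (simp add: f_def h_def tree_def reduced_def)
    also have "\<dots> = (x, b) # m"
    proof -
      have r: "reduced ((x, b) # m)" using f(2) reduced_append_iff[of "(x, b) # m"] by (simp add: m tree_def)
      have "foldr push f [(cj h x, b)] = foldr push ((x, b) # m) []" by (simp add: m)
      also have "\<dots> = (x, b) # m" using r foldr_push_reduced[of "(x, b) # m" "[]"] by simp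
      finally show ?thesis .
    qed
    also have "tact u ?z' ((x, b) # m) = m"
    proof -
      have "(x, b) # m \<in> tree u"
        using f(2) reduced_append_iff[of "(x, b) # m"] by (auto simp: m tree_def)
      then show ?thesis using tact_letter[OF u _ x, of _ "\<not> b"] by simp
    qed
    finally have "length (tact u (cj (?z' \<otimes> y) a) []) < length f" by (simp add: m)
    then show False using min[of "?z' \<otimes> y"] z y by (simp add: f_def a'_def)
  qed
  then show ?thesis using that y f by (simp add: f_def h_def a'_def)
qed

text \<open>Powers of \<open>a\<close> spell the periodic word \<open>\<omega>\<close> along the
  axis. Since \<open>b\<close> commutes with them, it shifts \<open>\<omega>\<close> by some integer
  s. With n the length of \<open>f\<close>, the n-th power of \<open>b\<close> and the s-th power of
  \<open>a\<close> shift equally, so their retractions conjugate one letter alike, and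
  \<open>cj_letter_eq_imp_expo_eq\<close> compares exponents.\<close>

lemma commuting_expo_proportional_aux:
  assumes u: "u \<in> V" and a: "a \<in> carrier G" and b: "b \<in> carrier G" and ab: "a \<otimes> b = b \<otimes> a"
    and f: "f = tact u a []" "f \<noteq> []"
    and h: "h = retr (- {u}) a"
    and red: "reduced (f @ map (apfst (cj h)) f)"
  shows "\<exists>p q. q \<noteq> 0 \<and> (\<forall>t. t \<notin> st u \<longrightarrow> q * expo t b = p * expo t a)"
proof -
  define n where "n = length f"
  define \<omega> where "\<omega> = axis n h f"
  define w where "w N = tact u (a [^] (N::nat)) []" for N
  define g where "g = tact u b []"
  define k where "k = retr (- {u}) b"
  define m where "m = length g"
  have n: "n > 0" using f(2) by (simp add: n_def)
  have hG: "h \<in> par (- {u})" and kG: "k \<in> par (- {u})"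
    using a b by (simp_all add: h k_def retr_in_par)
  have ft: "f \<in> tree u" and gt: "g \<in> tree u" using tact_closed[OF u tree_Nil] a b by (auto simp: f g_def)
  have \<omega>_letter: "fst (\<omega> i) \<in> letters u" for i
  proof -
    have "f ! (i mod n) \<in> set f" using n by (simp add: n_def)
    then have "fst (f ! (i mod n)) \<in> letters u" using ft by (auto simp: tree_def)
    moreover have "h [^] (i div n) \<in> par (- {u})"
      using hG retr_in_par[of "h [^] (i div n)" "- {u}"] by (simp add: retr_nat_pow)
    ultimately show ?thesis using cj_letters[OF u] by (simp add: \<omega>_def axis_def)
  qed
  have \<omega>_carrier: "fst (\<omega> i) \<in> carrier G" for i using \<omega>_letter letters_carrier[OF u] by blast
  have f_carrier: "fst (f ! i) \<in> carrier G" if "i < n" for i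
  proof -
    have "f ! i \<in> set f" using that by (simp add: n_def)
    then show ?thesis using ft letters_carrier[OF u] by (auto simp: tree_def)
  qed
  have \<omega>_small: "\<omega> i = f ! i" if "i < n" for i
    using that f_carrier[OF that] by (simp add: \<omega>_def axis_def prod_eq_iff)
  have \<omega>_step: "\<omega> (i + n) = apfst (cj h) (\<omega> i)" for i
  proof -
    have "h [^] Suc (i div n) = h \<otimes> h [^] (i div n)" using hG by (simp only: nat_pow_Suc2 parD)
    then show ?thesis using n hG f_carrier[of "i mod n"]
      by (simp add: \<omega>_def axis_def div_add_self2 cj_cj prod_eq_iff del: nat_pow_Suc)
  qed
  have \<omega>_pow: "\<omega> (i + n * s) = apfst (cj (h [^] s)) (\<omega> i)" for i s
  proof (induction s)
    case 0
    then show ?case using \<omega>_carrier[of i] by (simp add: prod_eq_iff)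
  next
    case (Suc s)
    have "\<omega> (i + n * Suc s) = apfst (cj h) (\<omega> (i + n * s))" using \<omega>_step[of "i + n * s"] by (simp add: add_ac)
    then show ?case using Suc hG \<omega>_carrier[of i] nat_pow_Suc2[of h s]
      by (simp add: cj_cj prod_eq_iff del: nat_pow_Suc)
  qed
  have w_eq: "w N = map \<omega> [0..<N * n]" for N
  proof (induction N)
    case 0
    show ?case by (simp add: w_def gact_one[OF tree_action[OF u]])
  next
    case (Suc N)
    have split: "f @ map (apfst (cj h)) (map \<omega> [0..<N * n]) = map \<omega> [0..<Suc N * n]"
    proof (rule nth_equalityI)
      fix i assume "i < length (f @ map (apfst (cj h)) (map \<omega> [0..<N * n]))"
      then show "(f @ map (apfst (cj h)) (map \<omega> [0..<N * n])) ! i = map \<omega> [0..<Suc N * n] ! i"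
        using \<omega>_step[of "i - n"] \<omega>_small[of i] by (auto simp: nth_append n_def[symmetric] simp del: map_map)
    qed (simp add: n_def)
    have wt: "w N \<in> tree u" using tact_closed[OF u tree_Nil] a by (simp add: w_def)
    \<comment> \<open>For \<open>N > 0\<close> the word \<open>w N\<close> begins like
      \<open>f\<close>, so the junction is the one covered by \<open>red\<close>.\<close>
    have "reduced (f @ map (apfst (cj h)) (w N))"
    proof (cases "N = 0")
      case True
      then have "w N = []" using Suc by simp
      then show ?thesis using ft by (simp add: tree_def)
    next
      case False
      then have "w N \<noteq> []" "hd (w N) = hd f"
        using n f(2) \<omega>_small[of 0] by (simp_all add: Suc hd_map hd_conv_nth)
      moreover have "reduced (map (apfst (cj h)) (w N))"
        using map_cj_tree[OF u hG wt] by (simp add: tree_def)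
      ultimately show ?thesis using red f(2) by (simp add: reduced_append_iff hd_map)
    qed
    then have "foldr push f (map (apfst (cj h)) (w N)) = f @ map (apfst (cj h)) (w N)"
      by (rule foldr_push_reduced)
    moreover have "w (Suc N) = tact u a (w N)"
      unfolding w_def using u a nat_pow_Suc2[OF a] by (simp add: tact_mult del: nat_pow_Suc)
    ultimately have "w (Suc N) = f @ map (apfst (cj h)) (w N)"
      using tact_eq[OF u wt a] by (simp add: f h)
    then show ?case using split Suc by simp
  qed
  \<comment> \<open>Long enough for \<open>shift\<close> at every position visited in
    \<open>iter\<close>: these lie between \<open>m\<close> and
    \<open>m + 2 * n * m\<close>.\<close>
  define N where "N = 4 * m + 2 * n * m + 1"
  have wt: "w N \<in> tree u" using tact_closed[OF u tree_Nil] a by (simp add: w_def)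
  have aN: "a [^] N \<in> carrier G" using a by simp
  have "b \<otimes> a [^] N = a [^] N \<otimes> b"
    using group_commutes_pow[OF ab a b] by simp
  then have "tact u b (w N) = tact u (a [^] N) g"
    using u a b tact_mult[of u "[]" b "a [^] N"] tact_mult[of u "[]" "a [^] N" b] by (simp add: w_def g_def)
  \<comment> \<open>Both sides are the vertex reached by
    \<open>b \<otimes> a [^] N = a [^] N \<otimes> b\<close>. On the left a copy of the axis
    conjugated by \<open>k\<close> follows what remains of \<open>g\<close>; on the right the axis
    starts at the base vertex. Cancellation costs at most \<open>m\<close> letters on either
    side.\<close>
  then have eq: "foldr push g (map (apfst (cj k)) (w N)) =
      foldr push (w N) (map (apfst (cj (retr (- {u}) (a [^] N)))) g)"
    using tact_eq[OF u wt b] tact_eq[OF u gt aN] by (simp add: g_def k_def w_def)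
  have lw: "length (w N) = N * n" by (simp add: w_eq)
  obtain c where c: "c \<le> m" "foldr push g (map (apfst (cj k)) (w N)) = take (m - c) g @ drop c (map (apfst (cj k)) (w N))"
    using foldr_push_eq[of g "map (apfst (cj k)) (w N)"] gt map_cj_tree[OF u kG wt]
    unfolding m_def tree_def by blast
  obtain d where d: "d \<le> m" "foldr push (w N) (map (apfst (cj (retr (- {u}) (a [^] N)))) g) =
      take (N * n - d) (w N) @ drop d (map (apfst (cj (retr (- {u}) (a [^] N)))) g)"
    using foldr_push_eq[of "w N" "map (apfst (cj (retr (- {u}) (a [^] N)))) g"]
      wt map_cj_tree[OF u retr_in_par[OF aN] gt]
    unfolding m_def tree_def lw[symmetric] by auto
  have Nn: "N \<le> N * n" using n by simp
  \<comment> \<open>\<open>b\<close> translates the axis of \<open>a\<close> by \<open>m - 2 * c\<close>.\<close>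
  have shift: "apfst (cj k) (\<omega> j) = \<omega> (j + m - 2 * c)" if j: "m \<le> j" "j + 2 * m < N * n" for j
  proof -
    have lt: "j + m - 2 * c < N * n - d" using j d(1) by linarith
    have "(take (m - c) g @ drop c (map (apfst (cj k)) (w N))) ! (j + m - 2 * c) =
        drop c (map (apfst (cj k)) (w N)) ! (j - c)"
      using j c by (simp add: nth_append m_def[symmetric])
    also have "\<dots> = apfst (cj k) (\<omega> j)" using j c by (simp add: w_eq)
    finally have "apfst (cj k) (\<omega> j) =
        (take (N * n - d) (w N) @ drop d (map (apfst (cj (retr (- {u}) (a [^] N)))) g)) ! (j + m - 2 * c)"
      using eq c d by simp
    also have "\<dots> = \<omega> (j + m - 2 * c)" using lt by (simp add: nth_append w_eq)
    finally show ?thesis .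
  qed
  \<comment> \<open>Starting here, \<open>n\<close> shifts to the left by at most \<open>m\<close>
    each stay in the range \<open>m \<le> j\<close> where \<open>shift\<close> applies.\<close>
  define j0 where "j0 = m + n * m"
  have iter: "apfst (cj (k [^] i)) (\<omega> j0) = \<omega> (j0 + i * m - 2 * i * c) \<and> m \<le> j0 + i * m - 2 * i * c
      \<and> j0 + i * m - 2 * i * c \<le> j0 + i * m \<and> 2 * i * c \<le> j0 + i * m" if "i \<le> n" for i
    using that
  proof (induction i)
    case 0
    then show ?case using \<omega>_carrier by (simp add: prod_eq_iff j0_def)
  next
    case (Suc i)
    let ?j = "j0 + i * m - 2 * i * c"
    have IH: "apfst (cj (k [^] i)) (\<omega> j0) = \<omega> ?j" "m \<le> ?j" "?j \<le> j0 + i * m" "2 * i * c \<le> j0 + i * m"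
      using Suc by auto
    have im: "Suc i * m \<le> n * m" "Suc i * c \<le> Suc i * m" using Suc.prems c(1) by (intro mult_le_mono; simp)+
    have "?j + 2 * m < N * n" using IH(3) im Nn by (simp add: N_def j0_def)
    then have "apfst (cj k) (\<omega> ?j) = \<omega> (?j + m - 2 * c)" using shift IH(2) by blast
    moreover have "?j + m - 2 * c = j0 + Suc i * m - 2 * Suc i * c" using IH(4) by simp
    moreover have "apfst (cj (k [^] Suc i)) (\<omega> j0) = apfst (cj k) (apfst (cj (k [^] i)) (\<omega> j0))"
      using kG \<omega>_carrier[of j0] nat_pow_Suc2[of k i] by (simp add: cj_cj prod_eq_iff del: nat_pow_Suc)
    ultimately show ?case using IH im by (simp add: j0_def)
  qed
  have kt: "expo t k = expo t b" "expo t h = expo t a" if "t \<notin> st u" for t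
    using that a b by (auto simp: k_def h)
  have it: "apfst (cj (k [^] n)) (\<omega> j0) = \<omega> (j0 + n * m - 2 * n * c)" using iter[of n] by simp
  \<comment> \<open>Indices are natural numbers, so the sign of the shift decides which side of the
    equation carries the power of \<open>h\<close>.\<close>
  show ?thesis
  proof (cases "2 * c \<le> m")
    case True
    have "n * (2 * c) \<le> n * m" using True by (rule mult_le_mono2)
    then have "j0 + n * m - 2 * n * c = j0 + n * (m - 2 * c)" by (simp add: diff_mult_distrib2)
    then have "cj (k [^] n) (fst (\<omega> j0)) = cj (h [^] (m - 2 * c)) (fst (\<omega> j0))"
      using it \<omega>_pow[of j0 "m - 2 * c"] by (metis fst_apfst)
    then have "int n * expo t b = int (m - 2 * c) * expo t a" if "t \<notin> st u" for t
      using cj_letter_eq_imp_expo_eq[OF u that \<omega>_letter[of j0], of "k [^] n" "h [^] (m - 2 * c)"] kG hG kt[OF that]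
      by simp
    then show ?thesis using n by (intro exI[of _ "int (m - 2 * c)"] exI[of _ "int n"]) simp
  next
    case False
    let ?s = "2 * c - m" and ?i = "j0 + n * m - 2 * n * c"
    have "n * m \<le> n * (2 * c)" using False by (intro mult_le_mono2) simp
    moreover have "2 * n * c \<le> j0 + n * m" using iter[of n] by simp
    ultimately have "j0 = ?i + n * ?s" by (simp add: diff_mult_distrib2)
    then have "\<omega> j0 = apfst (cj (h [^] ?s)) (\<omega> ?i)" using \<omega>_pow[of ?i ?s] by metis
    also have "\<omega> ?i = apfst (cj (k [^] n)) (\<omega> j0)" using it by simp
    finally have "fst (\<omega> j0) = cj (h [^] ?s) (cj (k [^] n) (fst (\<omega> j0)))" by (metis fst_apfst)
    then have "cj (h [^] ?s \<otimes> k [^] n) (fst (\<omega> j0)) = cj \<one> (fst (\<omega> j0))"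
      using kG hG \<omega>_carrier by (simp add: cj_cj)
    then have "int n * expo t b = - int ?s * expo t a" if "t \<notin> st u" for t
      using cj_letter_eq_imp_expo_eq[OF u that \<omega>_letter[of j0], of "h [^] ?s \<otimes> k [^] n" \<one>] kG hG kt[OF that]
      by simp
    then show ?thesis using n by (intro exI[of _ "- int ?s"] exI[of _ "int n"]) simp
  qed
qed

text \<open>The hypothesis \<open>nc\<close> says that \<open>a\<close> fixes no vertex of the tree.
  Exponents are invariant under conjugation, so \<open>a\<close> may be replaced by a cyclically
  reduced conjugate.\<close>

lemma commuting_expo_proportional:
  assumes u: "u \<in> V" and a: "a \<in> carrier G" and b: "b \<in> carrier G" and ab: "a \<otimes> b = b \<otimes> a"
    and nc: "\<And>y. y \<in> carrier G \<Longrightarrow> cj y a \<notin> par (- {u})"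
  shows "\<exists>p q. q \<noteq> 0 \<and> (\<forall>t. t \<notin> st u \<longrightarrow> q * expo t b = p * expo t a)"
proof -
  obtain y where y: "y \<in> carrier G" "tact u (cj y a) [] \<noteq> []"
    "reduced (tact u (cj y a) [] @ map (apfst (cj (retr (- {u}) (cj y a)))) (tact u (cj y a) []))"
    using exists_min_conjugate[OF u a nc] by blast
  have "cj y a \<otimes> cj y b = cj y b \<otimes> cj y a" using y a b ab by (simp flip: cj_mult)
  then show ?thesis
    using commuting_expo_proportional_aux[OF u, of "cj y a" "cj y b"] y a b by simp
qed

section \<open>Automorphisms and rigid vertex sets\<close>

text \<open>For \<open>u\<close> outside the star of \<open>v\<close>, \<open>gen v\<close> fixes
  the base vertex of the tree of \<open>u\<close> and no other. As \<open>g\<close> commutes with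
  it, \<open>g\<close> fixes that vertex too; intersecting over all such \<open>u\<close> gives the
  claim.\<close>

lemma centralizer_gen:
  assumes "v \<in> V" "g \<in> carrier G" "g \<otimes> gen v = gen v \<otimes> g"
  shows "g \<in> par (st v)"
proof -
  have "g \<in> par (- {u})" if u: "u \<in> V - st v" for u
  proof -
    have "inv g \<otimes> gen v = gen v \<otimes> inv g" using commute_inv[of "gen v" g] assms by simp
    then have "cj (inv g) (gen v) = gen v" using assms by (simp add: cj_eq_iff_commute)
    moreover have "gen v \<in> par (- {u})" using u assms by (intro par_closed) auto
    ultimately show ?thesis
      using conj_in_par_imp[of u "gen v" g v] u assms st_sym[of v u] by simp
  qed
  then have "g \<in> par (V \<inter> (\<Inter>u\<in>V - st v. - {u}))"
    using assms finite_V by (intro par_INT par_V) auto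
  then show ?thesis by (rule par_mono) auto
qed

lemma centralizer_gens:
  assumes "W \<subseteq> V" "g \<in> carrier G" "\<And>v. v \<in> W \<Longrightarrow> g \<otimes> gen v = gen v \<otimes> g"
    and "\<And>x. x \<in> V \<Longrightarrow> (\<And>v. v \<in> W \<Longrightarrow> x \<in> st v) \<Longrightarrow> x \<in> S"
  shows "g \<in> par S"
proof -
  have "g \<in> par (V \<inter> (\<Inter>v\<in>W. st v))"
    using assms finite_subset[OF assms(1) finite_V] by (intro par_INT par_V centralizer_gen) auto
  then show ?thesis by (rule par_mono) (use assms(4) in blast)
qed

section \<open>Conjugation into parabolic subgroups\<close>

definition conj_into :: "'v set \<Rightarrow> 'v word set \<Rightarrow> bool" where
  "conj_into S a \<longleftrightarrow> (\<exists>y\<in>carrier G. cj y a \<in> par S)"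

text \<open>Retracting the conjugate in \<open>par T\<close> onto \<open>S\<close> yields again a
  conjugate of \<open>a\<close>, because \<open>cj y a\<close> is fixed by
  \<open>retr S\<close>.\<close>

lemma conj_into_Int:
  assumes "a \<in> carrier G" "conj_into S a" "conj_into T a"
  shows "conj_into (S \<inter> T) a"
proof -
  obtain y z where yz: "y \<in> carrier G" "cj y a \<in> par S" "z \<in> carrier G" "cj z a \<in> par T"
    using assms by (auto simp: conj_into_def)
  let ?c = "z \<otimes> inv y"
  have "cj z a = cj ?c (cj y a)" using yz assms by (simp add: cj_cj m_assoc)
  then have "retr S (cj z a) = cj (retr S ?c) (cj y a)" using yz assms by (simp add: retr_cj)
  moreover have "retr S (cj z a) \<in> par (S \<inter> T)" using retr_par[OF yz(4), of S] by (simp add: Int_commute)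
  moreover have "cj (retr S ?c) (cj y a) = cj (retr S ?c \<otimes> y) a" using yz assms by (simp add: cj_cj)
  ultimately show ?thesis unfolding conj_into_def using yz by (intro bexI[of _ "retr S ?c \<otimes> y"]) auto
qed

lemma conj_into_mono: "conj_into S a \<Longrightarrow> S \<subseteq> T \<Longrightarrow> conj_into T a"
  unfolding conj_into_def using par_mono by blast

lemma conj_into_Diff:
  assumes "a \<in> carrier G" "finite U" "\<And>u. u \<in> U \<Longrightarrow> conj_into (- {u}) a"
  shows "conj_into (V - U) a"
  using assms(2,3)
proof (induction U)
  case empty
  have "cj \<one> a \<in> par (V - {})" using assms par_V by simp
  then show ?case unfolding conj_into_def by blast
next
  case (insert u U)
  then have "conj_into ((V - U) \<inter> - {u}) a" using assms by (intro conj_into_Int) auto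
  moreover have "(V - U) \<inter> - {u} = V - insert u U" by auto
  ultimately show ?case by simp
qed

text \<open>On the abelianization a homomorphism acts linearly; the numbers
  \<open>expo t (\<phi> (gen v))\<close> are its matrix.\<close>

lemma expo_hom:
  assumes "\<phi> \<in> hom G G" "g \<in> carrier G"
  shows "expo t (\<phi> g) = (\<Sum>v\<in>V. expo v g * expo t (\<phi> (gen v)))"
proof -
  interpret group_hom G G \<phi> using assms is_group by (simp add: group_hom_def group_hom_axioms_def)
  have sum: "(\<Sum>v\<in>V. (c * (if w = v then 1 else 0) + f v) * h v) = c * h w + (\<Sum>v\<in>V. f v * h v)"
    if "w \<in> V" for w and f h :: "'v \<Rightarrow> int" and c
  proof -
    have "(\<Sum>v\<in>V. (c * (if w = v then 1 else 0) + f v) * h v)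
        = (\<Sum>v\<in>V. if w = v then c * h v else 0) + (\<Sum>v\<in>V. f v * h v)"
      unfolding sum.distrib[symmetric] by (intro sum.cong) (auto simp: algebra_simps)
    then show ?thesis using that finite_V by simp
  qed
  show ?thesis using assms(2)
  proof (induction rule: raag_induct)
    case (gen v g)
    then show ?case using sum[of v 1 "\<lambda>v. expo v g"] by simp
  next
    case (inv_gen v g)
    then show ?case using sum[of v "-1" "\<lambda>v. expo v g"] by simp
  qed simp
qed

section \<open>Images of generators under automorphisms\<close>

definition link_separated :: bool where
  "link_separated \<longleftrightarrow> (\<forall>v\<in>V. \<forall>v'\<in>V. v \<noteq> v' \<longrightarrow>
     (\<exists>w1 w2. w1 \<noteq> w2 \<and> w1 \<in> lk v - st v' \<and> w2 \<in> lk v - st v'))"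

text \<open>The argument runs in the abelianization, on coordinates outside \<open>st v'\<close>. If
  \<open>\<psi> (gen u)\<close> fixed no vertex of the tree of \<open>v'\<close>, the images under
  \<open>\<psi>\<close> of all of \<open>st u\<close> would be proportional there to one vector
  \<open>z\<close>. For \<open>w\<close> in \<open>lk v\<close> some combination q w - p v with
  nonzero q is mapped by \<open>\<phi>\<close> into the span of \<open>st u\<close>, so away from
  \<open>v\<close> the unit vector of \<open>w\<close> is a multiple of \<open>z\<close>. Two
  different \<open>w\<close> contradict this.\<close>

lemma hom_inverse_conj_into:
  assumes sep: link_separated
    and \<phi>: "\<phi> \<in> hom G G" and \<psi>: "\<psi> \<in> hom G G" and \<psi>\<phi>: "\<And>x. x \<in> carrier G \<Longrightarrow> \<psi> (\<phi> x) = x"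
    and v: "v \<in> V" and u: "u \<in> V" and nc: "\<not> conj_into (- {u}) (\<phi> (gen v))"
    and v': "v' \<in> V" "v' \<noteq> v"
  shows "conj_into (- {v'}) (\<psi> (gen u))"
proof (rule ccontr)
  assume nc': "\<not> ?thesis"
  interpret \<phi>: group_hom G G \<phi> using \<phi> is_group by (simp add: group_hom_def group_hom_axioms_def)
  interpret \<psi>: group_hom G G \<psi> using \<psi> is_group by (simp add: group_hom_def group_hom_axioms_def)
  define z where "z s = real_of_int (expo s (\<psi> (gen u)))" for s
  have ratio: "\<exists>r::real. \<forall>s. s \<notin> st v' \<longrightarrow> expo s (\<psi> (gen t)) = r * z s" if t: "t \<in> st u" for t
  proof -
    have tV: "t \<in> V" using t u lkD by auto
    have "gen u \<otimes> gen t = gen t \<otimes> gen u" using t gen_commute by auto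
    then have "\<psi> (gen u) \<otimes> \<psi> (gen t) = \<psi> (gen t) \<otimes> \<psi> (gen u)"
      using u tV by (simp flip: \<psi>.hom_mult)
    then obtain p q where pq: "q \<noteq> 0" "\<And>s. s \<notin> st v' \<Longrightarrow> q * expo s (\<psi> (gen t)) = p * expo s (\<psi> (gen u))"
      using commuting_expo_proportional[OF v'(1), of "\<psi> (gen u)" "\<psi> (gen t)"] nc' u tV
      unfolding conj_into_def by auto
    have "real_of_int (expo s (\<psi> (gen t))) = (p / q) * z s" if "s \<notin> st v'" for s
      using pq(1) arg_cong[OF pq(2)[OF that], of real_of_int] by (simp add: z_def field_simps)
    then show ?thesis by blast
  qed
  then obtain r where r: "\<And>t s. t \<in> st u \<Longrightarrow> s \<notin> st v' \<Longrightarrow> real_of_int (expo s (\<psi> (gen t))) = r t * z s"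
    by metis
  have key: "\<exists>q \<rho>::real. q \<noteq> 0 \<and> (\<forall>s. s \<notin> st v' \<longrightarrow> s \<noteq> v \<longrightarrow> (if s = w then q else 0) = \<rho> * z s)"
    if w: "w \<in> lk v" for w
  proof -
    have wV: "w \<in> V" "w \<noteq> v" using lkD[OF w] by auto
    have "\<phi> (gen v) \<otimes> \<phi> (gen w) = \<phi> (gen w) \<otimes> \<phi> (gen v)"
      using v wV gen_commute[OF w] by (simp flip: \<phi>.hom_mult)
    then obtain p q where pq: "q \<noteq> 0" "\<And>t. t \<notin> st u \<Longrightarrow> q * expo t (\<phi> (gen w)) = p * expo t (\<phi> (gen v))"
      using commuting_expo_proportional[OF u, of "\<phi> (gen v)" "\<phi> (gen w)"] nc v wV
      unfolding conj_into_def by auto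
    \<comment> \<open>Coordinates of the image of the combination; by \<open>pq\<close> they vanish
      outside \<open>st u\<close>.\<close>
    define c where "c t = q * expo t (\<phi> (gen w)) - p * expo t (\<phi> (gen v))" for t
    have ex: "expo s (gen x) = (\<Sum>t\<in>V. expo t (\<phi> (gen x)) * expo s (\<psi> (gen t)))" if "x \<in> V" for s x
      using expo_hom[OF \<psi>, of "\<phi> (gen x)" s] that \<psi>\<phi> by simp
    have "(if s = w then real_of_int q else 0) = (\<Sum>t\<in>V. if t \<in> st u then c t * r t else 0) * z s"
      if s: "s \<notin> st v'" "s \<noteq> v" for s
    proof -
      have "q * expo s (gen w) - p * expo s (gen v) = (\<Sum>t\<in>V. c t * expo s (\<psi> (gen t)))"
        unfolding ex[OF wV(1)] ex[OF v] c_def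
        by (simp add: sum_distrib_left sum_subtractf[symmetric] algebra_simps)
      then have "(if s = w then q else 0) = (\<Sum>t\<in>V. c t * expo s (\<psi> (gen t)))"
        using s by (auto split: if_splits)
      then have "real_of_int (if s = w then q else 0) = real_of_int (\<Sum>t\<in>V. c t * expo s (\<psi> (gen t)))"
        by (simp only:)
      then have "(if s = w then real_of_int q else 0) = (\<Sum>t\<in>V. c t * real_of_int (expo s (\<psi> (gen t))))"
        by (simp split: if_splits)
      also have "\<dots> = (\<Sum>t\<in>V. (if t \<in> st u then c t * r t else 0) * z s)"
      proof (rule sum.cong)
        fix t
        show "c t * real_of_int (expo s (\<psi> (gen t))) = (if t \<in> st u then c t * r t else 0) * z s"
          using r[of t s] s pq(2)[of t] by (cases "t \<in> st u") (auto simp: c_def)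
      qed simp
      finally show ?thesis by (simp add: sum_distrib_right)
    qed
    then show ?thesis using pq(1)
      by (intro exI[of _ "real_of_int q"] exI[of _ "\<Sum>t\<in>V. if t \<in> st u then c t * r t else 0"]) auto
  qed
  obtain w1 w2 where w: "w1 \<noteq> w2" "w1 \<in> lk v" "w1 \<notin> st v'" "w2 \<in> lk v" "w2 \<notin> st v'"
    using sep v v' unfolding link_separated_def by (metis DiffE)
  have "w1 \<noteq> v" "w2 \<noteq> v" using lkD w by blast+
  obtain q1 \<rho>1 where 1: "q1 \<noteq> 0" "\<And>s. s \<notin> st v' \<Longrightarrow> s \<noteq> v \<Longrightarrow> (if s = w1 then q1 else 0) = \<rho>1 * z s"
    using key[OF w(2)] by blast
  obtain q2 \<rho>2 where 2: "q2 \<noteq> 0" "\<And>s. s \<notin> st v' \<Longrightarrow> s \<noteq> v \<Longrightarrow> (if s = w2 then q2 else 0) = \<rho>2 * z s"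
    using key[OF w(4)] by blast
  show False
    using 1(1) 2(1) 1(2)[of w1] 1(2)[of w2] 2(2)[of w2] w \<open>w1 \<noteq> v\<close> \<open>w2 \<noteq> v\<close> by auto
qed

text \<open>Some \<open>u\<close> has a tree in which \<open>\<phi> (gen v)\<close> fixes no vertex.
  By \<open>hom_inverse_conj_into\<close>, \<open>\<psi> (gen u)\<close> is then conjugate into
  \<open>par (- {v'})\<close> for every \<open>v' \<noteq> v\<close>, hence to a power of
  \<open>gen v\<close>.\<close>

lemma automorphism_gen:
  assumes sep: link_separated
    and \<phi>: "\<phi> \<in> hom G G" and \<psi>: "\<psi> \<in> hom G G"
    and \<psi>\<phi>: "\<And>x. x \<in> carrier G \<Longrightarrow> \<psi> (\<phi> x) = x" and \<phi>\<psi>: "\<And>x. x \<in> carrier G \<Longrightarrow> \<phi> (\<psi> x) = x"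
    and v: "v \<in> V"
  shows "\<exists>u\<in>V. \<exists>b. \<exists>y\<in>carrier G. \<phi> (gen v) = cj y (if b then gen u else inv (gen u))"
proof -
  interpret \<phi>: group_hom G G \<phi> using \<phi> is_group by (simp add: group_hom_def group_hom_axioms_def)
  interpret \<psi>: group_hom G G \<psi> using \<psi> is_group by (simp add: group_hom_def group_hom_axioms_def)
  have "\<exists>u\<in>V. \<not> conj_into (- {u}) (\<phi> (gen v))"
  proof (rule ccontr)
    assume "\<not> ?thesis"
    then have "conj_into {} (\<phi> (gen v))" using conj_into_Diff[of "\<phi> (gen v)" V] v finite_V by simp
    then obtain y where "y \<in> carrier G" "cj y (\<phi> (gen v)) = \<one>" using par_empty by (auto simp: conj_into_def)
    then have "\<phi> (gen v) = \<one>" using cj_inject[of y "\<phi> (gen v)" \<one>] v by simp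
    then have "gen v = \<one>" using \<psi>\<phi>[of "gen v"] v by simp
    then show False using expo_gen[of v v] by simp
  qed
  then obtain u where u: "u \<in> V" "\<not> conj_into (- {u}) (\<phi> (gen v))" by blast
  have "conj_into (V - (V - {v})) (\<psi> (gen u))"
    using u v finite_V hom_inverse_conj_into[OF sep \<phi> \<psi> \<psi>\<phi> v u] by (intro conj_into_Diff) auto
  then have "conj_into {v} (\<psi> (gen u))" by (rule conj_into_mono) auto
  then obtain y where y: "y \<in> carrier G" "cj y (\<psi> (gen u)) \<in> par {v}" by (auto simp: conj_into_def)
  define k where "k = expo v (cj y (\<psi> (gen u)))"
  have yk: "cj y (\<psi> (gen u)) = gen v [^] k" unfolding k_def by (rule par_single[OF y(2) v])
  have "\<phi> (cj y (\<psi> (gen u))) = cj (\<phi> y) (gen u)" using y u \<phi>\<psi> by (simp add: cj_def)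
  then have eq: "cj (\<phi> y) (gen u) = \<phi> (gen v [^] k)" using yk by simp
  have gV: "gen v [^] k \<in> carrier G" using v by simp
  \<comment> \<open>Comparing exponents of \<open>u\<close> shows that \<open>k\<close> divides
    1.\<close>
  have "1 = expo u (cj (\<phi> y) (gen u))" using y u by simp
  also have "\<dots> = (\<Sum>x\<in>V. (if v = x then k else 0) * expo u (\<phi> (gen x)))"
    unfolding eq expo_hom[OF \<phi> gV] using v by (intro sum.cong) auto
  also have "\<dots> = (\<Sum>x\<in>V. if v = x then k * expo u (\<phi> (gen x)) else 0)" by (intro sum.cong) auto
  also have "\<dots> = k * expo u (\<phi> (gen v))" using v finite_V by simp
  finally have k: "k = 1 \<or> k = -1" by (metis zmult_eq_1_iff)
  from k show ?thesis
  proof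
    assume "k = 1"
    then have "\<phi> (gen v) = cj (\<phi> y) (if True then gen u else inv (gen u))" using eq v by simp
    then show ?thesis using u y by (intro bexI[of _ u] exI[of _ True] bexI[of _ "\<phi> y"]) simp_all
  next
    assume k: "k = -1"
    have "inv (cj (\<phi> y) (gen u)) = \<phi> (gen v)" using v by (simp add: eq k int_pow_neg)
    then have "\<phi> (gen v) = cj (\<phi> y) (if False then gen u else inv (gen u))" using y u by (simp add: cj_inv)
    then show ?thesis using u y by (intro bexI[of _ u] exI[of _ False] bexI[of _ "\<phi> y"]) simp_all
  qed
qed

section \<open>Rigid vertex sets\<close>

inductive_set reach :: "'v set \<Rightarrow> 'v \<Rightarrow> 'v \<Rightarrow> 'v set" for S u v0 where
  start: "v0 \<in> reach S u v0"
| step: "x \<in> reach S u v0 \<Longrightarrow> x \<notin> st u \<Longrightarrow> y \<in> S \<Longrightarrow> y \<in> lk x \<Longrightarrow> y \<in> reach S u v0"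

text \<open>Paths in \<open>reach\<close> may end in the star of \<open>u\<close> but not pass
  through it: only conjugates of generators outside the star have a unique fixed vertex. The vertex
  \<open>u\<close> is exempt, since its conjugates fix no vertex. The second vertex
  \<open>v1\<close> serves when one vertex has to be avoided, as in
  \<open>rigid_common_vertex\<close>.\<close>

definition rigid :: "'v set \<Rightarrow> bool" where
  "rigid S \<longleftrightarrow> S \<subseteq> V \<and> (\<forall>u\<in>V. \<exists>v0 v1. v0 \<in> S - st u \<and> v1 \<in> S - st u \<and> v0 \<noteq> v1 \<and> S - {u} \<subseteq> reach S u v0)"

definition conj_system :: "'v set \<Rightarrow> ('v \<Rightarrow> 'v word set) \<Rightarrow> bool" where
  "conj_system S f \<longleftrightarrow> (\<forall>v\<in>S. \<exists>y\<in>carrier G. f v = cj y (gen v)) \<and>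
     (\<forall>v\<in>S. \<forall>w\<in>S. w \<in> lk v \<longrightarrow> f v \<otimes> f w = f w \<otimes> f v)"

lemma conj_system_carrier: "conj_system S f \<Longrightarrow> S \<subseteq> V \<Longrightarrow> v \<in> S \<Longrightarrow> f v \<in> carrier G"
  unfolding conj_system_def by force

lemma conj_system_expo: "conj_system S f \<Longrightarrow> S \<subseteq> V \<Longrightarrow> v \<in> S \<Longrightarrow> expo v (f v) = 1"
  unfolding conj_system_def by force

lemma conj_system_cj:
  assumes "conj_system S f" "S \<subseteq> V" "g \<in> carrier G"
  shows "conj_system S (\<lambda>v. cj g (f v))"
  unfolding conj_system_def
proof (intro conjI ballI impI)
  fix v assume v: "v \<in> S"
  then obtain y where "y \<in> carrier G" "f v = cj y (gen v)" using assms by (auto simp: conj_system_def)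
  then show "\<exists>y\<in>carrier G. cj g (f v) = cj y (gen v)"
    using assms v by (intro bexI[of _ "g \<otimes> y"]) (auto simp: cj_cj)
next
  fix v w assume vw: "v \<in> S" "w \<in> S" "w \<in> lk v"
  then have "f v \<otimes> f w = f w \<otimes> f v" using assms by (auto simp: conj_system_def)
  then show "cj g (f v) \<otimes> cj g (f w) = cj g (f w) \<otimes> cj g (f v)"
    using conj_system_carrier[OF assms(1,2)] vw assms(3) by (simp flip: cj_mult)
qed

text \<open>A vertex fixed by \<open>f v0\<close> is carried along the paths: for \<open>x\<close>
  outside the star, \<open>f x\<close> fixes only this vertex, so everything commuting with
  \<open>f x\<close> fixes it too.\<close>

lemma rigid_fixed_vertex:
  assumes rig: "rigid S" and f: "conj_system S f" and u: "u \<in> V"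
  shows "\<exists>g\<in>carrier G. \<forall>v\<in>S - {u}. cj (inv g) (f v) \<in> par (- {u})"
proof -
  have S: "S \<subseteq> V" using rig by (simp add: rigid_def)
  obtain v0 where v0: "v0 \<in> S" "v0 \<notin> st u" "S - {u} \<subseteq> reach S u v0"
    using rig u unfolding rigid_def by blast
  obtain g where g: "g \<in> carrier G" "f v0 = cj g (gen v0)" using f v0 by (auto simp: conj_system_def)
  have "x \<in> S \<and> cj (inv g) (f x) \<in> par (- {u})" if "x \<in> reach S u v0" for x
    using that
  proof induction
    case start
    have "gen v0 \<in> par (- {u})" using v0 S by (intro par_closed) auto
    then show ?case using v0 g S by auto
  next
    case (step x y)
    let ?a = "cj (inv g) (f x)" and ?z = "cj (inv g) (f y)"
    have c: "f x \<in> carrier G" "f y \<in> carrier G" using conj_system_carrier[OF f S] step by auto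
    have "f x \<otimes> f y = f y \<otimes> f x" using f step by (auto simp: conj_system_def)
    then have "?a \<otimes> ?z = ?z \<otimes> ?a" using c g by (simp flip: cj_mult)
    then have "cj (inv ?z) ?a = ?a"
      using commute_inv[of ?a ?z] c g by (simp add: cj_eq_iff_commute)
    moreover have "expo x ?a \<noteq> 0" using conj_system_expo[OF f S, of x] step c g by simp
    ultimately show ?case
      using conj_in_par_imp[OF u, of ?a ?z x] step c g by auto
  qed
  then show ?thesis using v0 g by blast
qed

text \<open>The induction step for \<open>rigid_conj\<close>: the base vertices of the trees of
  \<open>U\<close> already serve, so the correction \<open>g\<close> for \<open>w\<close> must fix
  them. Retracting away each \<open>u\<close> in turn achieves this.\<close>

lemma rigid_common_vertex:
  assumes rig: "rigid S" and f: "conj_system S f" and w: "w \<in> V"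
    and "finite U" "U \<subseteq> V"
    and fU: "\<And>u v. u \<in> U \<Longrightarrow> v \<in> S - {u} \<Longrightarrow> f v \<in> par (- {u})"
  shows "\<exists>g\<in>carrier G. (\<forall>u\<in>U. g \<in> par (- {u})) \<and> (\<forall>v\<in>S - {w}. cj (inv g) (f v) \<in> par (- {w}))"
  using assms(4-6)
proof (induction U)
  case empty
  then show ?case using rigid_fixed_vertex[OF rig f w] by simp
next
  case (insert u U)
  then obtain g where g: "g \<in> carrier G" "\<And>x. x \<in> U \<Longrightarrow> g \<in> par (- {x})"
    "\<And>v. v \<in> S - {w} \<Longrightarrow> cj (inv g) (f v) \<in> par (- {w})" by auto
  have S: "S \<subseteq> V" using rig by (simp add: rigid_def)
  note fc = conj_system_carrier[OF f S]
  \<comment> \<open>\<open>g'\<close> and \<open>g\<close> determine the same vertex of the tree of \<open>w\<close>, since \<open>f v\<close> has only one fixed vertex.\<close>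
  define g' where "g' = retr (- {u}) g"
  have g': "g' \<in> carrier G" using g by (simp add: g'_def)
  obtain v where v: "v \<in> S" "v \<notin> st w" "v \<noteq> u"
    using rig w unfolding rigid_def by (metis DiffD1 DiffD2)
  let ?a = "cj (inv g) (f v)" and ?y = "inv g \<otimes> g'"
  have a: "?a \<in> par (- {w})" using g(3) v by auto
  have "f v \<in> par (- {u})" using insert.prems(2) v by auto
  then have "cj (inv g') (f v) = retr (- {u}) ?a" using g by (simp add: retr_cj g'_def)
  also have "\<dots> \<in> par (- {w})" using retr_par[OF a, of "- {u}"] by (rule par_mono) auto
  finally have "cj (inv ?y) ?a \<in> par (- {w})"
    using g g' fc v by (simp add: cj_cj inv_mult_group m_assoc)
  moreover have "expo v ?a \<noteq> 0" using conj_system_expo[OF f S] v fc g by simp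
  ultimately have y: "?y \<in> par (- {w})"
    using conj_in_par_imp[OF w a, of ?y v] v g g' by auto
  have "cj (inv g') (f x) \<in> par (- {w})" if "x \<in> S - {w}" for x
  proof -
    have "cj (inv g') (f x) = cj (inv ?y) (cj (inv g) (f x))"
      using g g' fc that by (simp add: cj_cj inv_mult_group m_assoc)
    then show ?thesis using g(3)[OF that] y by (simp add: par_closed)
  qed
  moreover have "g' \<in> par (- {x})" if "x \<in> insert u U" for x
  proof (cases "x = u")
    case True
    then show ?thesis using g by (simp add: g'_def retr_in_par)
  next
    case False
    then have "g \<in> par (- {x})" using that g by auto
    from retr_par[OF this, of "- {u}"] show ?thesis unfolding g'_def by (rule par_mono) auto
  qed
  ultimately show ?case using g' by blast
qed

text \<open>Treating the vertices one at a time gives one \<open>g\<close> for all trees. After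
  conjugation by \<open>inv g\<close>, each \<open>f v\<close> lies in \<open>par (- {u})\<close>
  for all \<open>u \<noteq> v\<close>, so it is a power of \<open>gen v\<close>, and its exponent is
  1.\<close>

lemma rigid_conj:
  assumes rig: "rigid S" and f: "conj_system S f"
  shows "\<exists>g\<in>carrier G. \<forall>v\<in>S. f v = cj g (gen v)"
proof -
  have S: "S \<subseteq> V" using rig by (simp add: rigid_def)
  note fc = conj_system_carrier[OF f S]
  have "\<exists>g\<in>carrier G. \<forall>u\<in>U. \<forall>v\<in>S - {u}. cj (inv g) (f v) \<in> par (- {u})" if "U \<subseteq> V" for U
    using finite_subset[OF that finite_V] that
  proof (induction U)
    case empty
    then show ?case by blast
  next
    case (insert w U)
    then obtain g where g: "g \<in> carrier G" "\<And>u v. u \<in> U \<Longrightarrow> v \<in> S - {u} \<Longrightarrow> cj (inv g) (f v) \<in> par (- {u})"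
      by auto
    have "conj_system S (\<lambda>v. cj (inv g) (f v))" using conj_system_cj[OF f S] g by simp
    from rigid_common_vertex[OF rig this _ insert.hyps(1), of w]
    obtain h where h: "h \<in> carrier G" "\<And>u. u \<in> U \<Longrightarrow> h \<in> par (- {u})"
      "\<And>v. v \<in> S - {w} \<Longrightarrow> cj (inv h) (cj (inv g) (f v)) \<in> par (- {w})"
      using insert.prems g by auto
    have "cj (inv (g \<otimes> h)) (f v) \<in> par (- {u})" if "u \<in> insert w U" "v \<in> S - {u}" for u v
    proof -
      have "cj (inv (g \<otimes> h)) (f v) = cj (inv h) (cj (inv g) (f v))"
        using g h fc that by (simp add: cj_cj inv_mult_group)
      then show ?thesis using that g(2)[of u v] h(2)[of u] h(3)[of v] by (auto simp: par_closed)
    qed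
    then show ?case using g h by (intro bexI[of _ "g \<otimes> h"]) auto
  qed
  from this[OF order_refl] obtain g where g: "g \<in> carrier G"
    "\<And>u v. u \<in> V \<Longrightarrow> v \<in> S - {u} \<Longrightarrow> cj (inv g) (f v) \<in> par (- {u})"
    by blast
  have "f v = cj g (gen v)" if v: "v \<in> S" for v
  proof -
    let ?a = "cj (inv g) (f v)"
    have c: "f v \<in> carrier G" "v \<in> V" using fc v S by auto
    have "?a \<in> par (V \<inter> (\<Inter>u\<in>V - {v}. - {u}))"
      using c g v finite_V by (intro par_INT par_V) auto
    then have "?a \<in> par {v}" by (rule par_mono) auto
    moreover have "expo v ?a = 1" using conj_system_expo[OF f S v] c g by simp
    ultimately have "?a = gen v" using par_single[of ?a v] c by simp
    then show ?thesis using g c cj_inv_cj(2)[of g "f v"] by metis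
  qed
  then show ?thesis using g by blast
qed

section \<open>Outer automorphisms\<close>

sublocale aut: group "AutoGroup G"
  by (rule AutoGroup)

lemma aut_carrier [simp]: "carrier (AutoGroup G) = auto G"
  by (simp add: AutoGroup_def)

lemmas auto_group_closed [simp] =
  aut.one_closed[unfolded aut_carrier] aut.m_closed[unfolded aut_carrier] aut.inv_closed[unfolded aut_carrier]

lemma auto_hom: "\<phi> \<in> auto G \<Longrightarrow> \<phi> \<in> hom G G"
  by (simp add: auto_def)

lemma auto_closed [simp]: "\<phi> \<in> auto G \<Longrightarrow> x \<in> carrier G \<Longrightarrow> \<phi> x \<in> carrier G"
  using auto_hom hom_in_carrier by metis

lemma auto_cj:
  assumes "\<phi> \<in> auto G" "g \<in> carrier G" "x \<in> carrier G"
  shows "\<phi> (cj g x) = cj (\<phi> g) (\<phi> x)"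
proof -
  interpret \<phi>: group_hom G G \<phi>
    using auto_hom[OF assms(1)] is_group by (simp add: group_hom_def group_hom_axioms_def)
  show ?thesis using assms by (simp add: cj_def)
qed

lemma auto_apply_mult [simp]:
  assumes "\<phi> \<in> auto G" "\<chi> \<in> auto G" "x \<in> carrier G"
  shows "(\<phi> \<otimes>\<^bsub>AutoGroup G\<^esub> \<chi>) x = \<phi> (\<chi> x)"
  using assms by (simp add: AutoGroup_def BijGroup_def auto_def compose_def)

lemma auto_apply_one [simp]: "x \<in> carrier G \<Longrightarrow> \<one>\<^bsub>AutoGroup G\<^esub> x = x"
  by (simp add: AutoGroup_def BijGroup_def)

lemma auto_apply_inv [simp]:
  assumes "\<phi> \<in> auto G" "x \<in> carrier G"
  shows "\<phi> ((inv\<^bsub>AutoGroup G\<^esub> \<phi>) x) = x" "(inv\<^bsub>AutoGroup G\<^esub> \<phi>) (\<phi> x) = x"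
  using assms auto_apply_mult[of \<phi> "inv\<^bsub>AutoGroup G\<^esub> \<phi>" x] auto_apply_mult[of "inv\<^bsub>AutoGroup G\<^esub> \<phi>" \<phi> x]
    aut.inv_closed[of \<phi>] aut.r_inv[of \<phi>] aut.l_inv[of \<phi>] by simp_all

lemma auto_eqI:
  assumes "\<phi> \<in> auto G" "\<chi> \<in> auto G" "\<And>v. v \<in> V \<Longrightarrow> \<phi> (gen v) = \<chi> (gen v)"
  shows "\<phi> = \<chi>"
proof (rule extensionalityI[of _ "carrier G"])
  show "\<phi> x = \<chi> x" if "x \<in> carrier G" for x
    using hom_eqI[OF is_group auto_hom[OF assms(1)] auto_hom[OF assms(2)] assms(3) that] .
qed (use assms in \<open>auto simp: auto_def Bij_def\<close>)

text \<open>Inverse relations need checking on generators only; \<open>restrict\<close> appears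
  because members of \<open>auto G\<close> are extensional.\<close>

lemma autoI:
  assumes "\<phi> \<in> hom G G" "\<psi> \<in> hom G G"
    and "\<And>v. v \<in> V \<Longrightarrow> \<psi> (\<phi> (gen v)) = gen v" "\<And>v. v \<in> V \<Longrightarrow> \<phi> (\<psi> (gen v)) = gen v"
  shows "restrict \<phi> (carrier G) \<in> auto G"
proof -
  have id: "(\<lambda>x. x) \<in> hom G G" by (simp add: hom_def)
  have "\<psi> (\<phi> x) = x" "\<phi> (\<psi> x) = x" if "x \<in> carrier G" for x
    using hom_eqI[OF is_group _ id, of "\<lambda>x. \<psi> (\<phi> x)" x] hom_eqI[OF is_group _ id, of "\<lambda>x. \<phi> (\<psi> x)" x]
      that assms by (auto simp: hom_def Pi_iff)
  moreover have "\<phi> x \<in> carrier G" "\<psi> x \<in> carrier G" if "x \<in> carrier G" for x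
    using assms that by (auto simp: hom_def)
  ultimately have "bij_betw \<phi> (carrier G) (carrier G)"
    by (intro bij_betwI[of _ _ _ \<psi>]) auto
  then have "bij_betw (restrict \<phi> (carrier G)) (carrier G) (carrier G)"
    using bij_betw_cong[of "carrier G" "restrict \<phi> (carrier G)" \<phi>] by simp
  moreover have "restrict \<phi> (carrier G) \<in> hom G G"
    using assms(1) by (simp add: hom_def Pi_iff)
  ultimately show ?thesis by (simp add: auto_def Bij_def)
qed

definition inn :: "'v word set \<Rightarrow> 'v word set \<Rightarrow> 'v word set" where
  "inn g = restrict (cj g) (carrier G)"

lemma inn_apply [simp]: "x \<in> carrier G \<Longrightarrow> inn g x = cj g x"
  by (simp add: inn_def)

lemma inn_auto [simp]: "g \<in> carrier G \<Longrightarrow> inn g \<in> auto G"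
  unfolding inn_def by (rule autoI[of _ "cj (inv g)"]) (simp_all add: cj_hom)

lemma Inn_eq: "Inn G = inn ` carrier G"
  unfolding Inn_def inn_def cj_def by auto

lemma inn_mult: "g \<in> carrier G \<Longrightarrow> h \<in> carrier G \<Longrightarrow> inn g \<otimes>\<^bsub>AutoGroup G\<^esub> inn h = inn (g \<otimes> h)"
  by (rule auto_eqI) (use aut.m_closed[of "inn g" "inn h"] in \<open>simp_all add: cj_cj\<close>)

lemma inn_one: "inn \<one> = \<one>\<^bsub>AutoGroup G\<^esub>"
  by (rule auto_eqI) (use aut.one_closed in simp_all)

lemma inn_inv: "g \<in> carrier G \<Longrightarrow> inv\<^bsub>AutoGroup G\<^esub> (inn g) = inn (inv g)"
  by (rule aut.inv_equality) (simp_all add: inn_mult inn_one)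

lemma auto_inn:
  assumes "\<phi> \<in> auto G" "g \<in> carrier G"
  shows "\<phi> \<otimes>\<^bsub>AutoGroup G\<^esub> inn g = inn (\<phi> g) \<otimes>\<^bsub>AutoGroup G\<^esub> \<phi>"
  by (rule auto_eqI)
     (use assms aut.m_closed[of \<phi> "inn g"] aut.m_closed[of "inn (\<phi> g)" \<phi>] in \<open>simp_all add: auto_cj\<close>)

lemma Inn_normal: "Inn G \<lhd> AutoGroup G"
proof (subst aut.normal_inv_iff, intro conjI ballI)
  show "subgroup (Inn G) (AutoGroup G)"
  proof (rule aut.subgroupI)
    show "Inn G \<noteq> {}" unfolding Inn_eq by blast
  qed (auto simp: Inn_eq inn_mult inn_inv)
next
  fix \<phi> i assume "\<phi> \<in> carrier (AutoGroup G)" "i \<in> Inn G"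
  then obtain g where *: "\<phi> \<in> auto G" "g \<in> carrier G" "i = inn g" by (auto simp: Inn_eq)
  then have "\<phi> \<otimes>\<^bsub>AutoGroup G\<^esub> i \<otimes>\<^bsub>AutoGroup G\<^esub> inv\<^bsub>AutoGroup G\<^esub> \<phi> = inn (\<phi> g)"
    by (simp add: auto_inn aut.m_assoc)
  then show "\<phi> \<otimes>\<^bsub>AutoGroup G\<^esub> i \<otimes>\<^bsub>AutoGroup G\<^esub> inv\<^bsub>AutoGroup G\<^esub> \<phi> \<in> Inn G"
    using * by (simp add: Inn_eq)
qed

definition oc :: "('v word set \<Rightarrow> 'v word set) \<Rightarrow> ('v word set \<Rightarrow> 'v word set) set" where
  "oc \<phi> = Inn G #>\<^bsub>AutoGroup G\<^esub> \<phi>"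

sublocale out: group_hom "AutoGroup G" "Out G" oc
proof -
  have "oc \<in> hom (AutoGroup G) (Out G)"
    unfolding Out_def oc_def[abs_def] by (rule normal.r_coset_hom_Mod[OF Inn_normal])
  moreover have "group (Out G)"
    unfolding Out_def by (rule normal.factorgroup_is_group[OF Inn_normal])
  ultimately show "group_hom (AutoGroup G) (Out G) oc"
    using aut.is_group by (simp add: group_hom_def group_hom_axioms_def)
qed

lemma Out_carrier: "carrier (Out G) = oc ` auto G"
  by (auto simp: Out_def FactGroup_def RCOSETS_def oc_def)

lemma oc_eq_one_iff: "\<phi> \<in> auto G \<Longrightarrow> oc \<phi> = \<one>\<^bsub>Out G\<^esub> \<longleftrightarrow> \<phi> \<in> Inn G"
  using aut.coset_join1[of "Inn G" \<phi>] aut.coset_join2[of \<phi> "Inn G"] normal_imp_subgroup[OF Inn_normal]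
  by (auto simp: oc_def Out_def FactGroup_def)

lemma oc_inn_mult: "g \<in> carrier G \<Longrightarrow> \<phi> \<in> auto G \<Longrightarrow> oc (inn g \<otimes>\<^bsub>AutoGroup G\<^esub> \<phi>) = oc \<phi>"
  using oc_eq_one_iff[of "inn g"] by (simp add: Inn_eq)

section \<open>Pure symmetric automorphisms\<close>

lemma PSA_iff: "\<phi> \<in> PSA V E \<longleftrightarrow> \<phi> \<in> auto G \<and> (\<forall>v\<in>V. \<exists>g\<in>carrier G. \<phi> (gen v) = cj g (gen v))"
  by (simp add: PSA_def G_eq[symmetric] cj_def)

lemma PSA_subgroup: "subgroup (PSA V E) (AutoGroup G)"
proof (rule aut.subgroupI)
  show "PSA V E \<subseteq> carrier (AutoGroup G)" by (auto simp: PSA_iff)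
  have "inn \<one> \<in> PSA V E" unfolding PSA_iff by (intro conjI ballI bexI[of _ \<one>]) simp_all
  then show "PSA V E \<noteq> {}" by blast
next
  fix \<phi> assume \<phi>: "\<phi> \<in> PSA V E"
  let ?\<psi> = "inv\<^bsub>AutoGroup G\<^esub> \<phi>"
  have a: "\<phi> \<in> auto G" "?\<psi> \<in> auto G" using \<phi> aut.inv_closed[of \<phi>] by (auto simp: PSA_iff)
  have "\<exists>g\<in>carrier G. ?\<psi> (gen v) = cj g (gen v)" if v: "v \<in> V" for v
  proof -
    obtain g where g: "g \<in> carrier G" "\<phi> (gen v) = cj g (gen v)" using \<phi> v by (auto simp: PSA_iff)
    then have "?\<psi> (gen v) = ?\<psi> (cj (inv g) (\<phi> (gen v)))" using v by simp
    also have "\<dots> = cj (?\<psi> (inv g)) (?\<psi> (\<phi> (gen v)))" using a(1) g(1) v by (intro auto_cj[OF a(2)]) simp_all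
    also have "?\<psi> (\<phi> (gen v)) = gen v" using a(1) v by simp
    finally show ?thesis using a g by (intro bexI[of _ "?\<psi> (inv g)"]) simp_all
  qed
  then show "?\<psi> \<in> PSA V E" using a by (simp add: PSA_iff)
next
  fix \<phi> \<chi> assume *: "\<phi> \<in> PSA V E" "\<chi> \<in> PSA V E"
  have a: "\<phi> \<in> auto G" "\<chi> \<in> auto G" using * by (auto simp: PSA_iff)
  have "\<exists>g\<in>carrier G. (\<phi> \<otimes>\<^bsub>AutoGroup G\<^esub> \<chi>) (gen v) = cj g (gen v)" if v: "v \<in> V" for v
  proof -
    obtain g h where "g \<in> carrier G" "\<phi> (gen v) = cj g (gen v)" "h \<in> carrier G" "\<chi> (gen v) = cj h (gen v)"
      using * v unfolding PSA_iff by blast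
    then show ?thesis using a v by (intro bexI[of _ "\<phi> h \<otimes> g"]) (simp_all add: auto_cj cj_cj)
  qed
  then show "\<phi> \<otimes>\<^bsub>AutoGroup G\<^esub> \<chi> \<in> PSA V E" using a aut.m_closed[of \<phi> \<chi>] by (simp add: PSA_iff)
qed

lemma PSO_eq: "PSO V E = oc ` PSA V E"
  unfolding PSO_def G_eq[symmetric] oc_def[abs_def] ..

lemma PSO_subgroup: "subgroup (PSO V E) (Out G)"
  unfolding PSO_eq by (rule out.subgroup_img_is_subgroup[OF PSA_subgroup])

section \<open>Finite index\<close>

definition gen_type :: "('v word set \<Rightarrow> 'v word set) \<Rightarrow> 'v \<Rightarrow> 'v \<times> bool \<Rightarrow> bool" where
  "gen_type \<phi> v d \<longleftrightarrow> fst d \<in> V \<and>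
     (\<exists>y\<in>carrier G. \<phi> (gen v) = cj y (if snd d then gen (fst d) else inv (gen (fst d))))"

text \<open>Images conjugate to the same signed generator are conjugate to each other; applying the
  inverse of \<open>\<phi>\<close> turns this into conjugacy to \<open>gen v\<close>.\<close>

lemma same_type_imp_PSA:
  assumes "\<phi> \<in> auto G" "\<chi> \<in> auto G" "\<And>v. v \<in> V \<Longrightarrow> gen_type \<phi> v (d v) \<and> gen_type \<chi> v (d v)"
  shows "inv\<^bsub>AutoGroup G\<^esub> \<phi> \<otimes>\<^bsub>AutoGroup G\<^esub> \<chi> \<in> PSA V E"
proof -
  let ?\<psi> = "inv\<^bsub>AutoGroup G\<^esub> \<phi>"
  have \<psi>: "?\<psi> \<in> auto G" using aut.inv_closed[of \<phi>] assms(1) by simp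
  have "\<exists>g\<in>carrier G. (?\<psi> \<otimes>\<^bsub>AutoGroup G\<^esub> \<chi>) (gen v) = cj g (gen v)" if v: "v \<in> V" for v
  proof -
    obtain s y z where s: "s \<in> carrier G" and y: "y \<in> carrier G" "\<phi> (gen v) = cj y s"
      and z: "z \<in> carrier G" "\<chi> (gen v) = cj z s"
      using assms(3)[OF v] unfolding gen_type_def by (smt (verit) gen_closed inv_closed)
    have "\<chi> (gen v) = cj (z \<otimes> inv y) (\<phi> (gen v))" using s y z by (simp add: cj_cj m_assoc)
    then have "(?\<psi> \<otimes>\<^bsub>AutoGroup G\<^esub> \<chi>) (gen v) = ?\<psi> (cj (z \<otimes> inv y) (\<phi> (gen v)))"
      using \<psi> assms(2) v by simp
    also have "\<dots> = cj (?\<psi> (z \<otimes> inv y)) (?\<psi> (\<phi> (gen v)))"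
      using assms(1) v y(1) z(1) by (intro auto_cj[OF \<psi>]) simp_all
    also have "?\<psi> (\<phi> (gen v)) = gen v" using assms(1) v by simp
    finally have "(?\<psi> \<otimes>\<^bsub>AutoGroup G\<^esub> \<chi>) (gen v) = cj (?\<psi> (z \<otimes> inv y)) (gen v)" .
    then show ?thesis using \<psi> y z by (intro bexI[of _ "?\<psi> (z \<otimes> inv y)"]) simp_all
  qed
  then show ?thesis using \<psi> assms aut.m_closed[of ?\<psi> \<chi>] by (simp add: PSA_iff)
qed

text \<open>A coset is determined by the signed generators assigned to the vertices, and there are
  finitely many such assignments.\<close>

lemma PSO_finite_index:
  assumes link_separated
  shows "finite (rcosets\<^bsub>Out G\<^esub> PSO V E)"
proof -
  \<comment> \<open>Inverses are taken because right cosets are compared through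
    \<open>\<phi>\<close> times the inverse of \<open>\<chi>\<close>.\<close>
  define d where "d \<phi> = (\<lambda>v\<in>V. SOME d. gen_type (inv\<^bsub>AutoGroup G\<^esub> \<phi>) v d)" for \<phi>
  define K where "K \<phi> = PSO V E #>\<^bsub>Out G\<^esub> oc \<phi>" for \<phi>
  have d: "gen_type (inv\<^bsub>AutoGroup G\<^esub> \<phi>) v (d \<phi> v)" if "\<phi> \<in> auto G" "v \<in> V" for \<phi> v
  proof -
    have "inv\<^bsub>AutoGroup G\<^esub> \<phi> \<in> auto G" using aut.inv_closed[of \<phi>] that by simp
    then have "\<exists>u\<in>V. \<exists>b. \<exists>y\<in>carrier G. (inv\<^bsub>AutoGroup G\<^esub> \<phi>) (gen v) = cj y (if b then gen u else inv (gen u))"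
      using that by (intro automorphism_gen[OF assms, of _ \<phi>] auto_hom) simp_all
    then obtain u b y where "u \<in> V" "y \<in> carrier G"
      "(inv\<^bsub>AutoGroup G\<^esub> \<phi>) (gen v) = cj y (if b then gen u else inv (gen u))"
      by blast
    then have "gen_type (inv\<^bsub>AutoGroup G\<^esub> \<phi>) v (u, b)" by (auto simp: gen_type_def)
    then show ?thesis using that(2) someI[of "gen_type (inv\<^bsub>AutoGroup G\<^esub> \<phi>) v"] by (simp add: d_def)
  qed
  have "d ` auto G \<subseteq> V \<rightarrow>\<^sub>E (V \<times> UNIV)"
  proof (intro subsetI, elim imageE)
    fix f \<phi> assume "\<phi> \<in> auto G" "f = d \<phi>"
    moreover have "d \<phi> \<in> extensional V" unfolding d_def by simp
    ultimately show "f \<in> V \<rightarrow>\<^sub>E (V \<times> UNIV)"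
      using d[of \<phi>] by (simp add: gen_type_def PiE_iff mem_Times_iff)
  qed
  moreover have "finite (V \<rightarrow>\<^sub>E (V \<times> (UNIV :: bool set)))" by (intro finite_PiE finite_cartesian_product finite_V) auto
  ultimately have fin: "finite (d ` auto G)" by (rule finite_subset)
  have K: "K \<phi> = K \<chi>" if \<phi>: "\<phi> \<in> auto G" and \<chi>: "\<chi> \<in> auto G" and eq: "d \<phi> = d \<chi>" for \<phi> \<chi>
  proof -
    have "inv\<^bsub>AutoGroup G\<^esub> (inv\<^bsub>AutoGroup G\<^esub> \<phi>) \<otimes>\<^bsub>AutoGroup G\<^esub> inv\<^bsub>AutoGroup G\<^esub> \<chi> \<in> PSA V E"
      using \<phi> \<chi> aut.inv_closed d[OF \<phi>] d[OF \<chi>] eq by (intro same_type_imp_PSA[of _ _ "d \<phi>"]) auto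
    then have "oc (\<phi> \<otimes>\<^bsub>AutoGroup G\<^esub> inv\<^bsub>AutoGroup G\<^esub> \<chi>) \<in> PSO V E" using \<phi> by (simp add: PSO_eq)
    then have "oc \<phi> \<otimes>\<^bsub>Out G\<^esub> inv\<^bsub>Out G\<^esub> oc \<chi> \<in> PSO V E"
      using \<phi> \<chi> aut.inv_closed[of \<chi>] by simp
    then have "PSO V E #>\<^bsub>Out G\<^esub> (oc \<phi> \<otimes>\<^bsub>Out G\<^esub> inv\<^bsub>Out G\<^esub> oc \<chi>) = PSO V E"
      using \<phi> \<chi> PSO_subgroup by (intro out.H.coset_join2) auto
    then show ?thesis
      unfolding K_def using \<phi> \<chi> subgroup.subset[OF PSO_subgroup] by (intro out.H.coset_mult_inv1) auto
  qed
  define F where "F x = K (SOME \<phi>. \<phi> \<in> auto G \<and> d \<phi> = x)" for x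
  have "K \<phi> = F (d \<phi>)" if "\<phi> \<in> auto G" for \<phi>
  proof -
    have "(SOME \<chi>. \<chi> \<in> auto G \<and> d \<chi> = d \<phi>) \<in> auto G \<and> d (SOME \<chi>. \<chi> \<in> auto G \<and> d \<chi> = d \<phi>) = d \<phi>"
      by (rule someI[of _ \<phi>]) (use that in simp)
    then show ?thesis unfolding F_def by (intro K[OF that]) simp_all
  qed
  then have "K ` auto G = F ` d ` auto G" by (simp add: image_image)
  moreover have "rcosets\<^bsub>Out G\<^esub> PSO V E = K ` auto G"
    by (auto simp: RCOSETS_def Out_carrier K_def)
  ultimately show ?thesis using fin by simp
qed

end

text \<open>\<open>L_determined\<close> forces the images of \<open>L\<close> once those of
  \<open>B \<union> D\<close> are known; \<open>B_common\<close> puts the centralizer of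
  \<open>B\<close> into \<open>par L\<close>; together with \<open>D_avoids\<close> it makes the
  centralizer of \<open>B \<union> D\<close> trivial. A vertex of \<open>C\<close> detects the
  twisting element.\<close>

locale raag_config = raag V E G for V :: "'v set" and E and G (structure) +
  fixes L B C D :: "'v set"
  assumes V_eq: "V = L \<union> B \<union> C \<union> D"
    and disjoint: "C \<inter> (L \<union> B \<union> D) = {}" "L \<inter> B = {}"
    and lk_C: "\<And>c. c \<in> C \<Longrightarrow> lk c \<subseteq> B \<union> C"
    and lk_B: "\<And>b. b \<in> B \<Longrightarrow> L \<subseteq> lk b"
    and rigid_BD: "rigid (B \<union> D)" and rigid_BC: "rigid (B \<union> C)"
    and L_determined: "\<And>l x. l \<in> L \<Longrightarrow> x \<in> V \<Longrightarrow> (\<And>w. w \<in> lk l \<Longrightarrow> w \<in> B \<union> D \<Longrightarrow> x \<in> st w) \<Longrightarrow> x = l"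
    and B_common: "\<And>x. x \<in> V \<Longrightarrow> (\<And>b. b \<in> B \<Longrightarrow> x \<in> st b) \<Longrightarrow> x \<in> L"
    and D_avoids: "\<And>l. l \<in> L \<Longrightarrow> \<exists>d\<in>D. l \<notin> st d"
    and C_nonempty: "C \<noteq> {}"
begin

section \<open>Twists\<close>

lemma par_L_commute:
  assumes "k \<in> par L" "b \<in> B"
  shows "k \<otimes> gen b = gen b \<otimes> k"
proof -
  have b: "gen b \<in> carrier G" using assms V_eq by simp
  have "cj k (gen b) = gen b" using assms(1)
  proof (induction rule: par_induct)
    case (gen v g)
    then have "cj (gen v) (gen b) = gen b"
      using lk_B[OF assms(2)] gen_commute[of b v] lk_sym[of b v] b by (auto simp: cj_eq_iff_commute)
    then show ?case using gen b by (simp flip: cj_cj)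
  next
    case (inv_gen v g)
    then have "cj (gen v) (gen b) = gen b"
      using lk_B[OF assms(2)] gen_commute[of b v] lk_sym[of b v] b by (auto simp: cj_eq_iff_commute)
    then have "cj (inv (gen v)) (gen b) = gen b" using inv_gen b cj_inv_cj(1)[of "gen v" "gen b"] by simp
    then show ?case using inv_gen b by (simp flip: cj_cj)
  qed (use b in simp)
  then show ?thesis using assms b by (simp add: cj_eq_iff_commute)
qed

definition twist :: "'v word set \<Rightarrow> 'v word set \<Rightarrow> 'v word set" where
  "twist k = restrict (lift G (\<lambda>v. if v \<in> C then cj k (gen v) else gen v)) (carrier G)"

text \<open>Relations within \<open>C\<close> are conjugated as a whole, and the other edges at
  \<open>C\<close> lead to \<open>B\<close>, which \<open>k\<close> centralizes.\<close>

lemma twist_lift: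
  assumes "k \<in> par L"
  shows "lift G (\<lambda>v. if v \<in> C then cj k (gen v) else gen v) \<in> hom G G"
    and "\<And>v. v \<in> V \<Longrightarrow> lift G (\<lambda>v. if v \<in> C then cj k (gen v) else gen v) (gen v) = (if v \<in> C then cj k (gen v) else gen v)"
proof -
  let ?f = "\<lambda>v. if v \<in> C then cj k (gen v) else gen v"
  have f: "?f v \<in> carrier G" if "v \<in> V" for v using that assms by simp
  have CB: "cj k (gen c) \<otimes> gen b = gen b \<otimes> cj k (gen c)" if "c \<in> C" "b \<in> lk c" "b \<notin> C" for b c
  proof -
    have "b \<in> B" using lk_C that by blast
    then have "cj k (gen b) = gen b" using par_L_commute assms V_eq by (simp add: cj_eq_iff_commute)
    then have "cj k (gen c) \<otimes> gen b = cj k (gen c) \<otimes> cj k (gen b)" by simp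
    also have "\<dots> = cj k (gen b) \<otimes> cj k (gen c)"
      using gen_commute[OF that(2)] lkD[OF that(2)] assms by (simp flip: cj_mult)
    finally show ?thesis using \<open>cj k (gen b) = gen b\<close> by simp
  qed
  have comm: "?f v \<otimes> ?f w = ?f w \<otimes> ?f v" if w: "w \<in> lk v" for v w
  proof -
    have V: "v \<in> V" "w \<in> V" using lkD[OF w] by auto
    have "cj k (gen v) \<otimes> cj k (gen w) = cj k (gen w) \<otimes> cj k (gen v)"
      using gen_commute[OF w] V assms by (simp flip: cj_mult)
    then show ?thesis using CB[of v w] CB[of w v] w lk_sym[of v w] gen_commute[OF w] by simp
  qed
  show "lift G ?f \<in> hom G G" using lift_hom_gen(1)[OF is_group, of ?f] f comm by blast
  show "lift G ?f (gen v) = ?f v" if "v \<in> V" for v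
    using lift_hom_gen(2)[OF is_group, of ?f v] f comm that by blast
qed

lemma twist_gen: "k \<in> par L \<Longrightarrow> v \<in> V \<Longrightarrow> twist k (gen v) = (if v \<in> C then cj k (gen v) else gen v)"
  using twist_lift(2)[of k v] by (simp add: twist_def)

lemma twist_hom: "k \<in> par L \<Longrightarrow> twist k \<in> hom G G"
  using twist_lift(1)[of k] by (auto simp: twist_def hom_def)

lemma twist_par_L:
  assumes "k \<in> par L" "m \<in> par L"
  shows "twist k m = m"
proof -
  interpret t: group_hom G G "twist k"
    using twist_hom[OF assms(1)] is_group by (simp add: group_hom_def group_hom_axioms_def)
  show ?thesis using assms(2)
    by (induction rule: par_induct) (use assms(1) disjoint in \<open>auto simp: twist_gen\<close>)
qed

text \<open>Since \<open>twist k\<close> fixes \<open>m\<close> but twists \<open>gen v\<close>, the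
  factors appear in reverse order: \<open>twist\<close> is an antihomomorphism.\<close>

lemma twist_twist_gen:
  assumes "k \<in> par L" "m \<in> par L" "v \<in> V"
  shows "twist k (twist m (gen v)) = twist (m \<otimes> k) (gen v)"
proof -
  interpret t: group_hom G G "twist k"
    using twist_hom[OF assms(1)] is_group by (simp add: group_hom_def group_hom_axioms_def)
  have "twist k (cj m (gen v)) = cj m (twist k (gen v))"
    using assms twist_par_L[OF assms(1,2)] by (simp add: cj_def)
  then show ?thesis using assms par_closed(2)[OF assms(2,1)] by (simp add: twist_gen cj_cj)
qed

lemma twist_one_gen: "v \<in> V \<Longrightarrow> twist \<one> (gen v) = gen v"
  by (simp add: twist_gen par_closed)

lemma twist_auto:
  assumes "k \<in> par L"
  shows "twist k \<in> auto G"
proof -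
  have k': "inv k \<in> par L" using assms by (rule par_closed)
  have "restrict (twist k) (carrier G) \<in> auto G"
    using assms k' twist_twist_gen[OF assms k'] twist_twist_gen[OF k' assms]
    by (intro autoI[of _ "twist (inv k)"] twist_hom) (simp_all add: twist_one_gen)
  then show ?thesis by (simp add: twist_def)
qed

lemma twist_mult:
  assumes "k \<in> par L" "m \<in> par L"
  shows "twist k \<otimes>\<^bsub>AutoGroup G\<^esub> twist m = twist (m \<otimes> k)"
  using assms aut.m_closed[of "twist k" "twist m"] par_closed(2)[OF assms(2,1)]
  by (intro auto_eqI) (simp_all add: twist_auto twist_twist_gen)

lemma twist_PSA:
  assumes "k \<in> par L"
  shows "twist k \<in> PSA V E"
  unfolding PSA_iff
proof (intro conjI ballI)
  fix v assume v: "v \<in> V"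
  show "\<exists>g\<in>carrier G. twist k (gen v) = cj g (gen v)"
    using assms v by (intro bexI[of _ "if v \<in> C then k else \<one>"]) (simp_all add: twist_gen)
qed (rule twist_auto[OF assms])

text \<open>If conjugation by \<open>h\<close> agrees with a twist, \<open>h\<close> centralizes
  \<open>B \<union> D\<close> and is trivial. Then \<open>k\<close> centralizes some
  \<open>gen c\<close>, whose star does not meet \<open>L\<close>.\<close>

lemma twist_inner_trivial:
  assumes k: "k \<in> par L" and inner: "twist k \<in> Inn G"
  shows "k = \<one>"
proof -
  obtain h where h: "h \<in> carrier G" "twist k = inn h" using inner by (auto simp: Inn_eq)
  have "h \<otimes> gen v = gen v \<otimes> h" if v: "v \<in> B \<union> D" for v
  proof -
    have V: "v \<in> V" "v \<notin> C" using v V_eq disjoint by auto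
    then have "cj h (gen v) = gen v" using twist_gen[OF k, of v] h by simp
    then show ?thesis using h V by (simp add: cj_eq_iff_commute)
  qed
  then have "h \<in> par {}"
    using V_eq B_common D_avoids h by (intro centralizer_gens[of "B \<union> D"]) blast+
  then have "h = \<one>" by (rule par_empty)
  obtain c where c: "c \<in> C" using C_nonempty by blast
  then have cV: "c \<in> V" using V_eq by auto
  then have "cj k (gen c) = gen c" using twist_gen[OF k cV] c h \<open>h = \<one>\<close> by simp
  then have "k \<in> par (st c)" using cV k by (intro centralizer_gen) (simp_all add: cj_eq_iff_commute)
  then have "k \<in> par (st c \<inter> L)" using k by (rule par_Int)
  moreover have "st c \<inter> L = {}" using lk_C[OF c] c disjoint by auto
  ultimately show ?thesis using par_empty by simp
qed

lemma PSA_imp_twist: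
  assumes \<phi>: "\<phi> \<in> PSA V E"
  shows "\<exists>k\<in>par L. oc \<phi> = oc (twist k)"
proof -
  have sys: "conj_system S (\<lambda>v. \<chi> (gen v))" if "\<chi> \<in> PSA V E" "S \<subseteq> V" for \<chi> S
    unfolding conj_system_def
  proof (intro conjI ballI impI)
    fix v w assume vw: "w \<in> lk v"
    have V: "v \<in> V" "w \<in> V" using lkD[OF vw] by auto
    have h: "\<chi> \<in> hom G G" using that by (simp add: PSA_iff auto_hom)
    show "\<chi> (gen v) \<otimes> \<chi> (gen w) = \<chi> (gen w) \<otimes> \<chi> (gen v)"
      using hom_mult[OF h] V gen_commute[OF vw] by (metis gen_closed)
  qed (use that in \<open>auto simp: PSA_iff\<close>)
  have sub: "B \<union> D \<subseteq> V" "B \<union> C \<subseteq> V" using V_eq by auto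
  have a\<phi>: "\<phi> \<in> auto G" using \<phi> by (simp add: PSA_iff)
  obtain g where g: "g \<in> carrier G" "\<And>v. v \<in> B \<union> D \<Longrightarrow> \<phi> (gen v) = cj g (gen v)"
    using rigid_conj[OF rigid_BD sys[OF \<phi> sub(1)]] by blast
  define \<chi> where "\<chi> = inn (inv g) \<otimes>\<^bsub>AutoGroup G\<^esub> \<phi>"
  have "inn (inv g) \<in> PSA V E" using g by (auto simp: PSA_iff)
  then have \<chi>: "\<chi> \<in> PSA V E" using subgroup.m_closed[OF PSA_subgroup _ \<phi>] by (simp add: \<chi>_def)
  then have a\<chi>: "\<chi> \<in> auto G" by (simp add: PSA_iff)
  have \<chi>_BD: "\<chi> (gen v) = gen v" if "v \<in> B \<union> D" for v
  proof -
    have "v \<in> V" using that sub by blast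
    then show ?thesis using g that a\<phi> by (simp add: \<chi>_def)
  qed
  have \<chi>_L: "\<chi> (gen l) = gen l" if l: "l \<in> L" for l
  proof -
    have lV: "l \<in> V" using l V_eq by auto
    \<comment> \<open>By \<open>L_determined\<close>, only powers of \<open>gen l\<close> commute
      with all these \<open>gen w\<close>.\<close>
    have "\<chi> (gen l) \<otimes> gen w = gen w \<otimes> \<chi> (gen l)" if w: "w \<in> lk l \<inter> (B \<union> D)" for w
    proof -
      have "w \<in> V" using w sub by auto
      then have "\<chi> (gen l) \<otimes> \<chi> (gen w) = \<chi> (gen w) \<otimes> \<chi> (gen l)"
        using hom_mult[OF auto_hom[OF a\<chi>]] lV gen_commute[of w l] w by (metis IntD1 gen_closed)
      then show ?thesis using \<chi>_BD w by simp
    qed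
    then have "\<chi> (gen l) \<in> par {l}"
      using sub a\<chi> lV L_determined[OF l] by (intro centralizer_gens[of "lk l \<inter> (B \<union> D)"]) auto
    moreover have "expo l (\<chi> (gen l)) = 1" using \<chi> lV by (force simp: PSA_iff)
    ultimately show ?thesis using par_single[of "\<chi> (gen l)" l] lV by simp
  qed
  obtain k where k: "k \<in> carrier G" "\<And>v. v \<in> B \<union> C \<Longrightarrow> \<chi> (gen v) = cj k (gen v)"
    using rigid_conj[OF rigid_BC sys[OF \<chi> sub(2)]] by blast
  \<comment> \<open>On \<open>B\<close> the automorphism \<open>\<chi>\<close> is both the identity
    and conjugation by \<open>k\<close>.\<close>
  have "k \<otimes> gen b = gen b \<otimes> k" if "b \<in> B" for b
  proof -
    have "b \<in> V" using that sub by blast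
    then show ?thesis using k(2)[of b] \<chi>_BD[of b] k(1) that cj_eq_iff_commute[of k "gen b"] by simp
  qed
  then have kL: "k \<in> par L" using sub k B_common by (intro centralizer_gens[of B]) auto
  have "\<chi> = twist k"
  proof (rule auto_eqI[OF a\<chi> twist_auto[OF kL]])
    fix v assume "v \<in> V"
    then show "\<chi> (gen v) = twist k (gen v)"
      using k(2)[of v] \<chi>_L[of v] \<chi>_BD[of v] V_eq twist_gen[OF kL, of v] by auto
  qed
  moreover have "oc \<chi> = oc \<phi>" unfolding \<chi>_def using g a\<phi> by (intro oc_inn_mult) auto
  ultimately show ?thesis using kL by metis
qed

theorem RAAG_iso_PSO:
  assumes \<Lambda>: "simple_graph W F" and e: "bij_betw e W L"
    and eF: "\<And>x y. x \<in> W \<Longrightarrow> y \<in> W \<Longrightarrow> {x, y} \<in> F \<longleftrightarrow> {e x, e y} \<in> E"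
  shows "RAAG W F \<cong> (Out G)\<lparr>carrier := PSO V E\<rparr>"
proof -
  interpret lam: raag W F "RAAG W F" by unfold_locales (use \<Lambda> in auto)
  have eL: "e x \<in> L" "e x \<in> V" if "x \<in> W" for x using that e V_eq by (auto simp: bij_betw_def)
  define \<iota> where "\<iota> = lam.lift G (\<lambda>x. gen (e x))"
  have c1: "gen (e x) \<otimes> gen (e y) = gen (e y) \<otimes> gen (e x)" if "y \<in> lam.lk x" for x y
    using that lam.lkD[OF that] eF[of x y] gen_commute[of "e y" "e x"] by (simp add: lam.lk_def lk_def)
  have \<iota>: "\<iota> \<in> hom (RAAG W F) G" "\<And>x. x \<in> W \<Longrightarrow> \<iota> (lam.gen x) = gen (e x)"
    unfolding \<iota>_def using lam.lift_hom_gen[OF is_group, of "\<lambda>x. gen (e x)"] eL c1 by (metis gen_closed)+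
  interpret \<iota>: group_hom "RAAG W F" G \<iota>
    using \<iota> lam.is_group is_group by (simp add: group_hom_def group_hom_axioms_def)
  define e' where "e' = inv_into W e"
  have e': "e' v \<in> W" "e (e' v) = v" if "v \<in> L" for v
    using that e by (auto simp: e'_def bij_betw_def inv_into_into f_inv_into_f)
  have e'e: "e' (e x) = x" if "x \<in> W" for x using that e by (auto simp: e'_def bij_betw_def)
  \<comment> \<open>A left inverse of \<open>\<iota>\<close>, killing the generators outside
    \<open>L\<close>; it gives injectivity.\<close>
  define \<rho> where "\<rho> = lift (RAAG W F) (\<lambda>v. if v \<in> L then lam.gen (e' v) else \<one>\<^bsub>RAAG W F\<^esub>)"
  have c2: "(if v \<in> L then lam.gen (e' v) else \<one>\<^bsub>RAAG W F\<^esub>) \<in> carrier (RAAG W F)" for v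
    using e' by simp
  have c3: "lam.gen (e' v) \<otimes>\<^bsub>RAAG W F\<^esub> lam.gen (e' w) = lam.gen (e' w) \<otimes>\<^bsub>RAAG W F\<^esub> lam.gen (e' v)"
    if "w \<in> lk v" "v \<in> L" "w \<in> L" for v w
    using that e' eF[of "e' v" "e' w"] lam.gen_commute[of "e' w" "e' v"] by (simp add: lam.lk_def lk_def)
  have c4: "(if v \<in> L then lam.gen (e' v) else \<one>\<^bsub>RAAG W F\<^esub>) \<otimes>\<^bsub>RAAG W F\<^esub> (if w \<in> L then lam.gen (e' w) else \<one>\<^bsub>RAAG W F\<^esub>)
      = (if w \<in> L then lam.gen (e' w) else \<one>\<^bsub>RAAG W F\<^esub>) \<otimes>\<^bsub>RAAG W F\<^esub> (if v \<in> L then lam.gen (e' v) else \<one>\<^bsub>RAAG W F\<^esub>)"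
    if "w \<in> lk v" for v w
    using c3[OF that] e' by simp
  have \<rho>: "\<rho> \<in> hom G (RAAG W F)" "\<And>v. v \<in> V \<Longrightarrow> \<rho> (gen v) = (if v \<in> L then lam.gen (e' v) else \<one>\<^bsub>RAAG W F\<^esub>)"
    unfolding \<rho>_def
    using lift_hom_gen[OF lam.is_group, of "\<lambda>v. if v \<in> L then lam.gen (e' v) else \<one>\<^bsub>RAAG W F\<^esub>"] c2 c4
    by blast+
  have \<rho>\<iota>: "\<rho> (\<iota> x) = x" if "x \<in> carrier (RAAG W F)" for x
  proof -
    have "(\<lambda>x. \<rho> (\<iota> x)) \<in> hom (RAAG W F) (RAAG W F)"
      using Group.hom_compose[OF \<iota>(1) \<rho>(1)] by (simp add: comp_def)
    moreover have "(\<lambda>x. x) \<in> hom (RAAG W F) (RAAG W F)" by (simp add: hom_def)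
    ultimately show ?thesis
      using lam.hom_eqI[OF lam.is_group, of "\<lambda>x. \<rho> (\<iota> x)" "\<lambda>x. x" x] that by (simp add: \<iota> \<rho> eL e'e)
  qed
  have \<iota>L: "\<iota> x \<in> par L" if "x \<in> carrier (RAAG W F)" for x
    using that by (induction rule: lam.raag_induct) (simp_all add: \<iota> eL par_closed)
  have \<iota>_surj: "\<exists>x\<in>carrier (RAAG W F). \<iota> x = k" if "k \<in> par L" for k
    using that
  proof (induction rule: par_induct)
    case one
    then show ?case using \<iota>.hom_one by blast
  next
    case (gen v g)
    then obtain x where "x \<in> carrier (RAAG W F)" "\<iota> x = g" by blast
    then show ?case using gen e'[of v] \<iota>(2)[of "e' v"]
      by (intro bexI[of _ "lam.gen (e' v) \<otimes>\<^bsub>RAAG W F\<^esub> x"]) simp_all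
  next
    case (inv_gen v g)
    then obtain x where "x \<in> carrier (RAAG W F)" "\<iota> x = g" by blast
    then show ?case using inv_gen e'[of v] \<iota>(2)[of "e' v"]
      by (intro bexI[of _ "inv\<^bsub>RAAG W F\<^esub> (lam.gen (e' v)) \<otimes>\<^bsub>RAAG W F\<^esub> x"]) simp_all
  qed
  \<comment> \<open>The inverse compensates for the reversed order in
    \<open>twist_mult\<close>.\<close>
  define \<Theta> where "\<Theta> x = oc (twist (inv (\<iota> x)))" for x
  let ?P = "(Out G)\<lparr>carrier := PSO V E\<rparr>"
  have P: "group ?P" by (rule subgroup.subgroup_is_group[OF PSO_subgroup out.H.is_group])
  have inv_par: "inv (\<iota> x) \<in> par L" if "x \<in> carrier (RAAG W F)" for x
    using \<iota>L[OF that] by (rule par_closed)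
  have hom: "\<Theta> \<in> hom (RAAG W F) ?P"
  proof (rule homI)
    fix x assume x: "x \<in> carrier (RAAG W F)"
    then show "\<Theta> x \<in> carrier ?P" using twist_PSA[OF inv_par[OF x]] by (simp add: \<Theta>_def PSO_eq)
    fix y assume y: "y \<in> carrier (RAAG W F)"
    have "twist (inv (\<iota> (x \<otimes>\<^bsub>RAAG W F\<^esub> y))) = twist (inv (\<iota> x)) \<otimes>\<^bsub>AutoGroup G\<^esub> twist (inv (\<iota> y))"
      using x y inv_par by (simp add: twist_mult inv_mult_group)
    then show "\<Theta> (x \<otimes>\<^bsub>RAAG W F\<^esub> y) = \<Theta> x \<otimes>\<^bsub>?P\<^esub> \<Theta> y"
      using twist_auto inv_par x y by (simp add: \<Theta>_def)
  qed
  interpret \<Theta>: group_hom "RAAG W F" ?P \<Theta>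
    using hom P lam.is_group by (simp add: group_hom_def group_hom_axioms_def)
  have "\<Theta> \<in> iso (RAAG W F) ?P"
    unfolding \<Theta>.iso_iff
  proof (intro conjI ballI impI subsetI)
    fix Z assume "Z \<in> carrier ?P"
    then obtain \<phi> where "\<phi> \<in> PSA V E" "Z = oc \<phi>" by (auto simp: PSO_eq)
    then obtain k where k: "k \<in> par L" "Z = oc (twist k)" using PSA_imp_twist by blast
    then obtain x where "x \<in> carrier (RAAG W F)" "\<iota> x = inv k" using \<iota>_surj[OF par_closed(3)] by blast
    then show "Z \<in> \<Theta> ` carrier (RAAG W F)" using k by (intro image_eqI[of _ _ x]) (simp_all add: \<Theta>_def)
  next
    fix x assume x: "x \<in> carrier (RAAG W F)" "\<Theta> x = \<one>\<^bsub>?P\<^esub>"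
    then have "twist (inv (\<iota> x)) \<in> Inn G"
      using oc_eq_one_iff[OF twist_auto[OF inv_par[OF x(1)]]] by (simp add: \<Theta>_def)
    then have "inv (\<iota> x) = \<one>" by (rule twist_inner_trivial[OF inv_par[OF x(1)]])
    then have "\<iota> x = \<one>" using x by (metis \<iota>.hom_closed inv_one inv_inv)
    then show "x = \<one>\<^bsub>RAAG W F\<^esub>" using \<rho>\<iota>[OF x(1)] \<rho>\<iota>[OF lam.one_closed] by simp
  qed
  then show ?thesis by (rule is_isoI)
qed

end

section \<open>The graph\<close>

text \<open>
  \<open>Lv i\<close> is the \<open>i\<close>-th vertex of \<open>\<Lambda>\<close>. Its two satellites \<open>Tv i False\<close> and \<open>Tv i True\<close>, which are attached
  to disjoint parts of the cycle of the \<open>Dv\<close>, tell the vertices of \<open>\<Lambda>\<close> apart. The remaining 27 vertices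
  do not depend on \<open>\<Lambda>\<close>: two cycles of length 9, and nine vertices \<open>Bv i\<close> joined to both. The length 9
  and the offsets 3 and 4 were found by search; all that matters are the finite checks
  \<open>core_separated\<close> and \<open>core_spans\<close>.
\<close>
datatype vert = Bv nat | Cv nat | Dv nat | Lv nat | Tv nat bool

instance vert :: countable
  by countable_datatype

fun nbr :: "vert \<Rightarrow> vert list" where
  "nbr (Bv i) = [Cv i, Cv ((i + 3) mod 9), Dv i, Dv ((i + 3) mod 9)]"
| "nbr (Cv i) = [Cv ((i + 1) mod 9), Cv ((i + 8) mod 9), Bv i, Bv ((i + 6) mod 9)]"
| "nbr (Dv i) = [Dv ((i + 1) mod 9), Dv ((i + 8) mod 9), Bv i, Bv ((i + 6) mod 9)]"
| "nbr (Lv i) = []"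
| "nbr (Tv i j) = []"

fun contact :: "bool \<Rightarrow> vert list" where
  "contact False = [Dv 0, Dv 4]"
| "contact True = [Dv 1, Dv 5]"

definition Bs :: "vert list" where "Bs = map Bv [0..<9]"
definition Cs :: "vert list" where "Cs = map Cv [0..<9]"
definition Ds :: "vert list" where "Ds = map Dv [0..<9]"

definition core :: "vert list" where "core = Bs @ Cs @ Ds"

text \<open>
  \<open>flood P Z\<close> consists of vertices reachable within \<open>P\<close> from its first vertex outside \<open>Z\<close> by paths that
  can only end in \<open>Z\<close>. Four passes over \<open>P\<close> turn out to be enough to find all of them.
\<close>
definition sweep :: "vert list \<Rightarrow> vert \<Rightarrow> vert list \<Rightarrow> vert list" where
  "sweep Z y S = (if y \<in> set S \<or> \<not> (\<exists>x\<in>set (nbr y). x \<notin> set Z \<and> x \<in> set S) then S else y # S)"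

definition flood :: "vert list \<Rightarrow> vert list \<Rightarrow> vert list" where
  "flood P Z = fold (sweep Z) (P @ rev P @ P @ rev P) [hd (filter (\<lambda>x. x \<notin> set Z) P)]"

definition spans :: "vert list \<Rightarrow> vert list \<Rightarrow> vert list \<Rightarrow> bool" where
  "spans P Z U \<longleftrightarrow> 2 \<le> length (filter (\<lambda>x. x \<notin> set Z) P) \<and> set P \<subseteq> set (U @ flood P Z)"

section \<open>Finite checks on the core\<close>

lemma core_nbr: "x \<in> set core \<Longrightarrow> y \<in> set (nbr x) \<Longrightarrow> y \<in> set core \<and> y \<noteq> x \<and> x \<in> set (nbr y)"
proof -
  have "\<forall>x\<in>set core. \<forall>y\<in>set (nbr x). y \<in> set core \<and> y \<noteq> x \<and> x \<in> set (nbr y)"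
    by code_simp
  then show "x \<in> set core \<Longrightarrow> y \<in> set (nbr x) \<Longrightarrow> y \<in> set core \<and> y \<noteq> x \<and> x \<in> set (nbr y)" by blast
qed

lemma core_distinct: "x \<in> set core \<Longrightarrow> distinct (nbr x)"
proof -
  have "\<forall>x\<in>set core. distinct (nbr x)" by code_simp
  then show "x \<in> set core \<Longrightarrow> distinct (nbr x)" by blast
qed

text \<open>The first three settle the cases of \<open>adj_separated\<close> with \<open>x\<close>
  in the core. The last two say that no star of a core vertex contains all of \<open>Bs\<close> or
  both vertices of a \<open>contact j\<close>.\<close>

lemma core_separated:
  "\<forall>x\<in>set core. \<forall>y\<in>set core. x \<noteq> y \<longrightarrow> 2 \<le> length (filter (\<lambda>w. w \<noteq> y \<and> w \<notin> set (nbr y)) (nbr x))"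
  "\<forall>x\<in>set core. 2 \<le> length (filter (\<lambda>w. w \<notin> set Bs) (nbr x))"
  "\<forall>x\<in>set core. \<forall>j. 2 \<le> length (filter (\<lambda>w. w \<notin> set (contact j)) (nbr x))"
  "\<forall>x\<in>set core. \<exists>b\<in>set Bs. b \<noteq> x \<and> b \<notin> set (nbr x)"
  "\<forall>x\<in>set core. \<forall>j. \<exists>m\<in>set (contact j). m \<noteq> x \<and> m \<notin> set (nbr x)"
  by code_simp+

text \<open>The removed list is the trace of a star: that of a core vertex, \<open>Bs\<close> for
  \<open>Lv i\<close>, and for a satellite its contacts, none of which lies in
  \<open>Bs @ Cs\<close>.\<close>

lemma core_spans:
  "\<forall>u\<in>set core. spans (Bs @ Ds) (u # nbr u) [u]" "\<forall>u\<in>set core. spans (Bs @ Cs) (u # nbr u) [u]"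
  "spans (Bs @ Ds) Bs []" "spans (Bs @ Cs) Bs []"
  "\<forall>j. spans (Bs @ Ds) (contact j) []" "spans (Bs @ Cs) [] []"
  by code_simp+

text \<open>One of the two is identified as the head because \<open>flood\<close> starts
  there.\<close>

lemma two_of_filter:
  assumes "2 \<le> length (filter Q xs)" "distinct xs"
  shows "\<exists>x y. x \<noteq> y \<and> x \<in> set xs \<and> y \<in> set xs \<and> Q x \<and> Q y \<and> x = hd (filter Q xs)"
proof -
  obtain x y zs where f: "filter Q xs = x # y # zs"
    using assms(1) by (cases "filter Q xs"; cases "tl (filter Q xs)") auto
  have "distinct (filter Q xs)" using assms(2) by simp
  then have "x \<noteq> y" by (simp add: f)
  have "{x, y} \<subseteq> set (filter Q xs)" unfolding f by simp
  then have "x \<in> set xs" "y \<in> set xs" "Q x" "Q y" by auto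
  with \<open>x \<noteq> y\<close> show ?thesis by (intro exI[of _ x] exI[of _ y]) (simp_all add: f)
qed

section \<open>The graph built from an adjacency relation\<close>

locale gamma =
  fixes n :: nat and F :: "nat \<Rightarrow> nat \<Rightarrow> bool"
  assumes F_sym: "F i j \<longleftrightarrow> F j i" and F_irrefl: "\<not> F i i"
begin

fun extra :: "vert \<Rightarrow> vert \<Rightarrow> bool" where
  "extra (Lv i) (Lv j) = F i j"
| "extra (Lv i) (Bv j) = True"
| "extra (Lv i) (Tv k j) = (i = k)"
| "extra (Tv i j) (Tv k l) = (i = k \<and> j \<noteq> l)"
| "extra (Tv i j) (Dv k) = (Dv k \<in> set (contact j))"
| "extra _ _ = False"

text \<open>On the core \<open>nbr\<close> is symmetric already; \<open>extra\<close> lists the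
  edges between different kinds of vertices in one direction only.\<close>

definition adj :: "vert \<Rightarrow> vert \<Rightarrow> bool" where
  "adj x y \<longleftrightarrow> y \<in> set (nbr x) \<or> extra x y \<or> extra y x"

definition verts :: "vert set" where
  "verts = set core \<union> Lv ` {..<n} \<union> {Tv i j | i j. i < n}"

text \<open>Vertices are coded by \<open>to_nat\<close> because the theorem asks for a graph on
  \<open>nat\<close>.\<close>

definition edges :: "nat set set" where
  "edges = {{to_nat x, to_nat y} | x y. x \<in> verts \<and> y \<in> verts \<and> adj x y}"

lemma core_not_LT [simp]: "Lv i \<notin> set core" "Tv i j \<notin> set core"
  by (auto simp: core_def Bs_def Cs_def Ds_def)

lemma verts_cases [consumes 1, case_names core Lv Tv]:
  assumes "x \<in> verts"
  obtains "x \<in> set core" | i where "x = Lv i" "i < n" | i j where "x = Tv i j" "i < n"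
  using assms by (auto simp: verts_def)

lemma verts_simps [simp]: "Lv i \<in> verts \<longleftrightarrow> i < n" "Tv i j \<in> verts \<longleftrightarrow> i < n"
  "x \<in> set core \<Longrightarrow> x \<in> verts"
  by (auto simp: verts_def)

lemma Bs_core: "x \<in> set Bs \<Longrightarrow> x \<in> set core" and Cs_core: "x \<in> set Cs \<Longrightarrow> x \<in> set core"
  and Ds_core: "x \<in> set Ds \<Longrightarrow> x \<in> set core" and contact_core: "x \<in> set (contact j) \<Longrightarrow> x \<in> set core"
  and contact_Ds: "x \<in> set (contact j) \<Longrightarrow> x \<in> set Ds"
  by (cases j; auto simp: core_def Bs_def Cs_def Ds_def)+

lemma core_cases:
  assumes "x \<in> set core"
  obtains i where "x = Bv i" "x \<in> set Bs" | i where "x = Cv i" "x \<in> set Cs" | i where "x = Dv i" "x \<in> set Ds"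
  using assms by (auto simp: core_def Bs_def Cs_def Ds_def)

lemma adj_core: "x \<in> set core \<Longrightarrow> y \<in> set core \<Longrightarrow> adj x y \<longleftrightarrow> y \<in> set (nbr x)"
  by (elim core_cases) (auto simp: adj_def)

lemma adj_L_core: "x \<in> set core \<Longrightarrow> adj (Lv i) x \<longleftrightarrow> x \<in> set Bs" "x \<in> set core \<Longrightarrow> adj x (Lv i) \<longleftrightarrow> x \<in> set Bs"
  by (auto elim!: core_cases simp: adj_def Bs_def Cs_def Ds_def)

lemma contact_Bv_Cv: "Bv i \<notin> set (contact j)" "Cv i \<notin> set (contact j)"
  by (cases j; simp)+

lemma adj_T_core: "x \<in> set core \<Longrightarrow> adj (Tv i j) x \<longleftrightarrow> x \<in> set (contact j)"
  "x \<in> set core \<Longrightarrow> adj x (Tv i j) \<longleftrightarrow> x \<in> set (contact j)"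
  using contact_Bv_Cv by (auto elim!: core_cases simp: adj_def Bs_def Cs_def Ds_def)

lemma adj_LT [simp]: "adj (Lv i) (Lv k) \<longleftrightarrow> F i k" "adj (Lv i) (Tv k j) \<longleftrightarrow> i = k" "adj (Tv k j) (Lv i) \<longleftrightarrow> i = k"
  "adj (Tv i j) (Tv k l) \<longleftrightarrow> i = k \<and> j \<noteq> l"
  using F_sym by (auto simp: adj_def)

lemma adj_sym:
  assumes "x \<in> verts" "y \<in> verts"
  shows "adj x y \<longleftrightarrow> adj y x"
proof (cases "x \<in> set core \<and> y \<in> set core")
  case True
  then show ?thesis using core_nbr by (metis adj_core)
next
  case False
  then show ?thesis using assms F_sym
    by (elim verts_cases) (auto simp: adj_L_core adj_T_core)
qed

lemma adj_irrefl: "x \<in> verts \<Longrightarrow> \<not> adj x x"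
  using core_nbr F_irrefl by (elim verts_cases) (auto simp: adj_core)

lemma simple_graph_edges: "simple_graph (to_nat ` verts) edges"
proof -
  have "verts = set core \<union> Lv ` {..<n} \<union> (\<lambda>(i, j). Tv i j) ` ({..<n} \<times> UNIV)"
    by (auto simp: verts_def)
  then have "finite verts" by simp
  moreover have "x \<noteq> y" if "x \<in> verts" "y \<in> verts" "adj x y" for x y
    using that adj_irrefl by blast
  ultimately show ?thesis
    unfolding simple_graph_def edges_def by (auto simp: inj_eq[OF inj_to_nat])
qed

lemma contact_disjoint: "x \<in> set (contact j) \<Longrightarrow> x \<in> set (contact l) \<longleftrightarrow> j = l"
  by (cases j; cases l) auto

lemma contact_two: "\<exists>x\<in>set (contact j). \<exists>y\<in>set (contact j). x \<noteq> y"
  by (cases j) auto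

text \<open>The witnesses for \<open>Lv i\<close> are its satellites or vertices of
  \<open>Bs\<close>; those for a satellite are its contacts, the other satellite of
  \<open>i\<close>, and \<open>Lv i\<close>.\<close>

lemma adj_separated:
  assumes x: "x \<in> verts" and y: "y \<in> verts" and "x \<noteq> y"
  shows "\<exists>w1\<in>verts. \<exists>w2\<in>verts. w1 \<noteq> w2 \<and> adj x w1 \<and> adj x w2 \<and>
    w1 \<noteq> y \<and> w2 \<noteq> y \<and> \<not> adj y w1 \<and> \<not> adj y w2"
  using x
proof (cases rule: verts_cases)
  case core
  note nb = core_nbr[OF core] core_distinct[OF core]
  show ?thesis using y
  proof (cases rule: verts_cases)
    case core_y: core
    have "2 \<le> length (filter (\<lambda>w. w \<noteq> y \<and> w \<notin> set (nbr y)) (nbr x))"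
      using core_separated(1) core core_y \<open>x \<noteq> y\<close> by blast
    from two_of_filter[OF this nb(2)] obtain w1 w2 where "w1 \<noteq> w2" "w1 \<in> set (nbr x)" "w2 \<in> set (nbr x)"
      "w1 \<noteq> y \<and> w1 \<notin> set (nbr y)" "w2 \<noteq> y \<and> w2 \<notin> set (nbr y)"
      by blast
    then show ?thesis using core core_y nb(1) by (intro bexI[of _ w1] bexI[of _ w2]) (auto simp: adj_core)
  next
    case (Lv k)
    have "2 \<le> length (filter (\<lambda>w. w \<notin> set Bs) (nbr x))" using core_separated(2) core by blast
    from two_of_filter[OF this nb(2)] obtain w1 w2 where "w1 \<noteq> w2" "w1 \<in> set (nbr x)" "w2 \<in> set (nbr x)" "w1 \<notin> set Bs" "w2 \<notin> set Bs"
      by blast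
    moreover from this have "w1 \<in> set core" "w2 \<in> set core" using nb(1) by blast+
    ultimately show ?thesis using core Lv
      by (intro bexI[of _ w1] bexI[of _ w2]) (auto simp: adj_core adj_L_core)
  next
    case (Tv k j)
    have "2 \<le> length (filter (\<lambda>w. w \<notin> set (contact j)) (nbr x))" using core_separated(3) core by blast
    from two_of_filter[OF this nb(2)] obtain w1 w2 where "w1 \<noteq> w2" "w1 \<in> set (nbr x)" "w2 \<in> set (nbr x)" "w1 \<notin> set (contact j)" "w2 \<notin> set (contact j)"
      by blast
    moreover from this have "w1 \<in> set core" "w2 \<in> set core" using nb(1) by blast+
    ultimately show ?thesis using core Tv
      by (intro bexI[of _ w1] bexI[of _ w2]) (auto simp: adj_core adj_T_core)
  qed
next
  case (Lv i)
  show ?thesis using y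
  proof (cases rule: verts_cases)
    case core
    show ?thesis
    proof (cases "\<exists>j. y \<in> set (contact j)")
      case True
      then obtain j where j: "y \<in> set (contact j)" by blast
      \<comment> \<open>Here \<open>y\<close> is adjacent to \<open>Tv i j\<close>, so a vertex of
        \<open>Bs\<close> outside the star of \<open>y\<close> replaces that satellite.\<close>
      obtain b where b: "b \<in> set Bs" "b \<noteq> y" "b \<notin> set (nbr y)" using core_separated(4) core by blast
      then show ?thesis using Lv core j contact_disjoint[OF j, of "\<not> j"] Bs_core[OF b(1)]
        by (intro bexI[of _ "Tv i (\<not> j)"] bexI[of _ b]) (auto simp: adj_core adj_L_core adj_T_core)
    next
      case False
      then have "y \<notin> set (contact True)" "y \<notin> set (contact False)" by blast+
      then show ?thesis using Lv core
        by (intro bexI[of _ "Tv i True"] bexI[of _ "Tv i False"]) (auto simp: adj_T_core)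
    qed
  next
    case Lv_y: (Lv k)
    then show ?thesis using Lv \<open>x \<noteq> y\<close>
      by (intro bexI[of _ "Tv i True"] bexI[of _ "Tv i False"]) auto
  next
    case (Tv k j)
    have "Bv 0 \<in> set Bs" "Bv 1 \<in> set Bs" by (simp_all add: Bs_def)
    then show ?thesis using Lv Tv Bs_core contact_Bv_Cv
      by (intro bexI[of _ "Bv 0"] bexI[of _ "Bv 1"]) (auto simp: adj_L_core adj_T_core)
  qed
next
  case (Tv i j)
  show ?thesis using y
  proof (cases rule: verts_cases)
    case core
    obtain m where m: "m \<in> set (contact j)" "m \<noteq> y" "m \<notin> set (nbr y)" using core_separated(5) core by blast
    have nB: "y \<in> set Bs \<Longrightarrow> y \<notin> set (contact l)" for l using contact_Bv_Cv by (auto simp: Bs_def)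
    \<comment> \<open>A vertex of \<open>Bs\<close> is adjacent to \<open>Lv i\<close> but to no
      satellite; any other core vertex is not adjacent to \<open>Lv i\<close>.\<close>
    show ?thesis
    proof (cases "y \<in> set Bs")
      case True
      then show ?thesis using Tv core m contact_core[OF m(1)] nB
        by (intro bexI[of _ "Tv i (\<not> j)"] bexI[of _ m]) (auto simp: adj_core adj_T_core)
    next
      case False
      then show ?thesis using Tv core m contact_core[OF m(1)]
        by (intro bexI[of _ "Lv i"] bexI[of _ m]) (auto simp: adj_core adj_T_core adj_L_core)
    qed
  next
    case (Lv k)
    obtain m m' where m: "m \<in> set (contact j)" "m' \<in> set (contact j)" "m \<noteq> m'" using contact_two by blast
    moreover have "m \<notin> set Bs" if "m \<in> set (contact j)" for m
      using that contact_Bv_Cv by (auto simp: Bs_def)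
    ultimately show ?thesis using Tv Lv contact_core[OF m(1)] contact_core[OF m(2)]
      by (intro bexI[of _ m] bexI[of _ m']) (auto simp: adj_T_core adj_L_core)
  next
    case Tv_y: (Tv k l)
    \<comment> \<open>For \<open>j = l\<close> the contacts coincide, but then
      \<open>i \<noteq> k\<close>, and the triangle formed by \<open>Lv i\<close> and its satellites
      provides the witnesses.\<close>
    show ?thesis
    proof (cases "j = l")
      case True
      then show ?thesis using Tv Tv_y \<open>x \<noteq> y\<close>
        by (intro bexI[of _ "Lv i"] bexI[of _ "Tv i (\<not> j)"]) auto
    next
      case False
      obtain m m' where m: "m \<in> set (contact j)" "m' \<in> set (contact j)" "m \<noteq> m'" using contact_two by blast
      then show ?thesis using Tv Tv_y contact_core[OF m(1)] contact_core[OF m(2)] contact_disjoint False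
        by (intro bexI[of _ m] bexI[of _ m']) (auto simp: adj_T_core)
    qed
  qed
qed

section \<open>Passage to the coded graph\<close>

sublocale raag "to_nat ` verts" edges "RAAG (to_nat ` verts) edges"
  by unfold_locales (rule simple_graph_edges, rule HOL.refl)

lemma edges_iff: "x \<in> verts \<Longrightarrow> y \<in> verts \<Longrightarrow> {to_nat x, to_nat y} \<in> edges \<longleftrightarrow> adj x y"
  unfolding edges_def using adj_sym by (auto simp: doubleton_eq_iff inj_eq[OF inj_to_nat])

lemma lk_iff: "x \<in> verts \<Longrightarrow> y \<in> verts \<Longrightarrow> to_nat y \<in> lk (to_nat x) \<longleftrightarrow> adj x y"
  by (simp add: lk_def edges_iff)

lemma st_iff: "x \<in> verts \<Longrightarrow> y \<in> verts \<Longrightarrow> to_nat y \<in> st (to_nat x) \<longleftrightarrow> y = x \<or> adj x y"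
  by (simp add: lk_iff inj_eq[OF inj_to_nat])

lemma link_separated_gamma: link_separated
  unfolding link_separated_def
proof (intro ballI impI, elim imageE)
  fix v v' x y assume "v \<noteq> v'" "v = to_nat x" "x \<in> verts" "v' = to_nat y" "y \<in> verts"
  moreover from this obtain w1 w2 where "w1 \<in> verts" "w2 \<in> verts" "w1 \<noteq> w2" "adj x w1" "adj x w2"
    "w1 \<noteq> y" "w2 \<noteq> y" "\<not> adj y w1" "\<not> adj y w2"
    using adj_separated[of x y] by auto
  ultimately show "\<exists>w1 w2. w1 \<noteq> w2 \<and> w1 \<in> lk v - st v' \<and> w2 \<in> lk v - st v'"
    by (intro exI[of _ "to_nat w1"] exI[of _ "to_nat w2"]) (simp add: st_iff lk_iff inj_eq[OF inj_to_nat])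
qed

text \<open>Every vertex added by \<open>sweep\<close> is a \<open>reach\<close> step, because
  \<open>Z\<close> covers the part of the star of \<open>u\<close> inside \<open>P\<close>. Thus the
  computed check \<open>spans\<close> yields reachability.\<close>

lemma flood_reach:
  assumes u: "u \<in> verts" and P: "set P \<subseteq> S" "set P \<subseteq> set core"
    and Z: "\<And>x. x \<in> set P \<Longrightarrow> x \<notin> set Z \<Longrightarrow> x \<noteq> u \<and> \<not> adj u x"
    and sp: "spans P Z U" and "distinct P"
  obtains v0 v1 where "v0 \<in> set P" "v1 \<in> set P" "v0 \<noteq> v1" "v0 \<noteq> u \<and> \<not> adj u v0" "v1 \<noteq> u \<and> \<not> adj u v1"
    "\<And>y. y \<in> set P \<Longrightarrow> y \<in> set U \<or> to_nat y \<in> reach (to_nat ` S) (to_nat u) (to_nat v0)"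
proof -
  have "2 \<le> length (filter (\<lambda>x. x \<notin> set Z) P)" using sp by (simp add: spans_def)
  from two_of_filter[OF this \<open>distinct P\<close>] obtain v0 v1 where v: "v0 \<noteq> v1" "v0 \<in> set P" "v1 \<in> set P" "v0 \<notin> set Z" "v1 \<notin> set Z"
    "v0 = hd (filter (\<lambda>x. x \<notin> set Z) P)"
    by blast
  let ?R = "reach (to_nat ` S) (to_nat u) (to_nat v0)"
  have "set K \<subseteq> {y \<in> set P. to_nat y \<in> ?R} \<Longrightarrow> set Q \<subseteq> set P \<Longrightarrow>
      set (fold (sweep Z) Q K) \<subseteq> {y \<in> set P. to_nat y \<in> ?R}" for Q K
  proof (induction Q arbitrary: K)
    case (Cons y Q)
    have "set (sweep Z y K) \<subseteq> {y \<in> set P. to_nat y \<in> ?R}"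
    proof (cases "\<exists>x\<in>set (nbr y). x \<notin> set Z \<and> x \<in> set K")
      case True
      then obtain x where x: "x \<in> set (nbr y)" "x \<notin> set Z" "x \<in> set K" by blast
      have y: "y \<in> set P" "y \<in> set core" using Cons P by auto
      have xP: "x \<in> set P" "to_nat x \<in> ?R" using x Cons by auto
      then have xv: "x \<in> set core" using P by auto
      have "to_nat x \<notin> st (to_nat u)" using Z[OF xP(1) x(2)] st_iff[OF u, of x] xv by simp
      moreover have "to_nat y \<in> lk (to_nat x)"
        using core_nbr[OF y(2) x(1)] xv y by (simp add: lk_iff adj_core)
      moreover have "to_nat y \<in> to_nat ` S" using y P by blast
      ultimately have "to_nat y \<in> ?R" using reach.step[OF xP(2)] by blast
      then show ?thesis using Cons.prems y by (auto simp: sweep_def)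
    qed (use Cons.prems in \<open>auto simp: sweep_def\<close>)
    then show ?case using Cons by simp
  qed simp
  from this[of "[v0]" "P @ rev P @ P @ rev P"] have "set (flood P Z) \<subseteq> {y \<in> set P. to_nat y \<in> ?R}"
    unfolding flood_def using v by (auto intro: reach.start)
  then have "y \<in> set U \<or> to_nat y \<in> ?R" if "y \<in> set P" for y
    using sp that unfolding spans_def by auto
  then show ?thesis using that[of v0 v1] v Z by blast
qed

lemma rigidI:
  assumes "S \<subseteq> verts"
    and "\<And>u. u \<in> verts \<Longrightarrow> \<exists>v0\<in>S. \<exists>v1\<in>S. v0 \<noteq> v1 \<and> v0 \<noteq> u \<and> \<not> adj u v0 \<and> v1 \<noteq> u \<and> \<not> adj u v1 \<and>
      (\<forall>y\<in>S. y \<noteq> u \<longrightarrow> to_nat y \<in> reach (to_nat ` S) (to_nat u) (to_nat v0))"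
  shows "rigid (to_nat ` S)"
  unfolding rigid_def
proof (intro conjI ballI)
  show "to_nat ` S \<subseteq> to_nat ` verts" using assms(1) by blast
  fix u assume "u \<in> to_nat ` verts"
  then obtain x where x: "x \<in> verts" "u = to_nat x" by blast
  then obtain v0 v1 where v: "v0 \<in> S" "v1 \<in> S" "v0 \<noteq> v1" "v0 \<noteq> x" "\<not> adj x v0" "v1 \<noteq> x" "\<not> adj x v1"
    "\<forall>y\<in>S. y \<noteq> x \<longrightarrow> to_nat y \<in> reach (to_nat ` S) u (to_nat v0)"
    using assms(2) by metis
  then have "v0 \<in> verts" "v1 \<in> verts" using assms(1) by auto
  then have "to_nat v0 \<notin> st u" "to_nat v1 \<notin> st u" using v x st_iff by auto
  moreover have "to_nat ` S - {u} \<subseteq> reach (to_nat ` S) u (to_nat v0)" using v(8) x by auto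
  ultimately show "\<exists>v0 v1. v0 \<in> to_nat ` S - st u \<and> v1 \<in> to_nat ` S - st u \<and> v0 \<noteq> v1 \<and>
      to_nat ` S - {u} \<subseteq> reach (to_nat ` S) u v0"
    using v by (intro exI[of _ "to_nat v0"] exI[of _ "to_nat v1"]) (simp add: inj_eq[OF inj_to_nat])
qed

lemma distinct_BD: "distinct (Bs @ Ds)" and distinct_BC: "distinct (Bs @ Cs)"
  by code_simp+

lemma rigid_gamma_BC: "rigid (to_nat ` (set (Bs @ Cs)))"
proof (rule rigidI)
  show "set (Bs @ Cs) \<subseteq> verts" using Bs_core Cs_core by auto
  have P: "set (Bs @ Cs) \<subseteq> set (Bs @ Cs)" "set (Bs @ Cs) \<subseteq> set core" using Bs_core Cs_core by auto
  fix u assume u: "u \<in> verts"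
  \<comment> \<open>\<open>Z\<close> covers the trace of the star of \<open>u\<close> on
    \<open>Bs @ Cs\<close>, and \<open>U\<close> exempts \<open>u\<close> itself.\<close>
  have "\<exists>Z U. spans (Bs @ Cs) Z U \<and> set U \<subseteq> {u} \<and> (\<forall>x\<in>set (Bs @ Cs). x \<notin> set Z \<longrightarrow> x \<noteq> u \<and> \<not> adj u x)"
    using u
  proof (cases rule: verts_cases)
    case core
    then show ?thesis using core_spans(2) P by (intro exI[of _ "u # nbr u"] exI[of _ "[u]"]) (auto simp: adj_core)
  next
    case (Lv i)
    then show ?thesis using core_spans(4) P
      by (intro exI[of _ Bs] exI[of _ "[]"]) (auto simp: adj_L_core)
  next
    case (Tv i j)
    have "x \<notin> set (contact j)" if "x \<in> set (Bs @ Cs)" for x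
      using that contact_Bv_Cv by (auto simp: Bs_def Cs_def)
    then show ?thesis using core_spans(6) P Tv
      by (intro exI[of _ "[]"] exI[of _ "[]"]) (auto simp: adj_T_core)
  qed
  then obtain Z U where ZU: "spans (Bs @ Cs) Z U" "set U \<subseteq> {u}"
    "\<And>x. x \<in> set (Bs @ Cs) \<Longrightarrow> x \<notin> set Z \<Longrightarrow> x \<noteq> u \<and> \<not> adj u x" by blast
  obtain v0 v1 where v: "v0 \<in> set (Bs @ Cs)" "v1 \<in> set (Bs @ Cs)" "v0 \<noteq> v1" "v0 \<noteq> u \<and> \<not> adj u v0" "v1 \<noteq> u \<and> \<not> adj u v1"
    "\<And>y. y \<in> set (Bs @ Cs) \<Longrightarrow> y \<in> set U \<or> to_nat y \<in> reach (to_nat ` set (Bs @ Cs)) (to_nat u) (to_nat v0)"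
    using flood_reach[OF u P ZU(3,1) distinct_BC] by blast
  have "\<forall>y\<in>set (Bs @ Cs). y \<noteq> u \<longrightarrow> to_nat y \<in> reach (to_nat ` set (Bs @ Cs)) (to_nat u) (to_nat v0)"
    using v(6) ZU(2) by blast
  with v(1-5) show "\<exists>v0\<in>set (Bs @ Cs). \<exists>v1\<in>set (Bs @ Cs). v0 \<noteq> v1 \<and> v0 \<noteq> u \<and> \<not> adj u v0 \<and> v1 \<noteq> u \<and> \<not> adj u v1 \<and>
      (\<forall>y\<in>set (Bs @ Cs). y \<noteq> u \<longrightarrow> to_nat y \<in> reach (to_nat ` set (Bs @ Cs)) (to_nat u) (to_nat v0))"
    by blast
qed

definition DT :: "vert set" where "DT = set Ds \<union> {Tv i j | i j. i < n}"

text \<open>The core part comes from \<open>flood_reach\<close>; a satellite is then usually reached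
  from a contact outside the star of \<open>u\<close>.\<close>

lemma rigid_gamma_BD: "rigid (to_nat ` (set Bs \<union> DT))"
proof (rule rigidI)
  let ?S = "set Bs \<union> DT"
  show S: "?S \<subseteq> verts" using Bs_core Ds_core by (auto simp: DT_def)
  have P: "set (Bs @ Ds) \<subseteq> ?S" "set (Bs @ Ds) \<subseteq> set core" using Bs_core Ds_core by (auto simp: DT_def)
  have TS: "Tv i j \<in> ?S" if "i < n" for i j using that by (auto simp: DT_def)
  fix u assume u: "u \<in> verts"
  have "\<exists>Z U. spans (Bs @ Ds) Z U \<and> set U \<subseteq> {u} \<and> (\<forall>x\<in>set (Bs @ Ds). x \<notin> set Z \<longrightarrow> x \<noteq> u \<and> \<not> adj u x)"
    using u
  proof (cases rule: verts_cases)
    case core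
    then show ?thesis using core_spans(1) P by (intro exI[of _ "u # nbr u"] exI[of _ "[u]"]) (auto simp: adj_core)
  next
    case (Lv i)
    then show ?thesis using core_spans(3) P
      by (intro exI[of _ Bs] exI[of _ "[]"]) (auto simp: adj_L_core)
  next
    case (Tv i j)
    then show ?thesis using core_spans(5) P
      by (intro exI[of _ "contact j"] exI[of _ "[]"]) (auto simp: adj_T_core)
  qed
  then obtain Z U where ZU: "spans (Bs @ Ds) Z U" "set U \<subseteq> {u}"
    "\<And>x. x \<in> set (Bs @ Ds) \<Longrightarrow> x \<notin> set Z \<Longrightarrow> x \<noteq> u \<and> \<not> adj u x" by blast
  obtain v0 v1 where v: "v0 \<in> set (Bs @ Ds)" "v1 \<in> set (Bs @ Ds)" "v0 \<noteq> v1" "v0 \<noteq> u \<and> \<not> adj u v0" "v1 \<noteq> u \<and> \<not> adj u v1"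
    "\<And>y. y \<in> set (Bs @ Ds) \<Longrightarrow> y \<in> set U \<or> to_nat y \<in> reach (to_nat ` ?S) (to_nat u) (to_nat v0)"
    using flood_reach[OF u P ZU(3,1) distinct_BD] by blast
  let ?R = "reach (to_nat ` ?S) (to_nat u) (to_nat v0)"
  have step: "to_nat y \<in> ?R" if "to_nat x \<in> ?R" "x \<in> verts" "x \<noteq> u" "\<not> adj u x" "y \<in> ?S" "adj x y" for x y
  proof (rule reach.step[OF that(1)])
    show "to_nat x \<notin> st (to_nat u)" using that st_iff[OF u, of x] by blast
    show "to_nat y \<in> lk (to_nat x)" using that S lk_iff[of x y] by blast
    show "to_nat y \<in> to_nat ` ?S" using that by blast
  qed
  have D: "to_nat m \<in> ?R" if "m \<in> set (contact j)" "m \<noteq> u" for m j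
    using v(6)[of m] contact_Ds[OF that(1)] ZU(2) that(2) by auto
  have T1: "to_nat (Tv k l) \<in> ?R" if "k < n" "m \<in> set (contact l)" "m \<noteq> u" "\<not> adj u m" for k l m
    using step[OF D[OF that(2,3)] _ that(3,4) TS[OF that(1)]] contact_core that(2)
    by (simp add: adj_T_core)
  have T: "to_nat (Tv k l) \<in> ?R" if "k < n" "Tv k l \<noteq> u" for k l
    using u
  proof (cases rule: verts_cases)
    case core
    then obtain m where "m \<in> set (contact l)" "m \<noteq> u" "m \<notin> set (nbr u)" using core_separated(5) by blast
    then show ?thesis using T1[OF that(1)] contact_core core by (auto simp: adj_core)
  next
    case (Lv i)
    obtain m where "m \<in> set (contact l)" using contact_two by blast
    moreover from this have "m \<notin> set Bs" using contact_Bv_Cv by (auto simp: Bs_def)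
    moreover have "m \<in> set core" using calculation(1) by (rule contact_core)
    moreover from this have "m \<noteq> u" using Lv by auto
    ultimately show ?thesis using T1[OF that(1)] Lv by (simp add: adj_L_core)
  next
    case (Tv i j)
    have *: "to_nat (Tv k l) \<in> ?R" if "k < n" "l \<noteq> j" for k l
    proof -
      obtain m where "m \<in> set (contact l)" using contact_two by blast
      moreover from this have "m \<in> set core" by (rule contact_core)
      moreover from this have "m \<noteq> u" using Tv by auto
      ultimately show ?thesis using T1[OF that(1)] contact_disjoint that(2) Tv by (simp add: adj_T_core)
    qed
    show ?thesis
    proof (cases "l = j")
      case True
      \<comment> \<open>All contacts of \<open>Tv k j\<close> are adjacent to
        \<open>u = Tv i j\<close>, so it is reached through \<open>Tv k (\<not> j)\<close>, which
        lies outside the star because \<open>k \<noteq> i\<close>.\<close>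
      then have "k \<noteq> i" using that Tv by auto
      then show ?thesis using step[OF *[OF that(1), of "\<not> j"] _ _ _ TS[OF that(1)], of l] that(1) True Tv by simp
    qed (use * that in blast)
  qed
  have "to_nat y \<in> ?R" if "y \<in> ?S" "y \<noteq> u" for y
    using that T v(6)[of y] ZU(2) by (auto simp: DT_def)
  then show "\<exists>v0\<in>?S. \<exists>v1\<in>?S. v0 \<noteq> v1 \<and> v0 \<noteq> u \<and> \<not> adj u v0 \<and> v1 \<noteq> u \<and> \<not> adj u v1 \<and>
      (\<forall>y\<in>?S. y \<noteq> u \<longrightarrow> to_nat y \<in> reach (to_nat ` ?S) (to_nat u) (to_nat v0))"
    using v(1-5) P(1) by blast
qed

sublocale raag_config "to_nat ` verts" edges "RAAG (to_nat ` verts) edges"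
  "to_nat ` Lv ` {..<n}" "to_nat ` set Bs" "to_nat ` set Cs" "to_nat ` DT"
proof unfold_locales
  show "to_nat ` verts = to_nat ` Lv ` {..<n} \<union> to_nat ` set Bs \<union> to_nat ` set Cs \<union> to_nat ` DT"
    by (auto simp: verts_def DT_def core_def)
  show "to_nat ` set Cs \<inter> (to_nat ` Lv ` {..<n} \<union> to_nat ` set Bs \<union> to_nat ` DT) = {}"
    "to_nat ` Lv ` {..<n} \<inter> to_nat ` set Bs = {}"
    by (auto simp: Bs_def Cs_def Ds_def DT_def inj_eq[OF inj_to_nat])
  show "rigid (to_nat ` set Bs \<union> to_nat ` DT)" "rigid (to_nat ` set Bs \<union> to_nat ` set Cs)"
    using rigid_gamma_BD rigid_gamma_BC by (simp_all add: image_Un)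
  show "to_nat ` set Cs \<noteq> {}" by (simp add: Cs_def)
next
  fix c assume "c \<in> to_nat ` set Cs"
  then obtain x where x: "x \<in> set Cs" "c = to_nat x" by blast
  show "lk c \<subseteq> to_nat ` set Bs \<union> to_nat ` set Cs"
  proof
    fix w assume w: "w \<in> lk c"
    then obtain y where y: "y \<in> verts" "w = to_nat y" using lkD by blast
    then have "adj x y" using w x lk_iff[of x y] Cs_core by simp
    moreover obtain i where "x = Cv i" "i < 9" using x by (auto simp: Cs_def)
    ultimately show "w \<in> to_nat ` set Bs \<union> to_nat ` set Cs"
      using y Cs_core[OF x(1)] contact_Bv_Cv core_nbr[of x y]
      by (cases rule: verts_cases[OF y(1)])
         (auto simp: adj_core adj_L_core adj_T_core Bs_def Cs_def)
  qed
next
  fix b assume "b \<in> to_nat ` set Bs"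
  then show "to_nat ` Lv ` {..<n} \<subseteq> lk b"
    using Bs_core by (auto simp: lk_iff adj_L_core)
next
  fix l x assume "l \<in> to_nat ` Lv ` {..<n}" "x \<in> to_nat ` verts"
    and *: "\<And>w. w \<in> lk l \<Longrightarrow> w \<in> to_nat ` set Bs \<union> to_nat ` DT \<Longrightarrow> x \<in> st w"
  then obtain i y where i: "i < n" "l = to_nat (Lv i)" and y: "y \<in> verts" "x = to_nat y" by blast
  have adj: "y = w \<or> adj w y" if "adj (Lv i) w" "w \<in> set Bs \<union> DT" for w
  proof -
    have "w \<in> verts" using that(2) Bs_core Ds_core by (auto simp: DT_def)
    then show ?thesis using *[of "to_nat w"] that i y lk_iff[of "Lv i" w] st_iff[of w y] by auto
  qed
  have T: "y = Tv i j \<or> adj (Tv i j) y" for j using adj[of "Tv i j"] i by (auto simp: DT_def)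
  have B: "y = Bv k \<or> adj (Bv k) y" if "k < 9" for k
    using adj[of "Bv k"] that adj_L_core(1)[of "Bv k" i] Bs_core by (auto simp: Bs_def)
  \<comment> \<open>No core vertex is a contact of both satellites, another \<open>Lv k\<close> is
    not adjacent to the satellites of \<open>i\<close>, and satellites are not adjacent to
    \<open>Bs\<close>.\<close>
  from y(1) have "y = Lv i"
  proof (cases rule: verts_cases)
    case core
    then show ?thesis using T[of True] T[of False] contact_disjoint by (auto simp: adj_T_core)
  next
    case (Lv k)
    then show ?thesis using T[of True] by simp
  next
    case (Tv k j)
    have "Bv 0 \<in> set core" by (simp add: core_def Bs_def)
    then show ?thesis using B[of 0] Tv contact_Bv_Cv by (simp add: adj_T_core)
  qed
  then show "x = l" using i y by simp
next
  fix x assume "x \<in> to_nat ` verts" and *: "\<And>b. b \<in> to_nat ` set Bs \<Longrightarrow> x \<in> st b"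
  then obtain y where y: "y \<in> verts" "x = to_nat y" by blast
  have B: "y = b \<or> adj b y" if "b \<in> set Bs" for b
    using *[of "to_nat b"] that y st_iff[of b y] Bs_core by auto
  from y(1) show "x \<in> to_nat ` Lv ` {..<n}"
  proof (cases rule: verts_cases)
    case core
    then obtain b where "b \<in> set Bs" "b \<noteq> y" "b \<notin> set (nbr y)" using core_separated(4) by blast
    then show ?thesis using B[of b] Bs_core[of b] core core_nbr[of b y] by (auto simp: adj_core)
  next
    case (Lv i)
    then show ?thesis using y by simp
  next
    case (Tv k j)
    have "Bv 0 \<in> set Bs" by (simp add: Bs_def)
    then show ?thesis using B[of "Bv 0"] Bs_core Tv contact_Bv_Cv by (auto simp: adj_T_core)
  qed
next
  fix l assume "l \<in> to_nat ` Lv ` {..<n}"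
  then obtain i where i: "i < n" "l = to_nat (Lv i)" by blast
  have "Dv 0 \<in> set Ds" "Dv 0 \<notin> set Bs" by (auto simp: Ds_def Bs_def)
  then show "\<exists>d\<in>to_nat ` DT. l \<notin> st d"
    using i Ds_core st_iff[of "Dv 0" "Lv i"]
    by (intro bexI[of _ "to_nat (Dv 0)"]) (auto simp: adj_L_core DT_def)
qed

end

theorem theorem3p1:
  fixes V\<Lambda> :: "'a set" and E\<Lambda> :: "'a set set"
  assumes "simple_graph V\<Lambda> E\<Lambda>"
  shows "\<exists>(V\<Gamma> :: nat set) E\<Gamma>. simple_graph V\<Gamma> E\<Gamma> \<and>
           RAAG V\<Lambda> E\<Lambda> \<cong> (Out (RAAG V\<Gamma> E\<Gamma>))\<lparr>carrier := PSO V\<Gamma> E\<Gamma>\<rparr> \<and>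
           finite (rcosets\<^bsub>Out (RAAG V\<Gamma> E\<Gamma>)\<^esub> PSO V\<Gamma> E\<Gamma>)"
proof -
  have fin: "finite V\<Lambda>" using assms by (simp add: simple_graph_def)
  define n where "n = card V\<Lambda>"
  obtain f where f: "bij_betw f V\<Lambda> {..<n}"
    using fin by (metis n_def bij_betw_iff_card finite_lessThan card_lessThan)
  \<comment> \<open>A relation on all naturals, as \<open>gamma\<close> requires; it is false
    outside \<open>{..<n}\<close>, the range of \<open>f\<close>.\<close>
  define F where "F i j \<longleftrightarrow> (\<exists>x y. x \<in> V\<Lambda> \<and> y \<in> V\<Lambda> \<and> {x, y} \<in> E\<Lambda> \<and> i = f x \<and> j = f y)" for i j
  have irr: "x \<noteq> y" if "{x, y} \<in> E\<Lambda>" for x y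
    using that assms unfolding simple_graph_def by (metis doubleton_eq_iff)
  have inj: "f x = f y \<longleftrightarrow> x = y" if "x \<in> V\<Lambda>" "y \<in> V\<Lambda>" for x y
    using f that by (auto simp: bij_betw_def inj_on_def)
  interpret gamma n F
  proof
    have "F j i" if F: "F i j" for i j
    proof -
      obtain x y where "x \<in> V\<Lambda>" "y \<in> V\<Lambda>" "{y, x} \<in> E\<Lambda>" "i = f x" "j = f y"
        using F by (auto simp: F_def insert_commute)
      then show ?thesis unfolding F_def by blast
    qed
    then show "F i j \<longleftrightarrow> F j i" for i j by blast
    show "\<not> F i i" for i unfolding F_def using irr inj by metis
  qed
  have "bij_betw (\<lambda>x. to_nat (Lv (f x))) V\<Lambda> (to_nat ` Lv ` {..<n})"
    unfolding bij_betw_def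
  proof
    show "inj_on (\<lambda>x. to_nat (Lv (f x))) V\<Lambda>" using inj by (auto simp: inj_on_def inj_eq[OF inj_to_nat])
    show "(\<lambda>x. to_nat (Lv (f x))) ` V\<Lambda> = to_nat ` Lv ` {..<n}"
      using f by (simp add: bij_betw_def image_image[symmetric, of "\<lambda>i. to_nat (Lv i)" f]) (simp add: image_image)
  qed
  moreover have "{x, y} \<in> E\<Lambda> \<longleftrightarrow> {to_nat (Lv (f x)), to_nat (Lv (f y))} \<in> edges"
    if xy: "x \<in> V\<Lambda>" "y \<in> V\<Lambda>" for x y
  proof -
    have "f x < n" "f y < n" using f xy by (auto simp: bij_betw_def)
    then have "{to_nat (Lv (f x)), to_nat (Lv (f y))} \<in> edges \<longleftrightarrow> F (f x) (f y)"
      by (simp add: edges_iff)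
    also have "\<dots> \<longleftrightarrow> {x, y} \<in> E\<Lambda>" unfolding F_def using xy inj by metis
    finally show ?thesis by simp
  qed
  ultimately have "RAAG V\<Lambda> E\<Lambda> \<cong> (Out (RAAG (to_nat ` verts) edges))\<lparr>carrier := PSO (to_nat ` verts) edges\<rparr>"
    by (rule RAAG_iso_PSO[OF assms])
  then show ?thesis
    using simple_graph_edges PSO_finite_index[OF link_separated_gamma] by blast
qed

end
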